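(* (Setting in context.) For the dihedral group $I_{2k}$ with multiplicity $(\alpha,\beta)$, $\alpha,\beta>0$, and $z_1,z_2\in\mathbb{C}\setminus\{0\}$, for $\mathrm{Re}\,s$ sufficiently large \[\mathcal{L}(E_{\kappa}(z_{1},z_{2},t))(s)=\Gamma(k(\alpha+\beta)+1)\int_{-1}^{1}\int_{-1}^{1}f_{I_{2k}}(s)\,d\mu_{\alpha}(u)\,d\mu_{\beta}(v).\] For an odd-$k$ dihedral group $I_k$ with multiplicity $\alpha>0$, \[\mathcal{L}(E_{\kappa}(z_{1},z_{2},t))(s)=\Gamma(k\alpha+1)\int_{-1}^{1}g_{I_{k}}(s)\,d\mu_{\alpha}(u).\] Here $f_{I_{2k}}$ and $g_{I_k}$ are evaluated at $\omega=z_1/|z_1|$, $\eta=z_2/|z_2|$, $b=|z_1||z_2|$ and the given $u,v$.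
   Context: Identify $\mathbb{R}^2$ with $\mathbb{C}$. $I_N$ denotes the dihedral group of order $2N$ (symmetries of the regular $N$-gon). For a reflection group $G$ with root system $\mathcal R$, positive subsystem $\mathcal R_+$, and $G$-invariant multiplicity $\kappa$, the Dunkl operators are $T_if(x)=\partial_if(x)+\sum_{\alpha\in\mathcal R_+}\kappa(\alpha)\alpha_i\frac{f(x)-f(r_\alpha x)}{\langle\alpha,x\rangle}$, $\Delta_\kappa=T_1^2+T_2^2$, and $\mathcal H_j(\upsilon_\kappa)$ is the space of homogeneous polynomials of degree $j$ annihilated by $\Delta_\kappa$. For $I_{2k}$, $\kappa$ takes value $\alpha$ on one class of reflections and $\beta$ on the other, with weight $\upsilon_\kappa(z)=|\frac{z^k-\bar z^k}{2i}|^{2\alpha}|\frac{z^k+\bar z^k}{2}|^{2\beta}$ and $\langle\kappa\rangle=k(\alpha+\beta)$; for odd $k$, $I_k$ has one class, weight $\upsilon_\kappa(z)=|\frac{z^k-\bar z^k}{2i}|^{2\alpha}$ and $\langle\kappa\rangle=k\alpha$. $P_j(G;\omega,\eta)$ is the reproducing kernel of $\mathcal H_j(\upsilon_\kappa)$ restricted to the unit circle with respect to $\langle f,g\rangle=\int_{S^1}f\bar g\,\upsilon_\kappa d\sigma/\int_{S^1}\upsilon_\kappa d\sigma$. For $z_1=|z_1|\omega$, $z_2=|z_2|\eta$, $b=|z_1||z_2|$, $t\ge0$: $E_\kappa(z_1,z_2,t)=2^{\langle\kappa\rangle}\Gamma(\langle\kappa\rangle+1)\sum_{j\ge0}(-i)^jb^{-\langle\kappa\rangle}J_{j+\langle\kappa\rangle}(bt)P_j(G;\omega,\eta)$;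 the Dunkl kernel is $E_\kappa(z_1,z_2)=E_\kappa(z_1,z_2,1)$. $\mathcal L$ is the Laplace transform in $t$. $d\mu_\gamma(w)=c_\gamma(1+w)(1-w^2)^{\gamma-1}dw$ on $[-1,1]$ with $c_\gamma=B(\frac12,\gamma)^{-1}$. With $r=\sqrt{s^2+b^2}$, $R=s+r$, $w=-ib/R$, $X(u,v)=(\mathrm{Im}\,\omega^{k})(\mathrm{Im}\,\eta^{k})u+(\mathrm{Re}\,\omega^{k})(\mathrm{Re}\,\eta^{k})v$: $f_{I_{2k}}(s)=\frac{2^{k(\alpha+\beta)}}{rR^{k(\alpha+\beta)}}\frac{1-w^2}{1-w^{2k}}\frac{1-2w^{k}\mathrm{Re}(\omega^{k}\bar\eta^{k})+w^{2k}}{1-2\mathrm{Re}(\omega\bar\eta)w+w^2}\frac{1-w^{2k}}{(1-2w^{k}X(u,v)+w^{2k})^{\alpha+\beta+1}}$ and $g_{I_{k}}(s)=\frac{2^{k\alpha}}{rR^{k\alpha}}\frac{1-w^2}{1-w^{2k}}\frac{1-2w^{k}\mathrm{Re}(\omega^{k}\bar\eta^{k})+w^{2k}}{1-2\mathrm{Re}(\omega\bar\eta)w+w^2}\frac{1-w^{2k}}{(1-2w^{k}X(u,1)+w^{2k})^{\alpha+1}}$ (principal branches). *)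

theory Defs
  imports "HOL-Analysis.Analysis"
begin

text \<open>R^2 is identified with the complex plane.  The dihedral group I_N (order 2N)
  has N reflections, namely the reflections across the lines through 0 at angles
  theta_j = pi j / N, j = 0..N-1.  We take as (positive) root for the j-th reflection
  the unit normal i * cis theta_j; the Dunkl operator does not depend on the sign or
  length of the root.  A multiplicity is given as a function on the index j.\<close>

definition dih_theta :: "nat \<Rightarrow> nat \<Rightarrow> real" where
  "dih_theta N j = pi * real j / real N"

definition dih_root :: "nat \<Rightarrow> nat \<Rightarrow> complex" where
  "dih_root N j = \<i> * cis (dih_theta N j)"

definition dih_refl :: "nat \<Rightarrow> nat \<Rightarrow> complex \<Rightarrow> complex" where
  "dih_refl N j x = cis (2 * dih_theta N j) * cnj x"

definition inner2 :: "complex \<Rightarrow> complex \<Rightarrow> real" where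
  "inner2 a x = Re a * Re x + Im a * Im x"

definition pderiv2 :: "(complex \<Rightarrow> complex) \<Rightarrow> complex \<Rightarrow> complex \<Rightarrow> complex" where
  "pderiv2 f e x = vector_derivative (\<lambda>t::real. f (x + t *\<^sub>R e)) (at 0)"

text \<open>Dunkl operator T_i, with e = 1 (i = 1) or e = i (i = 2); the i-th
  component of the root a is inner2 a e.  The formula is used off the mirrors.\<close>
definition dunkl_T :: "nat \<Rightarrow> (nat \<Rightarrow> real) \<Rightarrow> complex \<Rightarrow> (complex \<Rightarrow> complex) \<Rightarrow> complex \<Rightarrow> complex" where
  "dunkl_T N kap e f x = pderiv2 f e x +
     (\<Sum>j<N. of_real (kap j * inner2 (dih_root N j) e) *
        (f x - f (dih_refl N j x)) / of_real (inner2 (dih_root N j) x))"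

definition dunkl_Lap :: "nat \<Rightarrow> (nat \<Rightarrow> real) \<Rightarrow> (complex \<Rightarrow> complex) \<Rightarrow> complex \<Rightarrow> complex" where
  "dunkl_Lap N kap f x = dunkl_T N kap 1 (dunkl_T N kap 1 f) x + dunkl_T N kap \<i> (dunkl_T N kap \<i> f) x"

definition off_mirrors :: "nat \<Rightarrow> complex set" where
  "off_mirrors N = {x. \<forall>j<N. inner2 (dih_root N j) x \<noteq> 0}"

definition homog_poly :: "nat \<Rightarrow> (complex \<Rightarrow> complex) set" where
  "homog_poly n = {f. \<exists>c::nat \<Rightarrow> complex. \<forall>z.
      f z = (\<Sum>a\<le>n. c a * of_real (Re z ^ a * Im z ^ (n - a)))}"

text \<open>h-harmonics of degree n: homogeneous polynomials annihilated by the Dunkl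
  Laplacian (checked on the dense open set off the mirrors, where the defining
  formula of the Dunkl operators applies literally).\<close>
definition h_harm :: "nat \<Rightarrow> (nat \<Rightarrow> real) \<Rightarrow> nat \<Rightarrow> (complex \<Rightarrow> complex) set" where
  "h_harm N kap n = {f \<in> homog_poly n. \<forall>x \<in> off_mirrors N. dunkl_Lap N kap f x = 0}"

definition circ_ip :: "(complex \<Rightarrow> real) \<Rightarrow> (complex \<Rightarrow> complex) \<Rightarrow> (complex \<Rightarrow> complex) \<Rightarrow> complex" where
  "circ_ip ups f g =
     (LINT \<theta>:{0..2*pi}|lborel. f (cis \<theta>) * cnj (g (cis \<theta>)) * of_real (ups (cis \<theta>)))
     / of_real (LINT \<theta>:{0..2*pi}|lborel. ups (cis \<theta>))"

definition repr_kernel :: "nat \<Rightarrow> (nat \<Rightarrow> real) \<Rightarrow> (complex \<Rightarrow> real) \<Rightarrow> nat \<Rightarrow> complex \<Rightarrow> complex \<Rightarrow> complex" where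
  "repr_kernel N kap ups n \<omega> \<eta> =
     (THE p. p \<in> h_harm N kap n \<and> (\<forall>f \<in> h_harm N kap n. circ_ip ups f p = f \<eta>)) \<omega>"

text \<open>Bessel function of the first kind, for x >= 0.\<close>
definition besselJ :: "real \<Rightarrow> real \<Rightarrow> real" where
  "besselJ \<nu> x = (\<Sum>m. (-1) ^ m / (fact m * Gamma (real m + \<nu> + 1)) * (x / 2) powr (2 * real m + \<nu>))"

definition dunkl_E :: "nat \<Rightarrow> (nat \<Rightarrow> real) \<Rightarrow> (complex \<Rightarrow> real) \<Rightarrow> real \<Rightarrow> complex \<Rightarrow> complex \<Rightarrow> real \<Rightarrow> complex" where
  "dunkl_E N kap ups K z1 z2 t =
     (let b = cmod z1 * cmod z2; \<omega> = z1 / of_real (cmod z1); \<eta> = z2 / of_real (cmod z2) in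
      of_real (2 powr K * Gamma (K + 1)) *
      (\<Sum>j. (- \<i>) ^ j * of_real (b powr (- K) * besselJ (real j + K) (b * t)) *
            repr_kernel N kap ups j \<omega> \<eta>))"

definition laplace :: "(real \<Rightarrow> complex) \<Rightarrow> complex \<Rightarrow> complex" where
  "laplace F s = (LINT t:{0..}|lborel. exp (- s * of_real t) * F t)"

definition laplace_exists :: "(real \<Rightarrow> complex) \<Rightarrow> complex \<Rightarrow> bool" where
  "laplace_exists F s = set_integrable lborel {0..} (\<lambda>t. exp (- s * of_real t) * F t)"

definition mu_dens :: "real \<Rightarrow> real \<Rightarrow> real" where
  "mu_dens \<gamma> w = (1 / Beta (1/2) \<gamma>) * (1 + w) * (1 - w\<^sup>2) powr (\<gamma> - 1)"

text \<open>Multiplicity and weight for I_{2k} (alpha on reflections across lines at angles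
  pi j'/k, i.e. even j, beta on the others) and for I_k, k odd.\<close>
definition kap_even :: "real \<Rightarrow> real \<Rightarrow> nat \<Rightarrow> real" where
  "kap_even \<alpha> \<beta> j = (if even j then \<alpha> else \<beta>)"

definition ups_even :: "nat \<Rightarrow> real \<Rightarrow> real \<Rightarrow> complex \<Rightarrow> real" where
  "ups_even k \<alpha> \<beta> z = cmod ((z ^ k - cnj z ^ k) / (2 * \<i>)) powr (2 * \<alpha>) *
                        cmod ((z ^ k + cnj z ^ k) / 2) powr (2 * \<beta>)"

definition ups_odd :: "nat \<Rightarrow> real \<Rightarrow> complex \<Rightarrow> real" where
  "ups_odd k \<alpha> z = cmod ((z ^ k - cnj z ^ k) / (2 * \<i>)) powr (2 * \<alpha>)"

definition lap_r :: "real \<Rightarrow> complex \<Rightarrow> complex" where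
  "lap_r b s = csqrt (s\<^sup>2 + of_real (b\<^sup>2))"

definition lap_R :: "real \<Rightarrow> complex \<Rightarrow> complex" where
  "lap_R b s = s + lap_r b s"

definition lap_w :: "real \<Rightarrow> complex \<Rightarrow> complex" where
  "lap_w b s = - \<i> * of_real b / lap_R b s"

definition Xk :: "nat \<Rightarrow> complex \<Rightarrow> complex \<Rightarrow> real \<Rightarrow> real \<Rightarrow> real" where
  "Xk k \<omega> \<eta> u v = Im (\<omega> ^ k) * Im (\<eta> ^ k) * u + Re (\<omega> ^ k) * Re (\<eta> ^ k) * v"

text \<open>Common form of f_{I_2k} and g_{I_k}: L plays the role of <kappa>, p of the
  exponent of the last denominator, X of X(u,v) resp. X(u,1).\<close>
definition f_gen :: "nat \<Rightarrow> real \<Rightarrow> real \<Rightarrow> complex \<Rightarrow> complex \<Rightarrow> real \<Rightarrow> real \<Rightarrow> complex \<Rightarrow> complex" where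
  "f_gen k L p \<omega> \<eta> b X s =
     (let r = lap_r b s; R = lap_R b s; w = lap_w b s in
      of_real (2 powr L) / (r * R powr of_real L) *
      ((1 - w\<^sup>2) / (1 - w ^ (2*k))) *
      ((1 - 2 * w ^ k * of_real (Re (\<omega> ^ k * cnj \<eta> ^ k)) + w ^ (2*k)) /
       (1 - 2 * of_real (Re (\<omega> * cnj \<eta>)) * w + w\<^sup>2)) *
      ((1 - w ^ (2*k)) / (1 - 2 * w ^ k * of_real X + w ^ (2*k)) powr of_real p))"

definition f_I2k :: "nat \<Rightarrow> real \<Rightarrow> real \<Rightarrow> complex \<Rightarrow> complex \<Rightarrow> real \<Rightarrow> real \<Rightarrow> real \<Rightarrow> complex \<Rightarrow> complex" where
  "f_I2k k \<alpha> \<beta> \<omega> \<eta> b u v s =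
     f_gen k (real k * (\<alpha> + \<beta>)) (\<alpha> + \<beta> + 1) \<omega> \<eta> b (Xk k \<omega> \<eta> u v) s"

definition g_Ik :: "nat \<Rightarrow> real \<Rightarrow> complex \<Rightarrow> complex \<Rightarrow> real \<Rightarrow> real \<Rightarrow> complex \<Rightarrow> complex" where
  "g_Ik k \<alpha> \<omega> \<eta> b u s =
     f_gen k (real k * \<alpha>) (\<alpha> + 1) \<omega> \<eta> b (Xk k \<omega> \<eta> u 1) s"

end

theory Submission
  imports Defs
begin

text \<open>Integration by parts for the angular Dunkl operator on the circle shows that the h-harmonics of degree \<open>n\<close>
  are exactly the homogeneous polynomials of degree \<open>n\<close> that are orthogonal to those of degree \<open>n - 2\<close>.
  Hence \<open>P n = K n - K (n - 2)\<close>, where \<open>K n\<close> is the reproducing kernel on the circle of all homogeneous polynomials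
  of degree \<open>n\<close>. That kernel is explicit: since the weight depends on \<open>z ^ k\<close> only, monomials with different residues
  modulo \<open>k\<close> separate, and on each residue class \<open>K n\<close> comes from the kernel
  \<open>Q m\<close> obtained by integrating the Gegenbauer polynomial of index \<open>\<alpha> + \<beta> + 1\<close> at \<open>X(u,v)\<close> against both measures.
  The reproducing property of \<open>Q m\<close> is a finite identity between the moments of the weight and those of
  the measures. Summing \<open>w ^ n * P n\<close> therefore gives \<open>1 - w ^ 2\<close> times two geometric sums times the integrated
  Gegenbauer generating function. The Laplace transform of \<open>J \<nu> (b t)\<close> is \<open>b powr \<nu> / (r * R powr \<nu>)\<close>, so the transform
  of the Dunkl kernel, taken term by term, is this generating function at \<open>w = - \<i> b / R\<close>.\<close>

section \<open>Laplace transforms of Bessel functions\<close>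

text \<open>The integration by parts rests on a polar form: on degree n, |x|^2 \<Delta> = A^2 + (n +
  K)^2 - S^2, with A the angular Dunkl operator, K the sum of the multiplicities and S the weighted
  sum of reflections. A is antisymmetric and S symmetric on the circle, so only the scalar (n + K)^2
  tells degrees apart. The index \<alpha> + \<beta> + 1 is one above the \<lambda> = \<alpha> +
  \<beta> of zonal h-harmonics for Z_2 x Z_2, since (n + \<lambda>) / \<lambda> times C_n of index
  \<lambda> is C_n - C_(n-2) of index \<lambda> + 1: all homogeneous polynomials collect every
  second degree. With it, the Pochhammer symbols of the Gegenbauer coefficients cancel the
  denominators of the circle moments, and what is left splits into an \<alpha> factor and a \<beta>
  factor. On the mirrors the formula for the Dunkl operators divides by 0, so identities are stated
  off them; on the circle this excludes finitely many angles. Only large Re s matters, so crude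
  bounds, geometric in the degree, suffice: the kernels grow at most like 4^n, which leads to |w|
  \<le> 1/8 and Re s > 8 b.\<close>

lemma alternating_sum_Suc:
  fixes f :: "nat \<Rightarrow> 'a::comm_ring_1"
  shows "(\<Sum>m\<le>Suc n. (-1) ^ (Suc n - m) * of_nat (Suc n choose m) * f m)
       = (\<Sum>m\<le>n. (-1) ^ (n - m) * of_nat (n choose m) * (f (Suc m) - f m))"
proof -
  have "(\<Sum>m\<le>Suc n. (-1) ^ (Suc n - m) * of_nat (Suc n choose m) * f m)
      = (-1) ^ Suc n * f 0 + (\<Sum>m\<le>n. (-1) ^ (n - m) * of_nat (Suc n choose Suc m) * f (Suc m))"
    by (simp only: sum.atMost_Suc_shift) simp
  also have "(\<Sum>m\<le>n. (-1) ^ (n - m) * of_nat (Suc n choose Suc m) * f (Suc m))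
     = (\<Sum>m\<le>n. (-1) ^ (n - m) * of_nat (n choose m) * f (Suc m))
     + (\<Sum>m\<le>n. (-1) ^ (n - m) * of_nat (n choose Suc m) * f (Suc m))"
    by (simp add: algebra_simps sum.distrib)
  also have "(-1) ^ Suc n * f 0 + \<dots> = (\<Sum>m\<le>n. (-1) ^ (n - m) * of_nat (n choose m) * f (Suc m))
     + (\<Sum>m\<le>Suc n. (-1) ^ (Suc n - m) * of_nat (n choose m) * f m)"
    by (simp only: sum.atMost_Suc_shift) (simp add: algebra_simps)
  also have "(\<Sum>m\<le>Suc n. (-1) ^ (Suc n - m) * of_nat (n choose m) * f m)
     = (\<Sum>m\<le>n. - ((-1) ^ (n - m) * of_nat (n choose m) * f m))"
    by (simp add: binomial_eq_0) (intro sum.cong, auto simp: Suc_diff_le)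
  finally show ?thesis by (simp add: algebra_simps sum_negf sum_subtractf)
qed

text \<open>An n-th finite difference of a monic polynomial of degree \<open>P\<close> in m: it
  kills degrees below n and gives n! at degree n. A first difference turns the rising factorial into
  \<open>P\<close> times the one of degree \<open>P - 1\<close> with its base point moved by 1,
  hence the induction generalises over \<open>P\<close> and \<open>c\<close>.\<close>

lemma alternating_sum_pochhammer:
  fixes c :: "'a::field_char_0"
  assumes "P \<le> n"
  shows "(\<Sum>m\<le>n. (-1) ^ (n - m) * of_nat (n choose m) * pochhammer (c + of_nat m) P)
       = (if P = n then fact n else 0)"
  using assms
proof (induction n arbitrary: P c)
  case (Suc n)
  have step: "pochhammer (c + of_nat (Suc m)) P - pochhammer (c + of_nat m) P
      = of_nat P * pochhammer ((c + 1) + of_nat m) (P - 1)" for m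
  proof (cases P)
    case (Suc p)
    have "pochhammer (c + of_nat (Suc m)) (Suc p) = pochhammer (c + of_nat (Suc m)) p * (c + of_nat (Suc m) + of_nat p)"
      by (rule pochhammer_Suc)
    moreover have "pochhammer (c + of_nat m) (Suc p) = (c + of_nat m) * pochhammer (c + of_nat (Suc m)) p"
      by (simp add: pochhammer_rec add_ac)
    ultimately show ?thesis using Suc by (simp add: algebra_simps)
  qed simp
  have "(\<Sum>m\<le>Suc n. (-1) ^ (Suc n - m) * of_nat (Suc n choose m) * pochhammer (c + of_nat m) P)
     = (\<Sum>m\<le>n. (-1) ^ (n - m) * of_nat (n choose m) * (of_nat P * pochhammer ((c + 1) + of_nat m) (P - 1)))"
    unfolding alternating_sum_Suc step ..
  also have "\<dots> = of_nat P * (\<Sum>m\<le>n. (-1) ^ (n - m) * of_nat (n choose m) * pochhammer ((c + 1) + of_nat m) (P - 1))"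
    by (simp add: sum_distrib_left algebra_simps)
  \<comment> \<open>For \<open>P = 0\<close> the factor \<open>of_nat P\<close> is 0, so the
    truncated \<open>P - 1\<close> does no harm.\<close>
  also have "\<dots> = of_nat P * (if P - 1 = n then fact n else 0)"
    using Suc.IH[of "P - 1" "c + 1"] Suc.prems by simp
  finally show ?case using Suc.prems by (cases P) auto
qed simp

text \<open>Normalised by n! and summed in reverse, which is the form met when a Gaussian series
  truncates a series of moments.\<close>

lemma alternating_sum_pochhammer':
  fixes c :: "'a::field_char_0"
  assumes "P \<le> n"
  shows "(\<Sum>i\<le>n. (-1) ^ i / (fact i * fact (n - i)) * pochhammer (c + of_nat (n - i)) P)
       = (if P = n then 1 else 0)"
proof -
  have "(\<Sum>i\<le>n. (-1) ^ i / (fact i * fact (n - i)) * pochhammer (c + of_nat (n - i)) P)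
      = (\<Sum>m\<le>n. (-1) ^ (n - m) / (fact (n - m) * fact m) * pochhammer (c + of_nat m) P)"
    by (rule sum.reindex_bij_witness[of _ "\<lambda>m. n - m" "\<lambda>m. n - m"]) auto
  also have "\<dots> = (\<Sum>m\<le>n. (-1) ^ (n - m) * of_nat (n choose m) * pochhammer (c + of_nat m) P) / fact n"
    unfolding sum_divide_distrib
    by (intro sum.cong refl) (simp add: binomial_fact field_simps)
  also have "\<dots> = (if P = n then 1 else 0)"
    using alternating_sum_pochhammer[OF assms, of c] by simp
  finally show ?thesis .
qed

section \<open>Regrouping double series and integrating series term by term\<close>

lemma has_sum_antidiagonal:
  fixes B :: "nat \<times> nat \<Rightarrow> 'a::{topological_comm_monoid_add, t3_space}"
  assumes "(B has_sum S) (UNIV \<times> UNIV)"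
  shows "((\<lambda>n. \<Sum>m\<le>n. B (m, n - m)) has_sum S) UNIV"
proof -
  have "(B has_sum S) (UNIV \<times> UNIV) = ((\<lambda>(n, m). B (m, n - m)) has_sum S) (SIGMA n:UNIV. {..n})"
    by (rule has_sum_reindex_bij_witness[of _ "\<lambda>(n, m). (m, n - m)" "\<lambda>(m, l). (m + l, m)"]) auto
  with assms have *: "((\<lambda>(n, m). B (m, n - m)) has_sum S) (SIGMA n:UNIV. {..n})" by simp
  show ?thesis
    by (rule has_sum_SigmaD[OF *]) (simp add: has_sum_finiteI)
qed

text \<open>Absolute summability along rows and then over rows makes the family summable over all
  pairs, which may be regrouped by m + l. The second conclusion keeps the value of the sum of norms;
  the uniform bound on Gegenbauer polynomials comes from it.\<close>

lemma sums_antidiagonal: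
  fixes A :: "nat \<Rightarrow> nat \<Rightarrow> 'a::banach"
  assumes inner: "\<And>m. summable (\<lambda>l. norm (A m l))"
    and outer: "summable (\<lambda>m. \<Sum>l. norm (A m l))"
  shows "(\<lambda>n. \<Sum>m\<le>n. A m (n - m)) sums (\<Sum>m. \<Sum>l. A m l)"
    and "(\<lambda>n. \<Sum>m\<le>n. norm (A m (n - m))) sums (\<Sum>m. \<Sum>l. norm (A m l))"
proof -
  let ?B = "\<lambda>(m, l). A m l"
  have n1: "((\<lambda>l. norm (A m l)) has_sum (\<Sum>l. norm (A m l))) UNIV" for m
    using inner[of m] by (intro sums_nonneg_imp_has_sum summable_sums) auto
  have n2: "((\<lambda>m. \<Sum>l. norm (A m l)) has_sum (\<Sum>m. \<Sum>l. norm (A m l))) UNIV"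
    using outer inner by (intro sums_nonneg_imp_has_sum summable_sums suminf_nonneg) auto
  have abs: "(\<lambda>p. norm (?B p)) summable_on UNIV \<times> UNIV"
    by (rule summable_on_SigmaI[where g = "\<lambda>m. \<Sum>l. norm (A m l)"])
      (use n1 n2 in \<open>auto simp: has_sum_imp_summable\<close>)
  have "((\<lambda>p. norm (?B p)) has_sum (\<Sum>m. \<Sum>l. norm (A m l))) (UNIV \<times> UNIV)"
    by (rule has_sum_SigmaI[OF _ n2 abs]) (use n1 in auto)
  from has_sum_imp_sums[OF has_sum_antidiagonal[OF this]]
  show "(\<lambda>n. \<Sum>m\<le>n. norm (A m (n - m))) sums (\<Sum>m. \<Sum>l. norm (A m l))" by simp
  have i: "summable (A m)" for m using inner summable_norm_cancel by blast
  have o: "summable (\<lambda>m. norm (\<Sum>l. A m l))"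
    by (rule summable_comparison_test[OF _ outer]) (auto intro!: summable_norm inner)
  have c1: "(A m has_sum (\<Sum>l. A m l)) UNIV" for m
    by (rule norm_summable_imp_has_sum[OF inner summable_sums[OF i]])
  have c2: "((\<lambda>m. \<Sum>l. A m l) has_sum (\<Sum>m. \<Sum>l. A m l)) UNIV"
    by (rule norm_summable_imp_has_sum[OF o summable_sums[OF summable_norm_cancel[OF o]]])
  have "(?B has_sum (\<Sum>m. \<Sum>l. A m l)) (UNIV \<times> UNIV)"
    by (rule has_sum_SigmaI[OF _ c2 abs_summable_summable[OF abs]]) (use c1 in auto)
  from has_sum_imp_sums[OF has_sum_antidiagonal[OF this]]
  show "(\<lambda>n. \<Sum>m\<le>n. A m (n - m)) sums (\<Sum>m. \<Sum>l. A m l)" by simp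
qed

text \<open>Tonelli turns summable L1 norms into absolute summability almost everywhere, the missing
  premise for exchanging sum and integral. The last conclusion allows nesting: the Bessel series is
  summed inside the series over degrees, and its L1 norm has to be known there.\<close>

lemma sums_Bochner_integral:
  fixes f :: "nat \<Rightarrow> 'a \<Rightarrow> 'b::{banach, second_countable_topology}"
  assumes int: "\<And>i. integrable M (f i)"
    and sm: "summable (\<lambda>i. \<integral>x. norm (f i x) \<partial>M)"
  shows "AE x in M. summable (\<lambda>i. norm (f i x))"
    and "integrable M (\<lambda>x. \<Sum>i. f i x)"
    and "(\<lambda>i. integral\<^sup>L M (f i)) sums (\<integral>x. (\<Sum>i. f i x) \<partial>M)"
    and "(\<integral>x. norm (\<Sum>i. f i x) \<partial>M) \<le> (\<Sum>i. \<integral>x. norm (f i x) \<partial>M)"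
proof -
  have meas [measurable]: "\<And>i. f i \<in> borel_measurable M" using int by auto
  have "(\<integral>\<^sup>+x. (\<Sum>i. ennreal (norm (f i x))) \<partial>M) = (\<Sum>i. \<integral>\<^sup>+x. ennreal (norm (f i x)) \<partial>M)"
    by (rule nn_integral_suminf) measurable
  also have "\<dots> = (\<Sum>i. ennreal (\<integral>x. norm (f i x) \<partial>M))"
    using int by (intro suminf_cong nn_integral_eq_integral) auto
  also have "\<dots> < \<infinity>"
    using sm by (simp add: suminf_ennreal2)
  finally have "AE x in M. (\<Sum>i. ennreal (norm (f i x))) \<noteq> \<infinity>"
    by (intro nn_integral_PInf_AE) (auto simp: less_top)
  then show ae: "AE x in M. summable (\<lambda>i. norm (f i x))"
    by eventually_elim (auto intro: summable_suminf_not_top)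
  show i: "integrable M (\<lambda>x. \<Sum>i. f i x)" by (rule integrable_suminf[OF int ae sm])
  show "(\<lambda>i. integral\<^sup>L M (f i)) sums (\<integral>x. (\<Sum>i. f i x) \<partial>M)" by (rule sums_integral[OF int ae sm])
  have int': "integrable M (\<lambda>x. norm (f i x))" for i using int by simp
  have ae': "AE x in M. summable (\<lambda>i. norm (norm (f i x)))" using ae by simp
  have sm': "summable (\<lambda>i. \<integral>x. norm (norm (f i x)) \<partial>M)" using sm by simp
  have "(\<integral>x. norm (\<Sum>i. f i x) \<partial>M) \<le> (\<integral>x. (\<Sum>i. norm (f i x)) \<partial>M)"
    using ae by (intro integral_mono_AE integrable_norm i integrable_suminf[OF int' ae' sm'])
      (auto elim!: eventually_mono intro: summable_norm)
  also have "\<dots> = (\<Sum>i. \<integral>x. norm (f i x) \<partial>M)"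
    using sums_integral[OF int' ae' sm'] by (simp add: sums_iff)
  finally show "(\<integral>x. norm (\<Sum>i. f i x) \<partial>M) \<le> (\<Sum>i. \<integral>x. norm (f i x) \<partial>M)" .
qed

section \<open>Laplace transforms of powers\<close>

lemma powr_exp_real_Laplace:
  fixes p \<sigma> :: real
  assumes p: "p > -1" and \<sigma>: "\<sigma> > 0"
  shows "set_integrable lborel {0..} (\<lambda>t. exp (- \<sigma> * t) * t powr p)"
    and "(LINT t:{0..}|lborel. exp (- \<sigma> * t) * t powr p) = Gamma (p + 1) * \<sigma> powr (- (p + 1))"
proof -
  let ?g = "\<lambda>t. indicator {0..} t * t powr p / exp t :: real"
  have "(\<integral>\<^sup>+t. ennreal (?g t) \<partial>lborel) = ennreal (Gamma (p + 1))"
    using Gamma_conv_nn_integral_real[of "p + 1"] p by simp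
  then have "has_bochner_integral lborel ?g (Gamma (p + 1))"
    using p by (intro has_bochner_integral_nn_integral) (auto simp: Gamma_real_pos less_imp_le)
  then have g: "integrable lborel ?g" "integral\<^sup>L lborel ?g = Gamma (p + 1)"
    by (auto simp: has_bochner_integral_iff)
  have eq: "?g (0 + \<sigma> * t) = \<sigma> powr p * (indicator {0..} t *\<^sub>R (exp (- \<sigma> * t) * t powr p))" for t
    using \<sigma> by (auto simp: indicator_def powr_mult exp_minus field_simps zero_le_mult_iff)
  from lborel_integrable_real_affine[OF g(1), of \<sigma> 0]
  have "integrable lborel (\<lambda>t. \<sigma> powr p * (indicator {0..} t *\<^sub>R (exp (- \<sigma> * t) * t powr p)))"
    unfolding eq using \<sigma> by simp
  then show i: "set_integrable lborel {0..} (\<lambda>t. exp (- \<sigma> * t) * t powr p)"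
    unfolding set_integrable_def using \<sigma> by simp
  have "Gamma (p + 1) = \<bar>\<sigma>\<bar> *\<^sub>R (\<integral>t. ?g (0 + \<sigma> * t) \<partial>lborel)"
    using lborel_integral_real_affine[of \<sigma> ?g 0] \<sigma> g(2) by simp
  also have "\<dots> = \<sigma> powr (p + 1) * (LINT t:{0..}|lborel. exp (- \<sigma> * t) * t powr p)"
    unfolding eq set_lebesgue_integral_def using \<sigma> by (simp add: powr_add)
  finally have *: "Gamma (p + 1) = \<sigma> powr (p + 1) * (LINT t:{0..}|lborel. exp (- \<sigma> * t) * t powr p)" .
  have "\<sigma> powr (p + 1) * \<sigma> powr (- (p + 1)) = 1" using \<sigma> by (simp flip: powr_add)
  then have "(LINT t:{0..}|lborel. exp (- \<sigma> * t) * t powr p)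
      = \<sigma> powr (p + 1) * (LINT t:{0..}|lborel. exp (- \<sigma> * t) * t powr p) * \<sigma> powr (- (p + 1))"
    by (metis (no_types, lifting) mult.assoc mult.commute mult_1)
  then show "(LINT t:{0..}|lborel. exp (- \<sigma> * t) * t powr p) = Gamma (p + 1) * \<sigma> powr (- (p + 1))"
    unfolding *[symmetric] .
qed

definition powr_Laplace :: "real \<Rightarrow> complex \<Rightarrow> complex" where
  "powr_Laplace p s = (LINT t:{0..}|lborel. exp (- s * of_real t) * of_real (t powr p))"

lemma norm_exp_powr: "norm (exp (- s * complex_of_real t) * complex_of_real (t powr p)) = exp (- Re s * t) * t powr p"
  by (simp add: norm_mult)

lemma set_integrable_exp_powr:
  assumes "p > -1" "Re s > 0"
  shows "set_integrable lborel {0..} (\<lambda>t. exp (- s * of_real t) * of_real (t powr p))"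
  by (rule set_integrable_bound[OF powr_exp_real_Laplace(1)[OF assms]])
    (auto simp: set_borel_measurable_def norm_mult)

text \<open>The derivative of e^(-st) t^(p+1) integrates to 0 over the half-line, since the function
  tends to 0 at both ends.\<close>

lemma powr_Laplace_Suc:
  assumes p: "p > 0" and s: "Re s > 0"
  shows "s * powr_Laplace (p + 1) s = of_real (p + 1) * powr_Laplace p s"
proof -
  have s0: "s \<noteq> 0" using s by auto
  let ?F = "\<lambda>t. exp (- s * of_real t) * complex_of_real (t powr (p + 1))"
  let ?f = "\<lambda>t. - s * (exp (- s * of_real t) * complex_of_real (t powr (p + 1))) 
     + of_real (p + 1) * (exp (- s * of_real t) * complex_of_real (t powr p))"
  have I: "set_integrable lborel {0..} ?f"
    using p s by (intro set_integral_add set_integrable_mult_right set_integrable_exp_powr) auto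
  have II: "(LINT t:{0..}|lborel. ?f t) = - s * powr_Laplace (p + 1) s + of_real (p + 1) * powr_Laplace p s"
    unfolding powr_Laplace_def using p s
    by (subst set_integral_add(2))
       (simp_all only: set_integral_mult_right set_integrable_mult_right set_integrable_exp_powr)
  have e: "einterval 0 \<infinity> = {0::real<..}" by (auto simp: einterval_def)
  have "(LBINT t=0..\<infinity>. ?f t) = 0 - 0"
  proof (rule interval_integral_FTC_integrable[where F = ?F])
    show "(?F has_vector_derivative ?f x) (at x)" if "0 < ereal x" for x
    proof -
      have x: "x > 0" using that by simp
      show ?thesis
        using x p by (auto intro!: derivative_eq_intros has_vector_derivative_real_field
            has_vector_derivative_of_real simp flip: has_real_derivative_iff_has_vector_derivative
            simp: algebra_simps)
    qed
    show "isCont ?f x" if "0 < ereal x" for x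
      using that by (intro continuous_intros) auto
    show "set_integrable lborel (einterval 0 \<infinity>) ?f"
      unfolding e by (rule set_integrable_subset[OF I]) auto
    show "((?F \<circ> real_of_ereal) \<longlongrightarrow> 0) (at_right 0)"
    proof -
      have "(?F \<longlongrightarrow> ?F 0) (at_right 0)"
        using p by (intro tendsto_intros) (auto intro!: eventually_at_rightI[of 0 1])
      then show ?thesis unfolding zero_ereal_def ereal_tendsto_simps by simp
    qed
    show "((?F \<circ> real_of_ereal) \<longlongrightarrow> 0) (at_left \<infinity>)"
      unfolding ereal_tendsto_simps
    proof (rule tendsto_norm_zero_cancel, unfold norm_exp_powr)
      show "((\<lambda>t. exp (- Re s * t) * t powr (p + 1)) \<longlongrightarrow> 0) at_top"
      proof -
        \<comment> \<open>An integer power above p + 1 reduces the decay at infinity to that of t^n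
          / e^t.\<close>
        obtain n where n: "real n \<ge> p + 1" using real_arch_simple by blast
        have "filterlim (\<lambda>t. Re s * t) at_top at_top"
          using s by (rule filterlim_tendsto_pos_mult_at_top[OF tendsto_const _ filterlim_ident])
        from filterlim_compose[OF tendsto_power_div_exp_0[of n] this]
        have "((\<lambda>t. (1 / Re s ^ n) * ((Re s * t) ^ n / exp (Re s * t))) \<longlongrightarrow> (1 / Re s ^ n) * 0) at_top"
          by (intro tendsto_mult tendsto_const) simp
        then have lim: "((\<lambda>t. t ^ n / exp (Re s * t)) \<longlongrightarrow> 0) at_top"
          using s by (simp add: power_mult_distrib)
        show ?thesis
        proof (rule tendsto_sandwich[OF _ _ tendsto_const lim])
          show "\<forall>\<^sub>F t in at_top. exp (- Re s * t) * t powr (p + 1) \<le> t ^ n / exp (Re s * t)"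
            using eventually_ge_at_top[of 1]
          proof eventually_elim
            case (elim t)
            have "t powr (p + 1) \<le> t powr real n" using elim n by (intro powr_mono) auto
            then show ?case using elim by (simp add: powr_realpow exp_minus field_simps)
          qed
        qed simp
      qed
    qed
  qed simp
  then have "(LINT t:{0<..}|lborel. ?f t) = 0"
    unfolding interval_lebesgue_integral_def e by simp
  \<comment> \<open>The point 0 may be added because \<open>?f\<close> is 0 there, by
    \<open>0 powr p = 0\<close>.\<close>
  moreover have "(LINT t:{0<..}|lborel. ?f t) = (LINT t:{0..}|lborel. ?f t)"
    unfolding set_lebesgue_integral_def using p
    by (intro Bochner_Integration.integral_cong) (auto simp: indicator_def order.order_iff_strict)
  ultimately show ?thesis unfolding II by (simp add: algebra_simps)
qed

lemma norm_iexp_bound: "norm (exp (\<i> * of_real x) - (1 + \<i> * of_real x)) \<le> x\<^sup>2"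
  using Taylor_exp[of "\<i> * of_real x" 1] by (simp add: norm_mult power2_eq_square)

text \<open>Differentiation under the integral along a vertical line with an explicit remainder: the
  Taylor bound for e^(ix) costs a factor (h t)^2, so the error is at most h^2 times the transform of
  t^(p+2) at the real part. The constant \<open>?C\<close> is that transform.\<close>

lemma powr_Laplace_vertical_deriv:
  assumes p: "p > 0" and \<sigma>: "\<sigma> > 0"
  shows "((\<lambda>\<tau>. powr_Laplace p (Complex \<sigma> \<tau>)) has_vector_derivative
            (- \<i> * powr_Laplace (p + 1) (Complex \<sigma> \<tau>))) (at \<tau>)"
proof -
  let ?C = "Gamma (p + 3) * \<sigma> powr (- (p + 3))"
  let ?D = "- \<i> * powr_Laplace (p + 1) (Complex \<sigma> \<tau>)"
  let ?s = "Complex \<sigma> \<tau>"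
  have key: "norm (powr_Laplace p (Complex \<sigma> (\<tau> + h)) - powr_Laplace p ?s - h *\<^sub>R ?D) \<le> ?C * h\<^sup>2" for h
  proof -
    define f1 where "f1 = (\<lambda>t. exp (- Complex \<sigma> (\<tau> + h) * complex_of_real t) * complex_of_real (t powr p))"
    define f2 where "f2 = (\<lambda>t. exp (- ?s * complex_of_real t) * complex_of_real (t powr p))"
    define f3 where "f3 = (\<lambda>t. exp (- ?s * complex_of_real t) * complex_of_real (t powr (p + 1)))"
    let ?c = "- \<i> * of_real h"
    let ?g = "\<lambda>t. f1 t - f2 t - ?c * f3 t"
    have i1: "set_integrable lborel {0..} f1" unfolding f1_def by (rule set_integrable_exp_powr) (use p \<sigma> in auto)
    have i2: "set_integrable lborel {0..} f2" unfolding f2_def by (rule set_integrable_exp_powr) (use p \<sigma> in auto)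
    have i3: "set_integrable lborel {0..} f3" unfolding f3_def by (rule set_integrable_exp_powr) (use p \<sigma> in auto)
    have i3': "set_integrable lborel {0..} (\<lambda>t. ?c * f3 t)" using i3 by (rule set_integrable_mult_right)
    have d: "set_integrable lborel {0..} (\<lambda>t. f1 t - f2 t)"
      by (rule set_integral_diff(1)[OF i1 i2])
    have int: "set_integrable lborel {0..} ?g" by (rule set_integral_diff(1)[OF d i3'])
    have "(LINT t:{0..}|lborel. ?g t) = (LINT t:{0..}|lborel. f1 t) - (LINT t:{0..}|lborel. f2 t) - ?c * (LINT t:{0..}|lborel. f3 t)"
      by (simp only: set_integral_diff(2)[OF d i3'] set_integral_diff(2)[OF i1 i2] set_integral_mult_right)
    then have "powr_Laplace p (Complex \<sigma> (\<tau> + h)) - powr_Laplace p ?s - h *\<^sub>R ?D = (LINT t:{0..}|lborel. ?g t)"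
      by (simp only: powr_Laplace_def f1_def f2_def f3_def scaleR_conv_of_real) (simp only: mult_ac)
    also have "norm \<dots> \<le> (LINT t:{0..}|lborel. norm (?g t))"
      by (rule set_integral_norm_bound[OF int])
    also have "\<dots> \<le> (LINT t:{0..}|lborel. h\<^sup>2 * (exp (- \<sigma> * t) * t powr (p + 2)))"
    proof (rule set_integral_mono)
      show "set_integrable lborel {0..} (\<lambda>t. norm (?g t))" by (rule set_integrable_norm[OF int])
      show "set_integrable lborel {0..} (\<lambda>t. h\<^sup>2 * (exp (- \<sigma> * t) * t powr (p + 2)))"
        using p \<sigma> by (intro set_integrable_mult_right powr_exp_real_Laplace) auto
      fix t :: real assume "t \<in> {0..}"
      show "norm (?g t) \<le> h\<^sup>2 * (exp (- \<sigma> * t) * t powr (p + 2))"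
      proof (cases "t = 0")
        case False
        with \<open>t \<in> {0..}\<close> have t: "t > 0" by auto
        have e: "exp (- Complex \<sigma> (\<tau> + h) * of_real t) = exp (- ?s * of_real t) * exp (\<i> * of_real (- (h * t)))"
          unfolding exp_add[symmetric] by (rule arg_cong[where f = exp]) (simp add: complex_eq_iff algebra_simps)
        let ?E = "exp (\<i> * of_real (- (h * t))) - (1 + \<i> * of_real (- (h * t)))"
        have "?g t = f2 t * ?E"
          unfolding f1_def f2_def f3_def e using t by (simp add: powr_add algebra_simps)
        then have "norm (?g t) = norm (f2 t) * norm ?E"
          by (simp only: norm_mult)
        also have "norm (f2 t) = exp (- \<sigma> * t) * t powr p"
          unfolding f2_def norm_exp_powr by simp
        also have "\<dots> * norm ?E \<le> exp (- \<sigma> * t) * t powr p * (- (h * t))\<^sup>2"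
          by (rule mult_left_mono[OF norm_iexp_bound]) simp
        also have "\<dots> = h\<^sup>2 * (exp (- \<sigma> * t) * t powr (p + 2))"
          using t by (simp add: powr_add power_mult_distrib mult_ac)
        finally show ?thesis .
      qed (simp add: f1_def f2_def f3_def)
    qed
    also have "\<dots> = ?C * h\<^sup>2"
      using powr_exp_real_Laplace(2)[of "p + 2" \<sigma>] p \<sigma> by (simp add: add.assoc mult_ac)
    finally show ?thesis .
  qed
  show ?thesis
    unfolding has_vector_derivative_def has_derivative_within
  proof (intro conjI)
    show "bounded_linear (\<lambda>x. x *\<^sub>R ?D)" by (rule bounded_linear_scaleR_left)
    have "((\<lambda>y. ?C * norm (y - \<tau>)) \<longlongrightarrow> ?C * norm (\<tau> - \<tau>)) (at \<tau>)" by (intro tendsto_intros)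
    then have lim: "((\<lambda>y. ?C * norm (y - \<tau>)) \<longlongrightarrow> 0) (at \<tau>)" by simp
    show "((\<lambda>y. (1 / norm (y - \<tau>)) *\<^sub>R (powr_Laplace p (Complex \<sigma> y) - (powr_Laplace p ?s + (y - \<tau>) *\<^sub>R ?D))) \<longlongrightarrow> 0) (at \<tau>)"
    proof (rule Lim_null_comparison[OF _ lim])
      show "\<forall>\<^sub>F y in at \<tau>. norm ((1 / norm (y - \<tau>)) *\<^sub>R (powr_Laplace p (Complex \<sigma> y) - (powr_Laplace p ?s + (y - \<tau>) *\<^sub>R ?D))) \<le> ?C * norm (y - \<tau>)"
        using eventually_at_ball'[of 1 \<tau> UNIV, simplified]
      proof eventually_elim
        case (elim y)
        define Z where "Z = powr_Laplace p (Complex \<sigma> y) - (powr_Laplace p ?s + (y - \<tau>) *\<^sub>R ?D)"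
        have "norm Z \<le> ?C * (y - \<tau>)\<^sup>2" using key[of "y - \<tau>"] by (simp add: Z_def algebra_simps)
        also have "\<dots> = (?C * norm (y - \<tau>)) * norm (y - \<tau>)" by (simp add: power2_eq_square flip: abs_mult)
        finally have "norm Z / norm (y - \<tau>) \<le> ?C * norm (y - \<tau>)" using elim by (simp add: pos_divide_le_eq)
        then show ?case unfolding Z_def[symmetric] by simp
      qed
    qed
  qed
qed

text \<open>By the recursion, the product of the transform with s^(p+1) has derivative 0 along the
  vertical line through s. It therefore equals its value at the real point of that line, where the
  Gamma integral applies; no contour has to be moved.\<close>

lemma powr_Laplace_eq:
  assumes p: "p > 0" and s: "Re s > 0"
  shows "powr_Laplace p s = of_real (Gamma (p + 1)) * s powr (- of_real (p + 1))"
proof -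
  let ?\<sigma> = "Re s"
  let ?q = "complex_of_real (p + 1)"
  let ?\<Psi> = "\<lambda>\<tau>. powr_Laplace p (Complex ?\<sigma> \<tau>) * Complex ?\<sigma> \<tau> powr ?q"
  have "(?\<Psi> has_vector_derivative 0) (at \<tau>)" for \<tau>
  proof -
    let ?s = "Complex ?\<sigma> \<tau>"
    have nz: "?s \<notin> \<real>\<^sub>\<le>\<^sub>0" "?s \<noteq> 0" using s by (auto simp: complex_nonpos_Reals_iff complex_eq_iff)
    have l: "((\<lambda>\<tau>. Complex ?\<sigma> \<tau>) has_vector_derivative \<i>) (at \<tau>)"
      unfolding Complex_eq by (auto intro!: derivative_eq_intros)
    have "((\<lambda>\<tau>. Complex ?\<sigma> \<tau> powr ?q) has_vector_derivative (\<i> * (?q * ?s powr (?q - 1)))) (at \<tau>)"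
      using field_vector_diff_chain_at[OF l has_field_derivative_powr[OF nz(1), of ?q]] by (simp only: o_def)
    from has_vector_derivative_mult[OF powr_Laplace_vertical_deriv[OF p s] this]
    have "(?\<Psi> has_vector_derivative (powr_Laplace p ?s * (\<i> * (?q * ?s powr (?q - 1))) +
        - \<i> * powr_Laplace (p + 1) ?s * ?s powr ?q)) (at \<tau>)" .
    moreover have "powr_Laplace p ?s * (\<i> * (?q * ?s powr (?q - 1))) + - \<i> * powr_Laplace (p + 1) ?s * ?s powr ?q = 0"
    proof -
      have *: "?s powr ?q = ?s * ?s powr (?q - 1)"
        using nz by (simp add: powr_add)
      have "?s * powr_Laplace (p + 1) ?s = ?q * powr_Laplace p ?s"
        using powr_Laplace_Suc[OF p, of ?s] s by simp
      then have "- \<i> * powr_Laplace (p + 1) ?s * (?s * ?s powr (?q - 1)) = - \<i> * (?q * powr_Laplace p ?s) * ?s powr (?q - 1)"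
        by (metis mult.assoc mult.commute)
      then show ?thesis unfolding * by (simp only:) (simp add: mult_ac)
    qed
    ultimately show ?thesis by (simp only:)
  qed
  then obtain c where "\<And>\<tau>. \<tau> \<in> UNIV \<Longrightarrow> ?\<Psi> \<tau> = c"
    using has_vector_derivative_zero_constant[OF convex_UNIV, of ?\<Psi>] by (metis (no_types))
  then have "?\<Psi> (Im s) = ?\<Psi> 0" by (metis UNIV_I)
  also have "\<dots> = of_real (LINT t:{0..}|lborel. exp (- ?\<sigma> * t) * t powr p) * of_real ?\<sigma> powr ?q"
  proof -
    have "powr_Laplace p (Complex ?\<sigma> 0) = (LINT t:{0..}|lborel. complex_of_real (exp (- ?\<sigma> * t) * t powr p))"
      unfolding powr_Laplace_def
      by (intro set_lebesgue_integral_cong) (auto simp: exp_of_real[symmetric] Complex_eq)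
    then show ?thesis by (simp only: set_integral_complex_of_real Complex_eq) simp
  qed
  also have "\<dots> = of_real (Gamma (p + 1) * (?\<sigma> powr (- (p + 1)) * ?\<sigma> powr (p + 1)))"
    using p s powr_exp_real_Laplace(2)[of p ?\<sigma>] by (simp add: powr_of_real flip: of_real_add)
  also have "?\<sigma> powr (- (p + 1)) * ?\<sigma> powr (p + 1) = 1" using s by (simp flip: powr_add)
  finally have "powr_Laplace p s * s powr ?q = of_real (Gamma (p + 1))" by simp
  moreover have "s powr ?q \<noteq> 0" using s by auto
  ultimately have "powr_Laplace p s = of_real (Gamma (p + 1)) / s powr ?q" by (metis nonzero_eq_divide_eq)
  then show ?thesis by (simp only: powr_minus divide_inverse)
qed

section \<open>The Laplace transform of the Bessel series\<close>

text \<open>The factor Gamma(2m + \<nu> + 1) / (m! Gamma(m + \<nu> + 1)) left by transforming the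
  m-th term of the Bessel series, a generalised binomial coefficient of 2m + \<nu> over m. As a
  rising factorial it fits the finite differences above.\<close>

definition bessel_coeff :: "real \<Rightarrow> nat \<Rightarrow> real" where
  "bessel_coeff \<nu> m = pochhammer (\<nu> + 1 + real m) m / fact m"

lemma bessel_coeff_nonneg: "\<nu> \<ge> 0 \<Longrightarrow> bessel_coeff \<nu> m \<ge> 0"
  unfolding bessel_coeff_def by (intro divide_nonneg_nonneg pochhammer_nonneg) auto

lemma bessel_coeff_Gamma:
  assumes "\<nu> \<ge> 0"
  shows "Gamma (2 * real m + \<nu> + 1) / (fact m * Gamma (real m + \<nu> + 1)) = bessel_coeff \<nu> m"
proof -
  have "\<nu> + 1 + real m \<notin> \<int>\<^sub>\<le>\<^sub>0" using assms by (auto elim!: nonpos_Ints_cases)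
  then have "pochhammer (\<nu> + 1 + real m) m = Gamma (\<nu> + 1 + real m + real m) / Gamma (\<nu> + 1 + real m)"
    by (rule pochhammer_Gamma)
  moreover have "\<nu> + 1 + real m + real m = 2 * real m + \<nu> + 1" "\<nu> + 1 + real m = real m + \<nu> + 1" by auto
  ultimately show ?thesis by (simp add: bessel_coeff_def add_ac)
qed

lemma pochhammer_mono_left:
  fixes x y :: real
  assumes "0 \<le> x" "x \<le> y"
  shows "pochhammer x n \<le> pochhammer y n"
  unfolding pochhammer_prod by (intro prod_mono) (use assms in auto)

text \<open>The coefficient grows with \<nu>, and at the integer \<open>N\<close> it is the binomial
  coefficient of 2m + N over m. \<open>N\<close> is kept in the bound because \<nu> will run through
  j + L, and the estimate must be geometric in j.\<close>

lemma bessel_coeff_le: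
  assumes "0 \<le> \<nu>" "\<nu> \<le> real N"
  shows "bessel_coeff \<nu> m \<le> 2 ^ (2 * m + N)"
proof -
  have "bessel_coeff \<nu> m \<le> pochhammer (real N + 1 + real m) m / fact m"
    unfolding bessel_coeff_def by (intro divide_right_mono pochhammer_mono_left) (use assms in auto)
  also have "\<dots> = real ((2 * m + N) choose m)"
  proof -
    have "fact (N + m) * pochhammer (real N + 1 + real m) m = fact (N + m + m)"
      unfolding pochhammer_fact pochhammer_product'[of _ "N + m" m] by (simp add: add_ac)
    also have "N + m + m = 2 * m + N" by simp
    finally have "fact (N + m) * pochhammer (real N + 1 + real m) m = fact (2 * m + N)" .
    moreover have "real ((2 * m + N) choose m) = fact (2 * m + N) / (fact m * fact (N + m))"
      using binomial_fact[of m "2 * m + N", where 'a = real] by (simp add: add_ac)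
    ultimately show ?thesis by (metis fact_nonzero mult.commute nonzero_mult_divide_mult_cancel_left)
  qed
  also have "\<dots> \<le> 2 ^ (2 * m + N)"
    using binomial_le_pow2[of "2 * m + N" m] by (metis of_nat_le_iff of_nat_numeral of_nat_power)
  finally show ?thesis .
qed

text \<open>The rising factorials (c + m)_m and (c + 2m)_(n-m) combine to (c + m)_n, so up to n! the
  sum is the n-th difference of a monic polynomial of degree n. It is the coefficient of t^n in the
  double series behind \<open>bessel_coeff_sums\<close>.\<close>

lemma pochhammer_alternating_sum_eq_one:
  fixes c :: "'a::field_char_0"
  shows "(\<Sum>m\<le>n. pochhammer (c + of_nat m) m / fact m * ((- (c + of_nat (2 * m))) gchoose (n - m))) = 1"
proof -
  have "(\<Sum>m\<le>n. pochhammer (c + of_nat m) m / fact m * ((- (c + of_nat (2 * m))) gchoose (n - m)))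
      = (\<Sum>m\<le>n. (-1) ^ (n - m) * of_nat (n choose m) * pochhammer (c + of_nat m) n) / fact n"
    unfolding sum_divide_distrib
  proof (intro sum.cong refl)
    fix m assume "m \<in> {..n}"
    then have m: "m \<le> n" by simp
    have "pochhammer (c + of_nat m) n = pochhammer (c + of_nat m) m * pochhammer (c + of_nat (2 * m)) (n - m)"
    proof -
      have "c + of_nat m + of_nat m = c + of_nat (2 * m)" by (simp only: mult_2 of_nat_add add.assoc)
      then show ?thesis using pochhammer_product[OF m, of "c + of_nat m"] by (simp only:)
    qed
    moreover have "(- (c + of_nat (2 * m))) gchoose (n - m) = (-1) ^ (n - m) * pochhammer (c + of_nat (2 * m)) (n - m) / fact (n - m)"
      by (simp only: gbinomial_pochhammer minus_minus)
    ultimately show "pochhammer (c + of_nat m) m / fact m * ((- (c + of_nat (2 * m))) gchoose (n - m))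
       = (-1) ^ (n - m) * of_nat (n choose m) * pochhammer (c + of_nat m) n / fact n"
      using m by (simp add: binomial_fact field_simps)
  qed
  also have "\<dots> = 1" using alternating_sum_pochhammer[of n n c] by simp
  finally show ?thesis .
qed

text \<open>For q \<ge> 0 these coefficients alternate in sign, so the series of norms is again a
  binomial series, taken at minus the norm of the variable.\<close>

lemma norm_gbinomial_minus:
  assumes "q \<ge> (0::real)"
  shows "norm ((- complex_of_real q) gchoose l) = (-1) ^ l * ((- q) gchoose l)"
proof -
  let ?P = "pochhammer q l / fact l"
  have "(- complex_of_real q) gchoose l = of_real ((-1) ^ l * ?P)"
    unfolding gbinomial_pochhammer minus_minus pochhammer_of_real by simp
  moreover have "?P \<ge> 0" unfolding pochhammer_prod using assms by (intro divide_nonneg_nonneg prod_nonneg) auto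
  ultimately have "norm ((- complex_of_real q) gchoose l) = ?P"
    by (simp only: norm_of_real abs_mult power_abs abs_minus_cancel abs_one power_one mult_1 abs_of_nonneg)
  also have "\<dots> = (-1) ^ l * ((-1) ^ l * ?P)"
    by (simp only: mult.assoc[symmetric] power_mult_distrib[symmetric]) simp
  also have "(-1) ^ l * ?P = (- q) gchoose l"
    unfolding gbinomial_pochhammer minus_minus by simp
  finally show ?thesis .
qed

text \<open>Each power of 1 + t is expanded in a binomial series and the double series is regrouped
  by the total power of t. All coefficients become 1, which leaves a geometric series. The radius
  1/16 secures 4 |t| < (1 - |t|)^2, so that the dominating series is geometric too.\<close>

lemma bessel_coeff_sums:
  fixes t :: complex
  assumes \<nu>: "\<nu> \<ge> 0" and t: "norm t \<le> 1 / 16"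
  shows "(\<lambda>m. of_real (bessel_coeff \<nu> m) * t ^ m * (1 + t) powr (- of_real (\<nu> + 1 + 2 * real m))) sums (1 / (1 - t))"
    (is "?F sums _")
proof -
  let ?q = "\<lambda>m. \<nu> + 1 + 2 * real m"
  define A where "A = (\<lambda>m l. of_real (bessel_coeff \<nu> m) * t ^ m * (((- complex_of_real (?q m)) gchoose l) * t ^ l))"
  obtain N where N: "\<nu> \<le> real N" using real_arch_simple by blast
  have nt: "norm t < 1" using t by simp
  have norms: "(\<lambda>l. norm (A m l)) sums (bessel_coeff \<nu> m * norm t ^ m * (1 - norm t) powr (- ?q m))" for m
  proof -
    have "norm (A m l) = bessel_coeff \<nu> m * norm t ^ m * (((- ?q m) gchoose l) * (- norm t) ^ l)" for l
      unfolding A_def using \<nu> bessel_coeff_nonneg[OF \<nu>, of m]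
      by (simp add: norm_mult norm_power norm_gbinomial_minus power_minus[of "norm t"] del: of_real_add of_real_mult)
    then show ?thesis
      using sums_mult[OF gen_binomial_real[of "- norm t" "- ?q m"], of "bessel_coeff \<nu> m * norm t ^ m"] nt by simp
  qed
  have sumA: "A m sums (?F m)" for m
    unfolding A_def using sums_mult[OF gen_binomial_complex[OF nt, of "- complex_of_real (?q m)"]] by simp
  have outer: "summable (\<lambda>m. bessel_coeff \<nu> m * norm t ^ m * (1 - norm t) powr (- ?q m))"
  proof (rule summable_comparison_test)
    let ?r = "4 * norm t / (1 - norm t)\<^sup>2"
    have "4 * norm t / (1 - norm t)\<^sup>2 < 1"
    proof -
      have "(15/16)\<^sup>2 \<le> (1 - norm t)\<^sup>2" using t by (intro power_mono) auto
      then have "4 * norm t < (1 - norm t)\<^sup>2" using t by (simp add: power2_eq_square)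
      then show ?thesis using nt by simp
    qed
    then show "summable (\<lambda>m. 2 ^ N * (1 - norm t) powr (- (\<nu> + 1)) * ?r ^ m)"
      by (intro summable_mult summable_geometric) simp
    have "norm (bessel_coeff \<nu> m * norm t ^ m * (1 - norm t) powr (- ?q m))
        \<le> 2 ^ N * (1 - norm t) powr (- (\<nu> + 1)) * ?r ^ m" for m
    proof -
      have "(1 - norm t) powr (- ?q m) = (1 - norm t) powr (- (\<nu> + 1)) * (1 - norm t) powr (- real (2 * m))"
        by (simp add: algebra_simps flip: powr_add)
      also have "(1 - norm t) powr (- real (2 * m)) = 1 / ((1 - norm t)\<^sup>2) ^ m"
      proof -
        have "(1 - norm t) powr real (2 * m) = ((1 - norm t)\<^sup>2) ^ m"
          using nt by (subst powr_realpow) (simp_all only: power_mult diff_gt_0_iff_gt)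
        then show ?thesis by (simp only: powr_minus inverse_eq_divide)
      qed
      finally have e: "(1 - norm t) powr (- ?q m) = (1 - norm t) powr (- (\<nu> + 1)) * (1 / ((1 - norm t)\<^sup>2) ^ m)" .
      have "(2::real) ^ (2 * m + N) = 2 ^ N * 4 ^ m" by (subst power_add, subst power_mult) simp
      with bessel_coeff_le[OF \<nu> N, of m] have b: "bessel_coeff \<nu> m \<le> 2 ^ N * 4 ^ m" by simp
      have "norm (bessel_coeff \<nu> m * norm t ^ m * (1 - norm t) powr (- ?q m)) = bessel_coeff \<nu> m * (norm t ^ m * (1 - norm t) powr (- ?q m))"
        unfolding real_norm_def mult.assoc by (rule abs_of_nonneg) (intro mult_nonneg_nonneg bessel_coeff_nonneg \<nu>, auto)
      also have "\<dots> \<le> 2 ^ N * 4 ^ m * (norm t ^ m * (1 - norm t) powr (- ?q m))"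
        by (rule mult_right_mono[OF b]) simp
      also have "\<dots> = 2 ^ N * (1 - norm t) powr (- (\<nu> + 1)) * ?r ^ m"
        unfolding e power_divide power_mult_distrib by simp
      finally show ?thesis .
    qed
    then show "\<exists>K. \<forall>m\<ge>K. norm (bessel_coeff \<nu> m * norm t ^ m * (1 - norm t) powr (- ?q m))
        \<le> 2 ^ N * (1 - norm t) powr (- (\<nu> + 1)) * ?r ^ m" by blast
  qed
  have "(\<lambda>n. \<Sum>m\<le>n. A m (n - m)) sums (\<Sum>m. \<Sum>l. A m l)"
  proof (rule sums_antidiagonal(1))
    show "summable (\<lambda>l. norm (A m l))" for m using norms[of m] by (simp add: sums_iff)
    show "summable (\<lambda>m. \<Sum>l. norm (A m l))"
      using outer norms by (simp add: sums_iff)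
  qed
  moreover have "(\<Sum>m\<le>n. A m (n - m)) = t ^ n" for n
  proof -
    have "(\<Sum>m\<le>n. A m (n - m)) = t ^ n * (\<Sum>m\<le>n. pochhammer ((of_real \<nu> + 1) + of_nat m) m / fact m * ((- ((of_real \<nu> + 1) + of_nat (2 * m))) gchoose (n - m)))"
      unfolding sum_distrib_left
    proof (intro sum.cong refl)
      fix m assume "m \<in> {..n}"
      then have "t ^ n = t ^ m * t ^ (n - m)" by (simp flip: power_add)
      moreover have "complex_of_real (bessel_coeff \<nu> m) = pochhammer ((of_real \<nu> + 1) + of_nat m) m / fact m"
        unfolding bessel_coeff_def by (simp add: pochhammer_of_real[symmetric])
      ultimately show "A m (n - m) = t ^ n * (pochhammer ((of_real \<nu> + 1) + of_nat m) m / fact m * ((- ((of_real \<nu> + 1) + of_nat (2 * m))) gchoose (n - m)))"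
        unfolding A_def by (simp add: mult_ac)
    qed
    then show ?thesis unfolding pochhammer_alternating_sum_eq_one by simp
  qed
  ultimately have "(\<lambda>n. t ^ n) sums (\<Sum>m. \<Sum>l. A m l)" by (simp only:)
  from sums_unique2[OF this geometric_sums[OF nt]]
  have eq: "(\<Sum>m. ?F m) = 1 / (1 - t)"
    unfolding sums_unique[OF sumA, symmetric] .
  have "summable ?F"
  proof (rule summable_comparison_test[OF _ outer], intro exI allI impI)
    fix m
    have "norm (?F m) = norm (\<Sum>l. A m l)" unfolding sums_unique[OF sumA, symmetric] ..
    also have "\<dots> \<le> (\<Sum>l. norm (A m l))"
      by (rule summable_norm[OF sums_summable[OF norms]])
    also have "\<dots> = bessel_coeff \<nu> m * norm t ^ m * (1 - norm t) powr (- ?q m)"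
      by (rule sums_unique[OF norms, symmetric])
    finally show "norm (?F m) \<le> bessel_coeff \<nu> m * norm t ^ m * (1 - norm t) powr (- ?q m)" .
  qed
  from summable_sums[OF this] show ?thesis unfolding eq .
qed

section \<open>The parameters r, R and w\<close>

lemma lap_r_props:
  assumes "Re s > b" "b > 0"
  shows "Re (lap_r b s) \<ge> 0" "(lap_r b s)\<^sup>2 = s\<^sup>2 + of_real (b\<^sup>2)"
  unfolding lap_r_def using csqrt_principal[of "s\<^sup>2 + of_real (b\<^sup>2)"] by auto

text \<open>From r^2 = s^2 + b^2 one has (r - s) R = b^2. With w^2 = - b^2 / R^2 this gives s =
  (R/2)(1 + w^2) and r = (R/2)(1 - w^2). The principal root has nonnegative real part, so Re R is at
  least Re s and w is small when Re s is large against b.\<close>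

lemma lap_props:
  assumes "Re s > b" "b > 0"
  shows "Re (lap_R b s) \<ge> Re s" "lap_R b s \<noteq> 0"
    "1 + (lap_w b s)\<^sup>2 = 2 * s / lap_R b s" "1 - (lap_w b s)\<^sup>2 = 2 * lap_r b s / lap_R b s"
    "norm (lap_w b s) \<le> b / Re s"
proof -
  note r = lap_r_props[OF assms]
  show R: "Re (lap_R b s) \<ge> Re s" using r by (simp add: lap_R_def)
  with assms show nz: "lap_R b s \<noteq> 0" by (metis less_le_trans order.strict_trans zero_complex.sel(1) order.irrefl)
  have w: "(lap_w b s)\<^sup>2 = - (of_real (b\<^sup>2)) / (lap_R b s)\<^sup>2"
    by (simp add: lap_w_def power_divide power_mult_distrib)
  have b: "complex_of_real (b\<^sup>2) = (lap_r b s)\<^sup>2 - s\<^sup>2" using r by simp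
  have "(lap_R b s)\<^sup>2 - of_real (b\<^sup>2) = 2 * s * lap_R b s"
    unfolding b by (simp add: lap_R_def power2_eq_square algebra_simps)
  moreover have "1 + (lap_w b s)\<^sup>2 = ((lap_R b s)\<^sup>2 - of_real (b\<^sup>2)) / (lap_R b s)\<^sup>2"
    unfolding w using nz by (simp add: diff_divide_distrib)
  ultimately show "1 + (lap_w b s)\<^sup>2 = 2 * s / lap_R b s"
    using nz by (simp add: power2_eq_square)
  have "(lap_R b s)\<^sup>2 + of_real (b\<^sup>2) = 2 * lap_r b s * lap_R b s"
    unfolding b by (simp add: lap_R_def power2_eq_square algebra_simps)
  moreover have "1 - (lap_w b s)\<^sup>2 = ((lap_R b s)\<^sup>2 + of_real (b\<^sup>2)) / (lap_R b s)\<^sup>2"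
    unfolding w using nz by (simp add: add_divide_distrib)
  ultimately show "1 - (lap_w b s)\<^sup>2 = 2 * lap_r b s / lap_R b s"
    using nz by (simp add: power2_eq_square)
  have "norm (lap_w b s) = b / norm (lap_R b s)" using assms by (simp add: lap_w_def norm_divide norm_mult)
  also have "\<dots> \<le> b / Re s"
    using R assms abs_Re_le_cmod[of "lap_R b s"] by (intro divide_left_mono mult_pos_pos) auto
  finally show "norm (lap_w b s) \<le> b / Re s" .
qed

text \<open>Both arguments lie strictly between -pi/2 and pi/2, so their sum stays on the principal
  branch.\<close>

lemma powr_mult_right_half_plane:
  fixes x y c :: complex
  assumes "Re x > 0" "Re y > 0"
  shows "(x * y) powr c = x powr c * y powr c"
proof -
  have nz: "x \<noteq> 0" "y \<noteq> 0" using assms by auto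
  have "\<bar>Im (Ln x)\<bar> < pi / 2" "\<bar>Im (Ln y)\<bar> < pi / 2"
    using assms Re_Ln_pos_lt nz by blast+
  then have "Ln (x * y) = Ln x + Ln y"
    using nz by (intro Ln_times_simple) auto
  then show ?thesis using nz by (simp add: powr_def exp_add distrib_left)
qed

text \<open>With t = w^2 one has s = (R/2)(1 + t), so every term is a fixed factor times a term of
  \<open>bessel_coeff_sums\<close>, and 1 / (1 - t) = R / (2 r). The condition Re s > 4 b gives |w|
  \<le> 1/4, hence |t| \<le> 1/16.\<close>

lemma bessel_Laplace_series:
  assumes b: "b > 0" and \<nu>: "\<nu> \<ge> 0" and s: "Re s > 4 * b"
  shows "(\<lambda>m. (-1) ^ m * of_real (bessel_coeff \<nu> m) * of_real ((b / 2) powr (2 * real m + \<nu>)) * s powr (- of_real (2 * real m + \<nu> + 1)))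
      sums (of_real (b powr \<nu>) / (lap_r b s * lap_R b s powr of_real \<nu>))"
proof -
  let ?R = "lap_R b s" and ?t = "(lap_w b s)\<^sup>2"
  have s': "Re s > b" using s b by simp
  note L = lap_props[OF s' b]
  have "norm (lap_w b s) \<le> 1 / 4"
    by (rule order_trans[OF L(5)]) (use s b in \<open>simp add: field_simps\<close>)
  then have "(norm (lap_w b s))\<^sup>2 \<le> (1 / 4)\<^sup>2" by (intro power_mono) auto
  then have t: "norm ?t \<le> 1 / 16" unfolding norm_power by (simp add: power_divide)
  have sR: "s = ?R / 2 * (1 + ?t)" using L(2) by (simp add: L(3) field_simps)
  have pR: "Re (?R / 2) > 0" using L(1) s b by simp
  have pt: "Re (1 + ?t) > 0" using abs_Re_le_cmod[of ?t] t by simp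
  have R0: "?R \<noteq> 0" by (rule L(2))
  have term_eq: "(-1) ^ m * of_real (bessel_coeff \<nu> m) * of_real ((b / 2) powr (2 * real m + \<nu>)) * s powr (- of_real (2 * real m + \<nu> + 1))
     = (of_real ((b / 2) powr \<nu>) * (?R / 2) powr (- of_real (\<nu> + 1))) * (of_real (bessel_coeff \<nu> m) * ?t ^ m * (1 + ?t) powr (- of_real (\<nu> + 1 + 2 * real m)))" for m
  proof -
    have e: "- complex_of_real (2 * real m + \<nu> + 1) = - of_real (\<nu> + 1 + 2 * real m)" by simp
    have 1: "s powr (- of_real (\<nu> + 1 + 2 * real m)) = (?R / 2) powr (- of_real (\<nu> + 1 + 2 * real m)) * (1 + ?t) powr (- of_real (\<nu> + 1 + 2 * real m))"
      by (subst sR) (rule powr_mult_right_half_plane[OF pR pt])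
    have "- complex_of_real (\<nu> + 1 + 2 * real m) = - of_real (\<nu> + 1) - of_nat (2 * m)" by simp
    then have 2: "(?R / 2) powr (- of_real (\<nu> + 1 + 2 * real m)) = (?R / 2) powr (- of_real (\<nu> + 1)) / (?R / 2) ^ (2 * m)"
    proof -
      assume e: "- complex_of_real (\<nu> + 1 + 2 * real m) = - of_real (\<nu> + 1) - of_nat (2 * m)"
      have "(?R / 2) powr of_nat (2 * m) = (?R / 2) ^ (2 * m)" using R0 by (intro powr_nat') simp
      then show ?thesis unfolding e powr_diff by (simp only:)
    qed
    have 3: "(b / 2) powr (2 * real m + \<nu>) = (b / 2) powr \<nu> * (b / 2) ^ (2 * m)"
      using b powr_realpow[of "b / 2" "2 * m"] by (simp add: powr_add mult.commute)
    have "(-1) ^ m * of_real ((b / 2) ^ (2 * m)) / (?R / 2) ^ (2 * m) = ((-1) * (of_real (b / 2))\<^sup>2 / (?R / 2)\<^sup>2) ^ m"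
      by (simp only: power_mult power_divide power_mult_distrib of_real_power of_real_divide)
    also have "(-1) * (of_real (b / 2))\<^sup>2 / (?R / 2)\<^sup>2 = ?t"
      by (simp add: lap_w_def power_divide power_mult_distrib)
    finally have 4: "(-1) ^ m * complex_of_real ((b / 2) ^ (2 * m)) / (?R / 2) ^ (2 * m) = ?t ^ m" .
    show ?thesis unfolding e 1 2 3 of_real_mult 4[symmetric] by (simp add: mult_ac)
  qed
  have "of_real ((b / 2) powr \<nu>) * (?R / 2) powr (- of_real (\<nu> + 1)) * (1 / (1 - ?t)) = of_real (b powr \<nu>) / (lap_r b s * ?R powr of_real \<nu>)"
  proof -
    have "?R = of_real 2 * (?R / 2)" by simp
    then have "?R powr of_real \<nu> = of_real 2 powr of_real \<nu> * (?R / 2) powr of_real \<nu>"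
      using pR by (metis powr_mult_right_half_plane Re_complex_of_real zero_less_numeral)
    then have 1: "(?R / 2) powr of_real \<nu> = ?R powr of_real \<nu> / of_real (2 powr \<nu>)"
      by (simp add: powr_of_real[of 2 \<nu>, simplified])
    have 2: "(?R / 2) powr (- of_real (\<nu> + 1)) = 1 / ((?R / 2) powr of_real \<nu> * (?R / 2))"
    proof -
      have "(?R / 2) powr 1 = ?R / 2" using R0 by simp
      then show ?thesis by (simp only: powr_minus of_real_add of_real_1 powr_add inverse_eq_divide)
    qed
    have 3: "(b / 2) powr \<nu> = b powr \<nu> / 2 powr \<nu>" using b by (simp add: powr_divide)
    show ?thesis unfolding 1 2 3 L(4) using R0 by simp
  qed
  with sums_mult[OF bessel_coeff_sums[OF \<nu> t], of "of_real ((b / 2) powr \<nu>) * (?R / 2) powr (- of_real (\<nu> + 1))"]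
  show ?thesis unfolding term_eq by (simp only:)
qed

text \<open>The Gamma factor in the denominator is at least \<open>Gamma (\<nu> + 1)\<close>, so a
  multiple of the series of exp (x^2 / 4) dominates.\<close>

lemma summable_bessel:
  assumes "x \<ge> 0" "\<nu> > 0"
  shows "summable (\<lambda>m. (-1) ^ m / (fact m * Gamma (real m + \<nu> + 1)) * (x / 2) powr (2 * real m + \<nu>))"
proof (rule summable_comparison_test)
  have G: "Gamma (real m + \<nu> + 1) \<ge> Gamma (\<nu> + 1)" for m
  proof -
    have "\<nu> + 1 \<notin> \<int>\<^sub>\<le>\<^sub>0" using nonpos_Ints_nonpos[of "\<nu> + 1"] assms by linarith
    then have "Gamma (real m + \<nu> + 1) = Gamma (\<nu> + 1) * pochhammer (\<nu> + 1) m"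
      using pochhammer_Gamma[of "\<nu> + 1" m] Gamma_eq_zero_iff[of "\<nu> + 1"] by (simp add: add_ac)
    moreover have "1 \<le> pochhammer (\<nu> + 1) m"
      using pochhammer_mono_left[of 1 "\<nu> + 1" m] assms fact_ge_1[of m, where 'a = real]
      unfolding pochhammer_fact[symmetric] by linarith
    moreover have "0 < Gamma (\<nu> + 1)" using assms by (intro Gamma_real_pos) auto
    ultimately show ?thesis by (simp add: mult_le_cancel_left1)
  qed
  have G0: "Gamma (\<nu> + 1) > 0" using assms by (intro Gamma_real_pos) auto
  show "summable (\<lambda>m. ((x / 2) powr \<nu> / Gamma (\<nu> + 1)) * (((x / 2)\<^sup>2) ^ m / fact m))"
    using summable_exp[of "(x / 2)\<^sup>2"] by (intro summable_mult) (simp only: divide_inverse mult.commute)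
  have "norm ((-1) ^ m / (fact m * Gamma (real m + \<nu> + 1)) * (x / 2) powr (2 * real m + \<nu>))
      \<le> ((x / 2) powr \<nu> / Gamma (\<nu> + 1)) * (((x / 2)\<^sup>2) ^ m / fact m)" for m
  proof (cases "x = 0")
    case False
    with assms have x: "x / 2 > 0" by simp
    have p: "(x / 2) powr (2 * real m + \<nu>) = (x / 2) powr \<nu> * ((x / 2)\<^sup>2) ^ m"
    proof -
      have "(x / 2) powr real (2 * m) = ((x / 2)\<^sup>2) ^ m"
        unfolding powr_realpow[OF x] by (rule power_mult)
      moreover have "2 * real m + \<nu> = \<nu> + real (2 * m)" by simp
      ultimately show ?thesis by (simp only: powr_add)
    qed
    have "norm ((-1) ^ m / (fact m * Gamma (real m + \<nu> + 1)) * (x / 2) powr (2 * real m + \<nu>))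
       = (x / 2) powr \<nu> * ((x / 2)\<^sup>2) ^ m / fact m / Gamma (real m + \<nu> + 1)"
      unfolding p using G[of m] G0 x by (simp add: abs_mult abs_divide)
    also have "\<dots> \<le> (x / 2) powr \<nu> * ((x / 2)\<^sup>2) ^ m / fact m / Gamma (\<nu> + 1)"
      using G[of m] G0 by (intro divide_left_mono mult_pos_pos) auto
    finally show ?thesis by (simp add: mult_ac)
  qed (use assms in auto)
  then show "\<exists>N. \<forall>m\<ge>N. norm ((-1) ^ m / (fact m * Gamma (real m + \<nu> + 1)) * (x / 2) powr (2 * real m + \<nu>))
      \<le> ((x / 2) powr \<nu> / Gamma (\<nu> + 1)) * (((x / 2)\<^sup>2) ^ m / fact m)" by blast
qed

text \<open>The power series of the Bessel function is transformed term by term. The L1 bound in the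
  third claim has the growth of 2^N (b / (2 Re s))^\<nu> in the order, and this is what later makes
  the series over all degrees summable.\<close>

lemma bessel_Laplace:
  assumes b: "b > 0" and \<nu>: "\<nu> > 0" and s: "Re s > 4 * b" and N: "\<nu> \<le> real N"
  shows "set_integrable lborel {0..} (\<lambda>t. exp (- s * of_real t) * of_real (besselJ \<nu> (b * t)))"
    and "(LINT t:{0..}|lborel. exp (- s * of_real t) * of_real (besselJ \<nu> (b * t)))
       = of_real (b powr \<nu>) / (lap_r b s * lap_R b s powr of_real \<nu>)"
    and "(LINT t:{0..}|lborel. norm (exp (- s * of_real t) * of_real (besselJ \<nu> (b * t))))
       \<le> 2 * 2 ^ N * (b / (2 * Re s)) powr \<nu> / Re s"
proof -
  let ?\<sigma> = "Re s"
  have \<sigma>: "?\<sigma> > 0" using s b by simp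
  define c where "c = (\<lambda>m. (-1) ^ m / (fact m * Gamma (real m + \<nu> + 1)) * (b / 2) powr (2 * real m + \<nu>))"
  define q where "q = (\<lambda>m. 2 * real m + \<nu>)"
  define f where "f = (\<lambda>m t. indicator {0..} t *\<^sub>R (of_real (c m) * (exp (- s * of_real t) * complex_of_real (t powr q m))))"
  have q: "q m > 0" for m using \<nu> by (simp add: q_def)
  have G: "Gamma (real m + \<nu> + 1) > 0" for m using \<nu> by (intro Gamma_real_pos) auto
  have cG: "\<bar>c m\<bar> * Gamma (q m + 1) = bessel_coeff \<nu> m * (b / 2) powr q m"
    "c m * Gamma (q m + 1) = (-1) ^ m * bessel_coeff \<nu> m * (b / 2) powr q m" for m
    using G[of m] \<nu> by (auto simp: c_def q_def abs_mult abs_of_pos bessel_coeff_Gamma[symmetric])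
  have int: "integrable lborel (f m)" for m
    using set_integrable_mult_right[OF set_integrable_exp_powr[of "q m" s], of "of_real (c m)"] q[of m] \<sigma>
    by (simp add: f_def set_integrable_def)
  have I: "integral\<^sup>L lborel (f m) = (-1) ^ m * of_real (bessel_coeff \<nu> m) * of_real ((b / 2) powr (2 * real m + \<nu>)) * s powr (- of_real (2 * real m + \<nu> + 1))" for m
  proof -
    have "integral\<^sup>L lborel (f m) = of_real (c m) * powr_Laplace (q m) s"
      unfolding f_def set_lebesgue_integral_def[symmetric] powr_Laplace_def by (rule set_integral_mult_right)
    also have "\<dots> = of_real (c m * Gamma (q m + 1)) * s powr (- of_real (q m + 1))"
      unfolding powr_Laplace_eq[OF q \<sigma>] by simp
    finally show ?thesis unfolding cG by (simp add: q_def)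
  qed
  have nI: "(\<integral>t. norm (f m t) \<partial>lborel) = bessel_coeff \<nu> m * (b / 2) powr q m * ?\<sigma> powr (- (q m + 1))" for m
  proof -
    have "(\<integral>t. norm (f m t) \<partial>lborel) = (LINT t:{0..}|lborel. \<bar>c m\<bar> * (exp (- ?\<sigma> * t) * t powr q m))"
      unfolding set_lebesgue_integral_def f_def
      by (intro Bochner_Integration.integral_cong refl) (auto simp: norm_mult indicator_def)
    also have "\<dots> = \<bar>c m\<bar> * (Gamma (q m + 1) * ?\<sigma> powr (- (q m + 1)))"
      using powr_exp_real_Laplace(2)[OF _ \<sigma>, of "q m"] q[of m] by simp
    finally show ?thesis by (simp only: mult.assoc[symmetric] cG)
  qed
  define C where "C = 2 ^ N * (b / (2 * ?\<sigma>)) powr \<nu> / ?\<sigma>"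
  have C: "C \<ge> 0" using \<sigma> by (simp add: C_def)
  \<comment> \<open>The bound 4^m on the coefficients meets (b / (2 Re s))^(2m), so the ratio is (b
    / Re s)^2 \<le> 1/16; 1/2 is a convenient larger value.\<close>
  have le: "(\<integral>t. norm (f m t) \<partial>lborel) \<le> C * (1 / 2) ^ m" for m
  proof -
    have bs: "b / ?\<sigma> \<le> 1 / 4" using s b by (simp add: field_simps)
    have 1: "(b / 2) powr q m * ?\<sigma> powr (- (q m + 1)) = (b / (2 * ?\<sigma>)) powr \<nu> * ((b / (2 * ?\<sigma>))\<^sup>2) ^ m / ?\<sigma>"
    proof -
      have "(b / 2) powr q m * ?\<sigma> powr (- (q m + 1)) = (b / (2 * ?\<sigma>)) powr q m / ?\<sigma>"
      proof -
        have "?\<sigma> powr (- (q m + 1)) = 1 / (?\<sigma> powr q m * ?\<sigma>)"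
          using \<sigma> by (simp only: powr_minus_divide powr_add powr_one less_imp_le)
        moreover have "b / (2 * ?\<sigma>) = b / 2 / ?\<sigma>" by simp
        moreover have "(b / 2 / ?\<sigma>) powr q m = (b / 2) powr q m / ?\<sigma> powr q m"
          by (rule powr_divide)
        ultimately show ?thesis by (simp only: divide_divide_eq_left mult_1_right times_divide_eq_right)
      qed
      also have "(b / (2 * ?\<sigma>)) powr q m = (b / (2 * ?\<sigma>)) powr \<nu> * (b / (2 * ?\<sigma>)) powr real (2 * m)"
        by (simp add: q_def flip: powr_add add.commute)
      also have "(b / (2 * ?\<sigma>)) powr real (2 * m) = ((b / (2 * ?\<sigma>))\<^sup>2) ^ m"
        using b \<sigma> by (subst powr_realpow) (simp_all add: power_mult[symmetric])
      finally show ?thesis .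
    qed
    have "(2::real) ^ (2 * m + N) = 2 ^ N * 4 ^ m" by (subst power_add, subst power_mult) simp
    with bessel_coeff_le[OF _ N, of m] \<nu> have "bessel_coeff \<nu> m \<le> 2 ^ N * 4 ^ m" by simp
    then have "(\<integral>t. norm (f m t) \<partial>lborel) \<le> 2 ^ N * 4 ^ m * ((b / (2 * ?\<sigma>)) powr \<nu> * ((b / (2 * ?\<sigma>))\<^sup>2) ^ m / ?\<sigma>)"
      unfolding nI mult.assoc[of "bessel_coeff \<nu> m"] 1 by (intro mult_right_mono) (use \<sigma> in auto)
    also have "\<dots> = C * (4 * (b / (2 * ?\<sigma>))\<^sup>2) ^ m"
      by (simp only: C_def power_mult_distrib) simp
    also have "4 * (b / (2 * ?\<sigma>))\<^sup>2 = (b / ?\<sigma>)\<^sup>2" by (simp add: power_divide power_mult_distrib)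
    also have "C * ((b / ?\<sigma>)\<^sup>2) ^ m \<le> C * (1 / 2) ^ m"
    proof (intro mult_left_mono power_mono C)
      have "(b / ?\<sigma>)\<^sup>2 \<le> (1 / 4)\<^sup>2" using bs b \<sigma> by (intro power_mono) auto
      also have "(1 / 4 :: real)\<^sup>2 \<le> 1 / 2" by (simp add: power2_eq_square)
      finally show "(b / ?\<sigma>)\<^sup>2 \<le> 1 / 2" .
    qed simp
    finally show ?thesis .
  qed
  have geo: "(\<lambda>m. C * (1 / 2) ^ m) sums (C * 2)"
    using sums_mult[OF geometric_sums[of "1 / 2 :: real"], of C] by simp
  have sm: "summable (\<lambda>m. \<integral>t. norm (f m t) \<partial>lborel)"
    by (rule summable_comparison_test[OF _ sums_summable[OF geo]]) (use le in auto)
  have J: "(\<Sum>m. f m t) = indicator {0..} t *\<^sub>R (exp (- s * of_real t) * of_real (besselJ \<nu> (b * t)))" for t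
  proof (cases "t \<in> {0..}")
    case True
    let ?g = "\<lambda>m. (-1) ^ m / (fact m * Gamma (real m + \<nu> + 1)) * (b * t / 2) powr (2 * real m + \<nu>)"
    have "f m t = of_real (?g m) * exp (- s * of_real t)" for m
      using True b by (simp add: f_def c_def q_def powr_mult powr_divide mult_ac)
    moreover have "(\<lambda>m. complex_of_real (?g m) * exp (- s * of_real t)) sums (of_real (besselJ \<nu> (b * t)) * exp (- s * of_real t))"
      unfolding besselJ_def
      by (intro sums_mult2 sums_of_real summable_sums summable_bessel) (use True b \<nu> in auto)
    ultimately show ?thesis using True by (simp add: sums_iff mult_ac)
  qed (simp add: f_def)
  note S = sums_Bochner_integral[OF int sm, unfolded J]
  show "set_integrable lborel {0..} (\<lambda>t. exp (- s * of_real t) * of_real (besselJ \<nu> (b * t)))"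
    unfolding set_integrable_def by (rule S(2))
  show "(LINT t:{0..}|lborel. exp (- s * of_real t) * of_real (besselJ \<nu> (b * t)))
       = of_real (b powr \<nu>) / (lap_r b s * lap_R b s powr of_real \<nu>)"
    using S(3) bessel_Laplace_series[OF b _ s, of \<nu>] \<nu>
    unfolding I set_lebesgue_integral_def by (intro sums_unique2[OF S(3)[unfolded I]]) simp
  have "(LINT t:{0..}|lborel. norm (exp (- s * of_real t) * of_real (besselJ \<nu> (b * t))))
      = (\<integral>t. norm (indicator {0..} t *\<^sub>R (exp (- s * of_real t) * complex_of_real (besselJ \<nu> (b * t)))) \<partial>lborel)"
    unfolding set_lebesgue_integral_def by (intro Bochner_Integration.integral_cong refl) auto
  also have "\<dots> \<le> (\<Sum>m. \<integral>t. norm (f m t) \<partial>lborel)" by (rule S(4))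
  also have "\<dots> \<le> (\<Sum>m. C * (1 / 2) ^ m)" by (rule suminf_le[OF le sm sums_summable[OF geo]])
  also have "\<dots> = C * 2" using geo by (simp add: sums_iff)
  finally show "(LINT t:{0..}|lborel. norm (exp (- s * of_real t) * of_real (besselJ \<nu> (b * t))))
       \<le> 2 * 2 ^ N * (b / (2 * Re s)) powr \<nu> / Re s" by (simp add: C_def mult_ac)
qed

text \<open>The coefficient of x^(m - 2i) in the classical Gegenbauer polynomial C_m of index
  p.\<close>

definition gegen_coeff :: "real \<Rightarrow> nat \<Rightarrow> nat \<Rightarrow> real" where
  "gegen_coeff p m i = (-1) ^ i * pochhammer p (m - i) * 2 ^ (m - 2 * i) / (fact i * fact (m - 2 * i))"

definition gegenbauer :: "real \<Rightarrow> nat \<Rightarrow> real \<Rightarrow> real" where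
  "gegenbauer p m x = (\<Sum>i\<le>m div 2. gegen_coeff p m i * x ^ (m - 2 * i))"

section \<open>Gegenbauer polynomials\<close>

lemma pochhammer_binomial_sums:
  fixes y :: complex
  assumes "norm y < 1"
  shows "(\<lambda>l. of_real (pochhammer p l / fact l) * y ^ l) sums (1 - y) powr (- of_real p)"
proof -
  have "((- complex_of_real p) gchoose l) * (- y) ^ l = of_real (pochhammer p l / fact l) * y ^ l" for l
  proof -
    have "(- complex_of_real p) gchoose l = (-1) ^ l * of_real (pochhammer p l / fact l)"
      unfolding gbinomial_pochhammer minus_minus pochhammer_of_real by simp
    moreover have "(- y) ^ l = (-1) ^ l * y ^ l" by (rule power_minus)
    moreover have "(-1) ^ l * (-1) ^ l = (1::complex)" by (simp flip: power_mult_distrib)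
    moreover have "(a * c) * (a * d) = (a * a) * (c * d)" for a c d :: complex by (simp only: mult_ac)
    ultimately show ?thesis by (simp only: mult_1)
  qed
  with gen_binomial_complex[of "- y" "- complex_of_real p"] assms show ?thesis by simp
qed

lemma pochhammer_binomial_sums_real:
  fixes y :: real
  assumes "\<bar>y\<bar> < 1"
  shows "(\<lambda>l. pochhammer p l / fact l * y ^ l) sums (1 - y) powr (- p)"
proof -
  have "(\<lambda>l. of_real (pochhammer p l / fact l * y ^ l)) sums (of_real ((1 - y) powr (- p)) :: complex)"
    using pochhammer_binomial_sums[of "of_real y" p] assms by (simp add: powr_of_real[symmetric])
  then show ?thesis by (simp only: sums_of_real_iff)
qed

text \<open>The expansion of (1 - y)^(-p) at y = 2 x W - W^2 as a double array: l is the binomial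
  exponent and i counts the factors - W^2 in y^l. The power of W is l + i, so antidiagonals collect
  the powers of W.\<close>

definition gegen_arr :: "real \<Rightarrow> real \<Rightarrow> complex \<Rightarrow> nat \<Rightarrow> nat \<Rightarrow> complex" where
  "gegen_arr p x W l i = of_real (pochhammer p l / fact l) *
     (of_nat (l choose i) * (2 * of_real x * W) ^ (l - i) * (- (W\<^sup>2)) ^ i)"

lemma gegen_arr_antidiagonal:
  "(\<Sum>l\<le>n. gegen_arr p x W l (n - l)) = of_real (gegenbauer p n x) * W ^ n"
proof -
  have "(\<Sum>l\<le>n. gegen_arr p x W l (n - l)) = (\<Sum>i\<le>n. gegen_arr p x W (n - i) i)"
    by (rule sum.reindex_bij_witness[of _ "\<lambda>m. n - m" "\<lambda>m. n - m"]) auto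
  also have "\<dots> = (\<Sum>i\<le>n div 2. gegen_arr p x W (n - i) i)"
    by (rule sum.mono_neutral_right) (auto simp: gegen_arr_def)
  also have "\<dots> = (\<Sum>i\<le>n div 2. of_real (gegen_coeff p n i * x ^ (n - 2 * i)) * W ^ n)"
  proof (intro sum.cong refl)
    fix i assume "i \<in> {..n div 2}"
    then have i: "2 * i \<le> n" by auto
    then have W: "W ^ n = W ^ (n - 2 * i) * (W\<^sup>2) ^ i" by (simp flip: power_add power_mult)
    have b: "real ((n - i) choose i) = fact (n - i) / (fact i * fact (n - 2 * i))"
      using i binomial_fact[of i "n - i", where 'a = real] by (simp add: diff_diff_left mult_2)
    have "pochhammer p (n - i) / fact (n - i) * real ((n - i) choose i) = pochhammer p (n - i) / (fact i * fact (n - 2 * i))"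
      unfolding b by simp
    then have "complex_of_real (pochhammer p (n - i) / fact (n - i)) * of_nat ((n - i) choose i) = of_real (pochhammer p (n - i) / (fact i * fact (n - 2 * i)))"
      by (metis of_real_mult of_real_of_nat_eq)
    moreover have "n - i - i = n - 2 * i" by simp
    ultimately have "gegen_arr p x W (n - i) i = of_real (pochhammer p (n - i) / (fact i * fact (n - 2 * i))) * ((2 * of_real x * W) ^ (n - 2 * i) * (- (W\<^sup>2)) ^ i)"
      unfolding gegen_arr_def by (simp only: mult.assoc[symmetric])
    then show "gegen_arr p x W (n - i) i = of_real (gegen_coeff p n i * x ^ (n - 2 * i)) * W ^ n"
      unfolding W gegen_coeff_def power_mult_distrib power_minus[of "W\<^sup>2"] by (simp add: mult_ac)
  qed
  finally show ?thesis by (simp add: gegenbauer_def sum_distrib_right)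
qed

text \<open>For |W| \<le> 1/4 the norms in y = 2 x W - W^2 add up to at most 1/2 + 1/16 = 9/16. So
  the double series converges absolutely, and its norms sum to at most (7/16)^(-p).\<close>

lemma gegenbauer_gf:
  fixes W :: complex
  assumes p: "p > 0" and x: "\<bar>x\<bar> \<le> 1" and W: "norm W \<le> 1 / 4"
  shows "(\<lambda>m. of_real (gegenbauer p m x) * W ^ m) sums (1 - 2 * W * of_real x + W\<^sup>2) powr (- of_real p)"
    and "(\<Sum>n. \<Sum>l\<le>n. norm (gegen_arr p x W l (n - l))) \<le> (7 / 16) powr (- p)"
    and "summable (\<lambda>n. \<Sum>l\<le>n. norm (gegen_arr p x W l (n - l)))"
proof -
  let ?y = "2 * of_real x * W - W\<^sup>2" and ?z = "2 * \<bar>x\<bar> * norm W + (norm W)\<^sup>2"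
  let ?A = "gegen_arr p x W"
  have "\<bar>x\<bar> * norm W \<le> 1 * (1 / 4)" using x W by (intro mult_mono) auto
  moreover have "(norm W)\<^sup>2 \<le> (1 / 4)\<^sup>2" using W by (intro power_mono) auto
  ultimately have z: "?z \<le> 9 / 16" by (simp add: power2_eq_square)
  have z0: "0 \<le> ?z" by simp
  have "norm ?y \<le> ?z" by (rule order_trans[OF norm_triangle_ineq4]) (simp add: norm_mult norm_power)
  with z have y: "norm ?y < 1" by simp
  have pp: "pochhammer p l / fact l \<ge> 0" for l
    unfolding pochhammer_prod using p by (intro divide_nonneg_nonneg prod_nonneg) auto
  have S: "?A l sums (of_real (pochhammer p l / fact l) * ?y ^ l)" for l
  proof -
    have "(\<Sum>i\<le>l. ?A l i) = of_real (pochhammer p l / fact l) * ?y ^ l"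
      unfolding gegen_arr_def sum_distrib_left[symmetric] using binomial_ring[of "- (W\<^sup>2)" "2 * of_real x * W" l]
      by (simp add: mult_ac)
    moreover have "?A l sums (\<Sum>i\<le>l. ?A l i)"
      by (rule sums_finite) (auto simp: gegen_arr_def)
    ultimately show ?thesis by simp
  qed
  have N: "(\<lambda>i. norm (?A l i)) sums (pochhammer p l / fact l * ?z ^ l)" for l
  proof -
    have n: "norm (?A l i) = pochhammer p l / fact l * (of_nat (l choose i) * ((norm W)\<^sup>2) ^ i * (2 * \<bar>x\<bar> * norm W) ^ (l - i))" for i
      unfolding gegen_arr_def norm_mult norm_power norm_minus_cancel norm_of_real abs_of_nonneg[OF pp]
      by (simp add: norm_mult norm_power)
    have "(\<Sum>i\<le>l. norm (?A l i)) = pochhammer p l / fact l * ?z ^ l"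
      unfolding n sum_distrib_left[symmetric] using binomial_ring[of "(norm W)\<^sup>2" "2 * \<bar>x\<bar> * norm W" l]
      by (simp add: add.commute)
    moreover have "(\<lambda>i. norm (?A l i)) sums (\<Sum>i\<le>l. norm (?A l i))"
      by (rule sums_finite) (auto simp: gegen_arr_def)
    ultimately show ?thesis by simp
  qed
  have Z: "(\<lambda>l. pochhammer p l / fact l * ?z ^ l) sums (1 - ?z) powr (- p)"
    by (rule pochhammer_binomial_sums_real) (use z z0 in linarith)
  have inner: "summable (\<lambda>i. norm (?A l i))" for l by (rule sums_summable[OF N])
  have outer: "summable (\<lambda>l. \<Sum>i. norm (?A l i))"
    unfolding sums_unique[OF N, symmetric] by (rule sums_summable[OF Z])
  note T = sums_antidiagonal[OF inner outer]
  show "(\<lambda>m. of_real (gegenbauer p m x) * W ^ m) sums (1 - 2 * W * of_real x + W\<^sup>2) powr (- of_real p)"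
    using T(1) sums_unique[OF pochhammer_binomial_sums[OF y, of p]]
    unfolding gegen_arr_antidiagonal sums_unique[OF S, symmetric] by (simp add: algebra_simps)
  show "summable (\<lambda>n. \<Sum>l\<le>n. norm (?A l (n - l)))" by (rule sums_summable[OF T(2)])
  have "(\<Sum>n. \<Sum>l\<le>n. norm (?A l (n - l))) = (1 - ?z) powr (- p)"
    using T(2) sums_unique[OF Z] unfolding sums_unique[OF N, symmetric] by (simp add: sums_iff)
  also have "\<dots> \<le> (7 / 16) powr (- p)"
    using z p by (intro powr_mono2') auto
  finally show "(\<Sum>n. \<Sum>l\<le>n. norm (?A l (n - l))) \<le> (7 / 16) powr (- p)" .
qed

text \<open>In the manner of a Cauchy estimate: one coefficient at radius 1/4 is at most the whole
  sum of norms there.\<close>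

lemma gegenbauer_bound:
  assumes p: "p > 0" and x: "\<bar>x\<bar> \<le> 1"
  shows "\<bar>gegenbauer p m x\<bar> \<le> (7 / 16) powr (- p) * 4 ^ m"
proof -
  let ?g = "\<lambda>n. \<Sum>l\<le>n. norm (gegen_arr p x (1 / 4) l (n - l))"
  have W: "norm (1 / 4 :: complex) \<le> 1 / 4" by (simp add: norm_divide)
  note G = gegenbauer_gf[OF p x W]
  have "norm (of_real (gegenbauer p m x) * (1 / 4 :: complex) ^ m) \<le> ?g m"
    unfolding gegen_arr_antidiagonal[symmetric] by (rule norm_sum)
  also have "\<dots> \<le> (\<Sum>n. ?g n)"
    using sum_le_suminf[OF G(3), of "{m}"] by (simp add: sum_nonneg)
  also note G(2)
  finally show ?thesis by (simp add: norm_mult norm_power norm_divide power_divide field_simps)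
qed

section \<open>Moments of the measures and integrals against them\<close>

text \<open>The moment of order a of \<open>mu_dens \<gamma>\<close>. The factor 1 + w adds to each
  moment of the symmetric density the following one, and only the even order of the two contributes.
  Orders 2A - 1 and 2A thus share their value, hence \<open>(a + 1) div 2\<close>.\<close>

definition mu_mom :: "real \<Rightarrow> nat \<Rightarrow> real" where
  "mu_mom \<gamma> a = pochhammer (1 / 2) ((a + 1) div 2) / pochhammer (\<gamma> + 1 / 2) ((a + 1) div 2)"

text \<open>The Beta integral under the substitution t = u^2.\<close>

lemma even_moment:
  assumes \<gamma>: "\<gamma> > 0"
  shows "set_integrable lborel {0..1} (\<lambda>u. u ^ (2 * A) * (1 - u\<^sup>2) powr (\<gamma> - 1))"
    and "(LINT u:{0..1}|lborel. u ^ (2 * A) * (1 - u\<^sup>2) powr (\<gamma> - 1)) = Beta (real A + 1 / 2) \<gamma> / 2"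
proof -
  let ?f = "\<lambda>t::real. t powr ((real A + 1 / 2) - 1) * (1 - t) powr (\<gamma> - 1)"
  let ?h = "\<lambda>u::real. u ^ (2 * A) * (1 - u\<^sup>2) powr (\<gamma> - 1)"
  have i: "set_integrable lborel {0..1} ?f" using \<gamma> by (intro integrable_Beta) auto
  then have i': "set_integrable lborel {(0::real)\<^sup>2..1\<^sup>2} ?f" by simp
  have d: "((\<lambda>x::real. x\<^sup>2) has_real_derivative 2 * x) (at x)" for x
    by (auto intro!: derivative_eq_intros)
  have c: "continuous_on {0..1} (\<lambda>x::real. 2 * x)" by (intro continuous_intros)
  note S = integral_substitution[where g = "\<lambda>x. x\<^sup>2" and g' = "\<lambda>x. 2 * x" and a = 0 and b = 1, OF i' d c]
  \<comment> \<open>For A = 0 the two sides differ at u = 0, where the factor 2 u vanishes, so the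
    equality is used almost everywhere.\<close>
  have eq: "indicator {0..1} u * (?f (u\<^sup>2) * (2 * u)) = indicator {0..1} u * (2 * ?h u)" if "u \<noteq> 0" for u
  proof (cases "u \<in> {0..1}")
    case True
    with that have u: "u > 0" by auto
    have "(u\<^sup>2) powr (real A - 1 / 2) = u powr (2 * real A - 1)"
      using u by (simp add: powr_powr algebra_simps flip: powr_numeral)
    also have "\<dots> = u ^ (2 * A) / u" using u powr_realpow[OF u, of "2 * A"] by (simp add: powr_diff)
    finally show ?thesis using u by simp
  qed simp
  have "AE u in lborel. indicator {0..1} u * (?f (u\<^sup>2) * (2 * u)) = indicator {0..1} u * (2 * ?h u)"
    using AE_lborel_singleton[of 0] by eventually_elim (use eq in auto)
  then have ae: "AE u in lborel. indicator {0..1} u * (?f (u\<^sup>2) * (2 * u)) = indicator {0..1} u * (2 * ?h u)" .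
  have s1: "set_integrable lborel {0..1} (\<lambda>u. ?f (u\<^sup>2) * (2 * u))"
    by (rule S(1)) auto
  have s2: "(LBINT x. ?f x * indicator {0..1} x) = (LBINT u. ?f (u\<^sup>2) * (2 * u) * indicator {0..1} u)"
    using S(2) by simp
  have "integrable lborel (\<lambda>u. indicator {0..1} u * (2 * ?h u))"
    using s1 ae unfolding set_integrable_def real_scaleR_def by (subst integrable_cong_AE[symmetric]) auto
  then show *: "set_integrable lborel {0..1} ?h"
    unfolding set_integrable_def real_scaleR_def by (simp add: mult.left_commute)
  have "2 * (LINT u:{0..1}|lborel. ?h u) = (LBINT u. indicator {0..1} u * (2 * ?h u))"
    unfolding set_lebesgue_integral_def by (simp add: mult.left_commute)
  also have "\<dots> = (LBINT u. indicator {0..1} u * (?f (u\<^sup>2) * (2 * u)))"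
    using ae by (intro integral_cong_AE) auto
  also have "\<dots> = (LBINT x. ?f x * indicator {0..1} x)" unfolding s2 by (simp add: mult_ac)
  also have "\<dots> = (LINT x:{0..1}|lborel. ?f x)" by (simp add: set_lebesgue_integral_def mult.commute)
  also have "\<dots> = Beta (real A + 1 / 2) \<gamma>"
    using set_borel_integral_eq_integral(2)[OF i] has_integral_Beta_real[of "real A + 1 / 2" \<gamma>] \<gamma> by (simp add: integral_unique)
  finally show "(LINT u:{0..1}|lborel. ?h u) = Beta (real A + 1 / 2) \<gamma> / 2" by simp
qed

lemma moment_both_sides:
  assumes \<gamma>: "\<gamma> > 0"
  shows "set_integrable lborel {-1..1} (\<lambda>u. u ^ a * (1 - u\<^sup>2) powr (\<gamma> - 1))"
    and "(LINT u:{-1..1}|lborel. u ^ a * (1 - u\<^sup>2) powr (\<gamma> - 1)) = (if even a then Beta (real (a div 2) + 1 / 2) \<gamma> else 0)"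
proof -
  let ?h = "\<lambda>a u::real. u ^ a * (1 - u\<^sup>2) powr (\<gamma> - 1)"
  have pos: "set_integrable lborel {0..1} (?h a)" for a
    by (rule set_integrable_bound[OF even_moment(1)[OF \<gamma>, of 0]])
      (auto simp: set_borel_measurable_def abs_mult power_abs intro!: AE_I2 mult_left_le_one_le power_le_one)
  have refl: "indicator {-1..0} (0 + (-1) * u) *\<^sub>R ?h a (0 + (-1) * u) = (-1) ^ a * (indicator {0..1} u *\<^sub>R ?h a u)" for a and u :: real
    by (auto simp: indicator_def power_minus[of u])
  have neg: "set_integrable lborel {-1..0} (?h a)" for a
  proof -
    have "integrable lborel (\<lambda>u. (-1) ^ a * (indicator {0..1} u *\<^sub>R ?h a u))"
      using pos[of a] unfolding set_integrable_def by simp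
    then have "integrable lborel (\<lambda>u. indicator {-1..0} (0 + (-1) * u) *\<^sub>R ?h a (0 + (-1) * u))" unfolding refl .
    then show ?thesis unfolding set_integrable_def by (subst (asm) lborel_integrable_real_affine_iff) auto
  qed
  have negi: "(LINT u:{-1..0}|lborel. ?h a u) = (-1) ^ a * (LINT u:{0..1}|lborel. ?h a u)"
    unfolding set_lebesgue_integral_def
    by (subst lborel_integral_real_affine[of "-1" _ 0]) (simp_all only: refl, simp_all)
  have un: "{-1..1::real} = {-1..0} \<union> {0..1}" by auto
  show "set_integrable lborel {-1..1} (?h a)"
    unfolding un by (rule set_integrable_Un[OF neg pos]) auto
  have "(LINT u:{-1..1}|lborel. ?h a u) = (LINT u:{-1..0}|lborel. ?h a u) + (LINT u:{0..1}|lborel. ?h a u)"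
    unfolding un
  proof (rule set_integral_Un_AE[OF _ _ _ neg pos])
    show "AE x in lborel. \<not> (x \<in> {-1..0::real} \<and> x \<in> {0..1})"
      using AE_lborel_singleton[of "0::real"] by eventually_elim auto
  qed auto
  also have "\<dots> = (if even a then Beta (real (a div 2) + 1 / 2) \<gamma> else 0)"
    unfolding negi using even_moment(2)[OF \<gamma>, of "a div 2"] by auto
  finally show "(LINT u:{-1..1}|lborel. ?h a u) = (if even a then Beta (real (a div 2) + 1 / 2) \<gamma> else 0)" .
qed

lemma Beta_half_ratio:
  assumes "\<gamma> > 0"
  shows "Beta (real A + 1 / 2) \<gamma> / Beta (1 / 2) \<gamma> = pochhammer (1 / 2) A / pochhammer (\<gamma> + 1 / 2) A"
proof -
  have n: "(1 / 2 :: real) \<notin> \<int>\<^sub>\<le>\<^sub>0" "\<gamma> + 1 / 2 \<notin> \<int>\<^sub>\<le>\<^sub>0"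
    using nonpos_Ints_nonpos[of "\<gamma> + 1 / 2"] nonpos_Ints_nonpos[of "1 / 2 :: real"] assms by linarith+
  have G: "Gamma (1 / 2 :: real) > 0" "Gamma \<gamma> > 0" "Gamma (\<gamma> + 1 / 2) > 0" "Gamma (real A + 1 / 2 + \<gamma>) > 0"
    using assms by (auto intro!: Gamma_real_pos add_pos_pos add_nonneg_pos)
  show ?thesis
    unfolding pochhammer_Gamma[OF n(1)] pochhammer_Gamma[OF n(2)] Beta_def
    using G by (simp add: add_ac field_simps)
qed

lemma mu_dens_nonneg: "\<gamma> > 0 \<Longrightarrow> u \<in> {-1..1} \<Longrightarrow> mu_dens \<gamma> u \<ge> 0"
  unfolding mu_dens_def by (intro mult_nonneg_nonneg) (auto simp: Beta_def intro!: divide_nonneg_nonneg Gamma_real_nonneg mult_nonneg_nonneg)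

lemma mu_dens_moment:
  assumes \<gamma>: "\<gamma> > 0"
  shows "set_integrable lborel {-1..1} (\<lambda>u. mu_dens \<gamma> u * u ^ a)"
    and "(LINT u:{-1..1}|lborel. mu_dens \<gamma> u * u ^ a) = mu_mom \<gamma> a"
proof -
  let ?h = "\<lambda>a u::real. u ^ a * (1 - u\<^sup>2) powr (\<gamma> - 1)"
  let ?B = "Beta (1 / 2) \<gamma>"
  have eq: "mu_dens \<gamma> u * u ^ a = (1 / ?B) * (?h a u + ?h (Suc a) u)" for u
    by (simp add: mu_dens_def algebra_simps add_divide_distrib)
  note M = moment_both_sides[OF \<gamma>]
  show "set_integrable lborel {-1..1} (\<lambda>u. mu_dens \<gamma> u * u ^ a)"
    unfolding eq by (intro set_integrable_mult_right set_integral_add M)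
  have "(LINT u:{-1..1}|lborel. mu_dens \<gamma> u * u ^ a) = (1 / ?B) * ((LINT u:{-1..1}|lborel. ?h a u) + (LINT u:{-1..1}|lborel. ?h (Suc a) u))"
    unfolding eq set_integral_mult_right by (simp only: set_integral_add(2)[OF M(1) M(1)])
  also have "\<dots> = Beta (real ((a + 1) div 2) + 1 / 2) \<gamma> / ?B"
    unfolding M(2) by auto
  finally show "(LINT u:{-1..1}|lborel. mu_dens \<gamma> u * u ^ a) = mu_mom \<gamma> a"
    unfolding mu_mom_def Beta_half_ratio[OF \<gamma>] .
qed

text \<open>For \<open>\<gamma> = 0\<close> the measure degenerates to the point mass at 1; this makes the group with a single
  class of reflections the case \<open>\<beta> = 0\<close> of the other one.\<close>

definition dmu :: "real \<Rightarrow> (real \<Rightarrow> complex) \<Rightarrow> complex" where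
  "dmu \<gamma> F = (if \<gamma> > 0 then (LINT u:{-1..1}|lborel. of_real (mu_dens \<gamma> u) * F u) else F 1)"

definition dmu_int :: "real \<Rightarrow> (real \<Rightarrow> complex) \<Rightarrow> bool" where
  "dmu_int \<gamma> F \<longleftrightarrow> (\<gamma> > 0 \<longrightarrow> set_integrable lborel {-1..1} (\<lambda>u. of_real (mu_dens \<gamma> u) * F u))"

text \<open>\<open>mu_mom 0 a\<close> is 1, the moment of the point mass, so the formulas from here
  on cover the degenerate case.\<close>

lemma dmu_power:
  assumes "\<gamma> \<ge> 0"
  shows "dmu_int \<gamma> (\<lambda>u. of_real (u ^ a))" "dmu \<gamma> (\<lambda>u. of_real (u ^ a)) = of_real (mu_mom \<gamma> a)"
proof -
  have "pochhammer (1 / 2 :: real) n \<noteq> 0" for n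
    unfolding pochhammer_prod by (auto simp: add_eq_0_iff)
  then have "mu_mom 0 a = 1" by (simp add: mu_mom_def)
  then show "dmu \<gamma> (\<lambda>u. of_real (u ^ a)) = of_real (mu_mom \<gamma> a)"
    using mu_dens_moment(2)[of \<gamma> a] assms unfolding dmu_def
    by (simp flip: of_real_mult of_real_power add: set_integral_complex_of_real)
  show "dmu_int \<gamma> (\<lambda>u. of_real (u ^ a))"
    unfolding dmu_int_def
  proof
    assume "\<gamma> > 0"
    then have "integrable lborel (\<lambda>u. complex_of_real (indicator {-1..1} u *\<^sub>R (mu_dens \<gamma> u * u ^ a)))"
      by (intro integrable_of_real mu_dens_moment(1)[unfolded set_integrable_def])
    then show "set_integrable lborel {-1..1} (\<lambda>u. complex_of_real (mu_dens \<gamma> u) * complex_of_real (u ^ a))"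
      unfolding set_integrable_def by (simp add: scaleR_conv_of_real)
  qed
qed

lemma dmu_cmult: "dmu \<gamma> (\<lambda>u. c * F u) = c * dmu \<gamma> F" "dmu_int \<gamma> F \<Longrightarrow> dmu_int \<gamma> (\<lambda>u. c * F u)"
  by (simp_all add: dmu_def dmu_int_def mult.left_commute[of _ c])

lemma dmu_sum:
  assumes "finite A" "\<And>i. i \<in> A \<Longrightarrow> dmu_int \<gamma> (F i)"
  shows "dmu_int \<gamma> (\<lambda>u. \<Sum>i\<in>A. F i u)" "dmu \<gamma> (\<lambda>u. \<Sum>i\<in>A. F i u) = (\<Sum>i\<in>A. dmu \<gamma> (F i))"
  using assms unfolding dmu_def dmu_int_def set_integrable_def set_lebesgue_integral_def
  by (simp_all add: sum_distrib_left scaleR_sum_right del: sum_indicator_scaleR)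

text \<open>The density is nonnegative on the interval and its total mass is
  \<open>mu_mom \<gamma> 0 = 1\<close>.\<close>

lemma dmu_bound:
  assumes \<gamma>: "\<gamma> \<ge> 0" and F: "dmu_int \<gamma> F" and le: "\<And>u. u \<in> {-1..1} \<Longrightarrow> norm (F u) \<le> C"
  shows "norm (dmu \<gamma> F) \<le> C"
    and "\<gamma> > 0 \<Longrightarrow> (LINT u:{-1..1}|lborel. norm (of_real (mu_dens \<gamma> u) * F u)) \<le> C"
proof -
  show *: "(LINT u:{-1..1}|lborel. norm (of_real (mu_dens \<gamma> u) * F u)) \<le> C" if g: "\<gamma> > 0"
  proof -
    have i: "set_integrable lborel {-1..1} (\<lambda>u. mu_dens \<gamma> u)"
      using mu_dens_moment(1)[OF g, of 0] by simp
    have "(LINT u:{-1..1}|lborel. norm (of_real (mu_dens \<gamma> u) * F u)) \<le> (LINT u:{-1..1}|lborel. C * mu_dens \<gamma> u)"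
    proof (rule set_integral_mono)
      show "set_integrable lborel {-1..1} (\<lambda>u. norm (of_real (mu_dens \<gamma> u) * F u))"
        using F g unfolding dmu_int_def by (intro set_integrable_norm) auto
      show "set_integrable lborel {-1..1} (\<lambda>u. C * mu_dens \<gamma> u)" using i by simp
      show "norm (of_real (mu_dens \<gamma> u) * F u) \<le> C * mu_dens \<gamma> u" if "u \<in> {-1..1}" for u
        using mult_right_mono[OF le[OF that] mu_dens_nonneg[OF g that]] mu_dens_nonneg[OF g that]
        by (simp add: norm_mult mult.commute)
    qed
    also have "\<dots> = C" using mu_dens_moment(2)[OF g, of 0] by (simp add: mu_mom_def)
    finally show ?thesis .
  qed
  show "norm (dmu \<gamma> F) \<le> C"
  proof (cases "\<gamma> > 0")
    case True
    have "norm (dmu \<gamma> F) \<le> (LINT u:{-1..1}|lborel. norm (of_real (mu_dens \<gamma> u) * F u))"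
      using True F unfolding dmu_def dmu_int_def by (auto intro: set_integral_norm_bound)
    with * True show ?thesis by fastforce
  qed (use le[of 1] in \<open>simp add: dmu_def\<close>)
qed

lemma dmu_sums:
  assumes \<gamma>: "\<gamma> \<ge> 0" and F: "\<And>m. dmu_int \<gamma> (F m)"
    and le: "\<And>m u. u \<in> {-1..1} \<Longrightarrow> norm (F m u) \<le> C m" and C: "summable C"
    and G: "\<And>u. u \<in> {-1..1} \<Longrightarrow> (\<lambda>m. F m u) sums G u"
  shows "(\<lambda>m. dmu \<gamma> (F m)) sums dmu \<gamma> G"
proof (cases "\<gamma> > 0")
  case True
  let ?f = "\<lambda>m u. indicator {-1..1} u *\<^sub>R (of_real (mu_dens \<gamma> u) * F m u)"
  have int: "integrable lborel (?f m)" for m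
    using F[of m] True by (simp add: dmu_int_def set_integrable_def)
  have "(\<integral>u. norm (?f m u) \<partial>lborel) \<le> C m" for m
    using dmu_bound(2)[OF \<gamma> F le True] unfolding set_lebesgue_integral_def by simp
  then have sm: "summable (\<lambda>m. \<integral>u. norm (?f m u) \<partial>lborel)"
    by (intro summable_comparison_test[OF _ C]) auto
  have "(\<Sum>m. ?f m u) = indicator {-1..1} u *\<^sub>R (of_real (mu_dens \<gamma> u) * G u)" for u
  proof (cases "u \<in> {-1..1}")
    case True
    then show ?thesis using sums_mult[OF G[OF True], of "of_real (mu_dens \<gamma> u)"] by (simp add: sums_iff)
  qed simp
  with sums_Bochner_integral(3)[OF int sm] show ?thesis
    using True by (simp add: dmu_def set_lebesgue_integral_def)
qed (use G[of 1] in \<open>simp add: dmu_def\<close>)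

text \<open>The double integral of the Gegenbauer polynomial of index \<open>\<alpha> + \<beta> + 1\<close> at \<open>U u + V v\<close>, expanded
  by means of the moments of the two measures.\<close>

definition Qker :: "real \<Rightarrow> real \<Rightarrow> nat \<Rightarrow> real \<Rightarrow> real \<Rightarrow> real" where
  "Qker \<alpha> \<beta> m U V = (\<Sum>i\<le>m div 2. gegen_coeff (\<alpha> + \<beta> + 1) m i *
     (\<Sum>a\<le>m - 2 * i. of_nat ((m - 2 * i) choose a) * (mu_mom \<alpha> a * U ^ a) * (mu_mom \<beta> (m - 2 * i - a) * V ^ (m - 2 * i - a))))"

lemma gegenbauer_expand:
  "complex_of_real (gegenbauer p m (U * u + V * v)) = (\<Sum>i\<le>m div 2. \<Sum>a\<le>m - 2 * i.
     of_real (gegen_coeff p m i * of_nat ((m - 2 * i) choose a) * U ^ a * V ^ (m - 2 * i - a) * u ^ a) * of_real (v ^ (m - 2 * i - a)))"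
  by (simp add: gegenbauer_def binomial_ring sum_distrib_left power_mult_distrib mult_ac)

lemma gegenbauer_dmu_right:
  assumes "\<beta> \<ge> 0"
  shows "dmu_int \<beta> (\<lambda>v. of_real (gegenbauer p m (U * u + V * v)))"
    "dmu \<beta> (\<lambda>v. of_real (gegenbauer p m (U * u + V * v))) = (\<Sum>i\<le>m div 2. \<Sum>a\<le>m - 2 * i.
     of_real (gegen_coeff p m i * of_nat ((m - 2 * i) choose a) * U ^ a * (mu_mom \<beta> (m - 2 * i - a) * V ^ (m - 2 * i - a))) * of_real (u ^ a))"
proof -
  show "dmu_int \<beta> (\<lambda>v. of_real (gegenbauer p m (U * u + V * v)))"
    unfolding gegenbauer_expand by (intro dmu_sum dmu_cmult dmu_power assms) auto
  show "dmu \<beta> (\<lambda>v. of_real (gegenbauer p m (U * u + V * v))) = (\<Sum>i\<le>m div 2. \<Sum>a\<le>m - 2 * i.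
     of_real (gegen_coeff p m i * of_nat ((m - 2 * i) choose a) * U ^ a * (mu_mom \<beta> (m - 2 * i - a) * V ^ (m - 2 * i - a))) * of_real (u ^ a))"
    unfolding gegenbauer_expand
    by (simp add: dmu_sum dmu_cmult dmu_power[OF assms] del: of_real_mult of_real_power) (simp add: mult_ac)
qed

lemma gegenbauer_dmu:
  assumes "\<alpha> \<ge> 0" "\<beta> \<ge> 0"
  shows "dmu_int \<alpha> (\<lambda>u. dmu \<beta> (\<lambda>v. of_real (gegenbauer (\<alpha> + \<beta> + 1) m (U * u + V * v))))"
    "dmu \<alpha> (\<lambda>u. dmu \<beta> (\<lambda>v. of_real (gegenbauer (\<alpha> + \<beta> + 1) m (U * u + V * v)))) = of_real (Qker \<alpha> \<beta> m U V)"
proof -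
  show "dmu_int \<alpha> (\<lambda>u. dmu \<beta> (\<lambda>v. of_real (gegenbauer (\<alpha> + \<beta> + 1) m (U * u + V * v))))"
    unfolding gegenbauer_dmu_right[OF assms(2)] by (intro dmu_sum dmu_cmult dmu_power assms) auto
  show "dmu \<alpha> (\<lambda>u. dmu \<beta> (\<lambda>v. of_real (gegenbauer (\<alpha> + \<beta> + 1) m (U * u + V * v)))) = of_real (Qker \<alpha> \<beta> m U V)"
    unfolding gegenbauer_dmu_right[OF assms(2)] Qker_def
    by (simp add: dmu_sum dmu_cmult dmu_power[OF assms(1)] del: of_real_mult of_real_power)
      (simp add: sum_distrib_left mult_ac)
qed

lemma convex_comb_le_1:
  fixes U V u v :: real
  assumes "\<bar>U\<bar> + \<bar>V\<bar> \<le> 1" "u \<in> {-1..1}" "v \<in> {-1..1}"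
  shows "\<bar>U * u + V * v\<bar> \<le> 1"
proof -
  have "\<bar>U * u + V * v\<bar> \<le> \<bar>U\<bar> * \<bar>u\<bar> + \<bar>V\<bar> * \<bar>v\<bar>"
    using abs_triangle_ineq[of "U * u" "V * v"] by (simp add: abs_mult)
  also have "\<dots> \<le> \<bar>U\<bar> * 1 + \<bar>V\<bar> * 1" using assms by (intro add_mono mult_left_mono) auto
  finally show ?thesis using assms by simp
qed

text \<open>The argument U u + V v stays in [-1, 1], and averaging against probability measures
  preserves a uniform bound.\<close>

lemma Qker_bound:
  assumes "\<alpha> \<ge> 0" "\<beta> \<ge> 0" "\<bar>U\<bar> + \<bar>V\<bar> \<le> 1"
  shows "\<bar>Qker \<alpha> \<beta> m U V\<bar> \<le> (7 / 16) powr (- (\<alpha> + \<beta> + 1)) * 4 ^ m"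
proof -
  let ?C = "(7 / 16) powr (- (\<alpha> + \<beta> + 1)) * 4 ^ m :: real"
  have "norm (dmu \<alpha> (\<lambda>u. dmu \<beta> (\<lambda>v. of_real (gegenbauer (\<alpha> + \<beta> + 1) m (U * u + V * v))))) \<le> ?C"
    using assms by (intro dmu_bound gegenbauer_dmu(1) gegenbauer_dmu_right(1))
      (simp_all only: norm_of_real, intro gegenbauer_bound convex_comb_le_1, auto)
  then show ?thesis unfolding gegenbauer_dmu(2)[OF assms(1,2)] by simp
qed

text \<open>The Gegenbauer generating function is integrated term by term, the inner measure before
  the outer one. At radius 1/8 the growth 4^m is dominated with ratio 1/2, uniformly in u and
  v.\<close>

lemma Qker_gf:
  assumes ab: "\<alpha> \<ge> 0" "\<beta> \<ge> 0" and UV: "\<bar>U\<bar> + \<bar>V\<bar> \<le> 1" and W: "norm W \<le> 1 / 8"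
  shows "(\<lambda>m. of_real (Qker \<alpha> \<beta> m U V) * W ^ m) sums
     dmu \<alpha> (\<lambda>u. dmu \<beta> (\<lambda>v. (1 - 2 * W * of_real (U * u + V * v) + W\<^sup>2) powr (- of_real (\<alpha> + \<beta> + 1))))"
proof -
  let ?p = "\<alpha> + \<beta> + 1"
  let ?C = "\<lambda>m. (7 / 16) powr (- ?p) * (1 / 2) ^ m :: real"
  have C: "summable ?C" by (intro summable_mult summable_geometric) simp
  have W': "norm W \<le> 1 / 4" using W by simp
  have p: "?p > 0" using ab by simp
  have b: "norm (W ^ m * of_real (gegenbauer ?p m (U * u + V * v))) \<le> ?C m" if "u \<in> {-1..1}" "v \<in> {-1..1}" for m u v
  proof -
    have "norm (W ^ m * of_real (gegenbauer ?p m (U * u + V * v))) \<le> (1 / 8) ^ m * ((7 / 16) powr (- ?p) * 4 ^ m)"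
      unfolding norm_mult norm_power norm_of_real
      using W by (intro mult_mono power_mono gegenbauer_bound convex_comb_le_1 p UV that) auto
    also have "\<dots> = (7 / 16) powr (- ?p) * ((1 / 8) * 4) ^ m" by (simp only: power_mult_distrib mult_ac)
    finally show ?thesis by simp
  qed
  have "(\<lambda>m. dmu \<alpha> (\<lambda>u. dmu \<beta> (\<lambda>v. W ^ m * of_real (gegenbauer ?p m (U * u + V * v))))) sums
     dmu \<alpha> (\<lambda>u. dmu \<beta> (\<lambda>v. (1 - 2 * W * of_real (U * u + V * v) + W\<^sup>2) powr (- of_real ?p)))"
  proof (rule dmu_sums[OF ab(1) _ _ C])
    show "dmu_int \<alpha> (\<lambda>u. dmu \<beta> (\<lambda>v. W ^ m * of_real (gegenbauer ?p m (U * u + V * v))))" for m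
      unfolding dmu_cmult(1) by (intro dmu_cmult(2) gegenbauer_dmu(1) ab)
    fix u :: real assume u: "u \<in> {-1..1}"
    show "norm (dmu \<beta> (\<lambda>v. W ^ m * of_real (gegenbauer ?p m (U * u + V * v)))) \<le> ?C m" for m
      by (rule dmu_bound(1)[OF ab(2) _ b[OF u]]) (intro dmu_cmult(2) gegenbauer_dmu_right(1) ab)
    show "(\<lambda>m. dmu \<beta> (\<lambda>v. W ^ m * of_real (gegenbauer ?p m (U * u + V * v)))) sums
      dmu \<beta> (\<lambda>v. (1 - 2 * W * of_real (U * u + V * v) + W\<^sup>2) powr (- of_real ?p))"
    proof (rule dmu_sums[OF ab(2) _ b[OF u] C])
      show "dmu_int \<beta> (\<lambda>v. W ^ m * of_real (gegenbauer ?p m (U * u + V * v)))" for m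
        by (intro dmu_cmult(2) gegenbauer_dmu_right(1) ab)
      show "(\<lambda>m. W ^ m * of_real (gegenbauer ?p m (U * u + V * v))) sums
        (1 - 2 * W * of_real (U * u + V * v) + W\<^sup>2) powr (- of_real ?p)" if "v \<in> {-1..1}" for v
        using gegenbauer_gf(1)[OF p convex_comb_le_1[OF UV u that] W'] by (simp add: mult.commute)
    qed
  qed
  then show ?thesis unfolding dmu_cmult(1) gegenbauer_dmu(2)[OF ab] by (simp add: mult.commute)
qed

section \<open>Dunkl operators on homogeneous polynomials\<close>

text \<open>Homogeneous forms in arbitrary coordinate functions, since the same space is used in
  three coordinate systems: real and imaginary part for derivatives, z and its conjugate for scaling
  and for the circle, rotated coordinates for a single mirror.\<close>

definition hform :: "(complex \<Rightarrow> complex) \<Rightarrow> (complex \<Rightarrow> complex) \<Rightarrow> nat \<Rightarrow> (complex \<Rightarrow> complex) set" where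
  "hform u v n = {f. \<exists>c. \<forall>z. f z = (\<Sum>a\<le>n. c a * u z ^ a * v z ^ (n - a))}"

lemma hformI: "(\<And>z. f z = (\<Sum>a\<le>n. c a * u z ^ a * v z ^ (n - a))) \<Longrightarrow> f \<in> hform u v n"
  unfolding hform_def by blast

lemma hform_zero: "(\<lambda>z. 0) \<in> hform u v n"
  by (rule hformI[where c = "\<lambda>_. 0"]) simp

lemma hform_add: "f \<in> hform u v n \<Longrightarrow> g \<in> hform u v n \<Longrightarrow> (\<lambda>z. f z + g z) \<in> hform u v n"
proof -
  assume "f \<in> hform u v n" "g \<in> hform u v n"
  then obtain c d where "\<And>z. f z = (\<Sum>a\<le>n. c a * u z ^ a * v z ^ (n - a))" "\<And>z. g z = (\<Sum>a\<le>n. d a * u z ^ a * v z ^ (n - a))"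
    unfolding hform_def by blast
  then show ?thesis by (intro hformI[where c = "\<lambda>a. c a + d a"]) (simp add: algebra_simps sum.distrib)
qed

lemma hform_cmult: "f \<in> hform u v n \<Longrightarrow> (\<lambda>z. k * f z) \<in> hform u v n"
proof -
  assume "f \<in> hform u v n"
  then obtain c where "\<And>z. f z = (\<Sum>a\<le>n. c a * u z ^ a * v z ^ (n - a))" unfolding hform_def by blast
  then show ?thesis by (intro hformI[where c = "\<lambda>a. k * c a"]) (simp add: algebra_simps sum_distrib_left)
qed

lemma hform_diff: "f \<in> hform u v n \<Longrightarrow> g \<in> hform u v n \<Longrightarrow> (\<lambda>z. f z - g z) \<in> hform u v n"
  using hform_add[of f u v n "\<lambda>z. (- 1) * g z"] hform_cmult[of g u v n "- 1"] by simp

lemma hform_sum: "(\<And>i. i \<in> A \<Longrightarrow> f i \<in> hform u v n) \<Longrightarrow> (\<lambda>z. \<Sum>i\<in>A. f i z) \<in> hform u v n"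
  by (induction A rule: infinite_finite_induct) (auto intro: hform_zero hform_add)

lemma hform_monom: "a + b = n \<Longrightarrow> (\<lambda>z. u z ^ a * v z ^ b) \<in> hform u v n"
  by (rule hformI[where c = "\<lambda>i. if i = a then 1 else 0"]) (auto simp: if_distrib[of "\<lambda>x. x * _"] cong: if_cong)

lemma hform_mult:
  assumes "f \<in> hform u v m" "g \<in> hform u v n"
  shows "(\<lambda>z. f z * g z) \<in> hform u v (m + n)"
proof -
  from assms obtain c d where f: "\<And>z. f z = (\<Sum>a\<le>m. c a * u z ^ a * v z ^ (m - a))"
    and g: "\<And>z. g z = (\<Sum>a\<le>n. d a * u z ^ a * v z ^ (n - a))" unfolding hform_def by blast
  have "(\<lambda>z. \<Sum>a\<le>m. \<Sum>b\<le>n. (c a * d b) * (u z ^ (a + b) * v z ^ ((m - a) + (n - b)))) \<in> hform u v (m + n)"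
    by (intro hform_sum hform_cmult hform_monom) auto
  also have "(\<lambda>z. \<Sum>a\<le>m. \<Sum>b\<le>n. (c a * d b) * (u z ^ (a + b) * v z ^ ((m - a) + (n - b)))) = (\<lambda>z. f z * g z)"
    unfolding f g sum_product
  proof (intro ext sum.cong refl)
    fix z a b
    have "u z ^ (a + b) * v z ^ ((m - a) + (n - b)) = (u z ^ a * v z ^ (m - a)) * (u z ^ b * v z ^ (n - b))"
      unfolding power_add by (simp add: mult_ac)
    then show "(c a * d b) * (u z ^ (a + b) * v z ^ ((m - a) + (n - b))) = c a * u z ^ a * v z ^ (m - a) * (d b * u z ^ b * v z ^ (n - b))"
      by simp
  qed
  finally show ?thesis .
qed

lemma hform_one: "(\<lambda>z. 1) \<in> hform u v 0"
  by (rule hformI[where c = "\<lambda>_. 1"]) simp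

lemma hform_power: "f \<in> hform u v m \<Longrightarrow> (\<lambda>z. f z ^ k) \<in> hform u v (k * m)"
  by (induction k) (auto intro: hform_one dest: hform_mult simp: add.commute)

lemma hform_basis_change:
  assumes "u' \<in> hform u v 1" "v' \<in> hform u v 1" "f \<in> hform u' v' n"
  shows "f \<in> hform u v n"
proof -
  from assms(3) obtain c where f: "\<And>z. f z = (\<Sum>a\<le>n. c a * u' z ^ a * v' z ^ (n - a))" unfolding hform_def by blast
  have "(\<lambda>z. u' z ^ a * v' z ^ (n - a)) \<in> hform u v n" if "a \<le> n" for a
    using hform_mult[OF hform_power[OF assms(1), of a] hform_power[OF assms(2), of "n - a"]] that by simp
  then have "(\<lambda>z. \<Sum>a\<le>n. c a * (u' z ^ a * v' z ^ (n - a))) \<in> hform u v n"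
    by (intro hform_sum hform_cmult) auto
  moreover have "f = (\<lambda>z. \<Sum>a\<le>n. c a * (u' z ^ a * v' z ^ (n - a)))"
    by (rule ext) (simp add: f mult.assoc)
  ultimately show ?thesis by simp
qed

lemma hform_lin: "(\<And>z. f z = p * u z + q * v z) \<Longrightarrow> f \<in> hform u v 1"
  by (rule hformI[where c = "\<lambda>a. if a = 0 then q else p"]) simp

abbreviation "cRe \<equiv> \<lambda>z. complex_of_real (Re z)"
abbreviation "cIm \<equiv> \<lambda>z. complex_of_real (Im z)"

lemma homog_poly_eq: "homog_poly n = hform cRe cIm n"
  unfolding homog_poly_def hform_def by (simp add: mult.assoc)

lemma homog_poly_eq': "homog_poly n = hform (\<lambda>z. z) cnj n"
proof -
  have 1: "cRe \<in> hform (\<lambda>z. z) cnj 1"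
    by (rule hform_lin[where p = "1/2" and q = "1/2"]) (simp add: complex_eq_iff)
  have 2: "cIm \<in> hform (\<lambda>z. z) cnj 1"
    by (rule hform_lin[where p = "- \<i> / 2" and q = "\<i> / 2"]) (simp add: complex_eq_iff)
  have 3: "(\<lambda>z. z) \<in> hform cRe cIm 1"
    by (rule hform_lin[where p = 1 and q = \<i>]) (simp add: complex_eq_iff)
  have 4: "cnj \<in> hform cRe cIm 1"
    by (rule hform_lin[where p = 1 and q = "- \<i>"]) (simp add: complex_eq_iff)
  show ?thesis
    unfolding homog_poly_eq using hform_basis_change[OF 1 2] hform_basis_change[OF 3 4] by blast
qed

text \<open>Coordinates adapted to the mirror at angle \<open>\<theta>\<close>: the reflection fixes the first and negates the second.\<close>

abbreviation "rRe \<theta> \<equiv> \<lambda>z. complex_of_real (Re (cis (- \<theta>) * z))"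
abbreviation "rIm \<theta> \<equiv> \<lambda>z. complex_of_real (Im (cis (- \<theta>) * z))"

lemma homog_poly_eq_rot: "homog_poly n = hform (rRe \<theta>) (rIm \<theta>) n"
proof -
  have 1: "cRe \<in> hform (rRe \<theta>) (rIm \<theta>) 1"
  proof (rule hform_lin[where p = "of_real (cos \<theta>)" and q = "- of_real (sin \<theta>)"])
    fix z
    have "cos \<theta> * (cos \<theta> * Re z + sin \<theta> * Im z) - sin \<theta> * (cos \<theta> * Im z - sin \<theta> * Re z) = ((cos \<theta>)\<^sup>2 + (sin \<theta>)\<^sup>2) * Re z"
      by algebra
    then show "cRe z = of_real (cos \<theta>) * rRe \<theta> z + - of_real (sin \<theta>) * rIm \<theta> z"
      by (simp flip: of_real_mult of_real_add of_real_diff of_real_minus)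
  qed
  have 2: "cIm \<in> hform (rRe \<theta>) (rIm \<theta>) 1"
  proof (rule hform_lin[where p = "of_real (sin \<theta>)" and q = "of_real (cos \<theta>)"])
    fix z
    have "sin \<theta> * (cos \<theta> * Re z + sin \<theta> * Im z) + cos \<theta> * (cos \<theta> * Im z - sin \<theta> * Re z) = ((cos \<theta>)\<^sup>2 + (sin \<theta>)\<^sup>2) * Im z"
      by algebra
    then show "cIm z = of_real (sin \<theta>) * rRe \<theta> z + of_real (cos \<theta>) * rIm \<theta> z"
      by (simp flip: of_real_mult of_real_add of_real_diff of_real_minus)
  qed
  have 3: "rRe \<theta> \<in> hform cRe cIm 1"
    by (rule hform_lin[where p = "of_real (cos \<theta>)" and q = "of_real (sin \<theta>)"]) simp
  have 4: "rIm \<theta> \<in> hform cRe cIm 1"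
    by (rule hform_lin[where p = "- of_real (sin \<theta>)" and q = "of_real (cos \<theta>)"]) simp
  show ?thesis
    unfolding homog_poly_eq using hform_basis_change[OF 1 2] hform_basis_change[OF 3 4] by blast
qed

lemma homog_poly_scale:
  assumes "f \<in> homog_poly n"
  shows "f (of_real r * z) = of_real (r ^ n) * f z"
proof -
  from assms obtain c where f: "\<And>z. f z = (\<Sum>a\<le>n. c a * z ^ a * cnj z ^ (n - a))"
    unfolding homog_poly_eq' hform_def by blast
  have "(of_real r * z) ^ a * cnj (of_real r * z) ^ (n - a) = of_real (r ^ n) * (z ^ a * cnj z ^ (n - a))" if "a \<le> n" for a
  proof -
    have "complex_of_real (r ^ n) = of_real r ^ a * of_real r ^ (n - a)" using that by (simp flip: power_add)
    then show ?thesis by (simp add: power_mult_distrib)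
  qed
  then show ?thesis unfolding f sum_distrib_left by (intro sum.cong) (auto simp: mult_ac)
qed

lemma homog_poly_cnj:
  assumes "f \<in> homog_poly n"
  shows "(\<lambda>z. cnj (f z)) \<in> homog_poly n"
proof -
  from assms obtain c where f: "\<And>z. f z = (\<Sum>a\<le>n. c a * cRe z ^ a * cIm z ^ (n - a))"
    unfolding homog_poly_eq hform_def by blast
  show ?thesis unfolding homog_poly_eq by (rule hformI[where c = "\<lambda>a. cnj (c a)"]) (simp add: f)
qed

lemma homog_poly_refl:
  assumes "f \<in> homog_poly n"
  shows "(\<lambda>z. f (cis \<phi> * cnj z)) \<in> homog_poly n"
proof -
  from assms obtain c where f: "\<And>z. f z = (\<Sum>a\<le>n. c a * z ^ a * cnj z ^ (n - a))"
    unfolding homog_poly_eq' hform_def by blast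
  have "(\<lambda>z. f (cis \<phi> * cnj z)) \<in> hform (\<lambda>z. cis \<phi> * cnj z) (\<lambda>z. cis (- \<phi>) * z) n"
    by (rule hformI[where c = c]) (simp add: f cis_cnj)
  then show ?thesis unfolding homog_poly_eq'
    by (rule hform_basis_change[rotated 2]) (rule hform_lin[where p = 0 and q = "cis \<phi>"], simp,
        rule hform_lin[where p = "cis (- \<phi>)" and q = 0], simp)
qed

text \<open>In the coordinates of the mirror the reflection negates the second one: its even powers
  cancel, its odd powers double and leave a factor to divide out. This is why the difference part of
  a Dunkl operator maps polynomials to polynomials.\<close>

lemma homog_poly_quotient:
  assumes "f \<in> homog_poly n"
  obtains q where "q \<in> homog_poly (n - 1)"
    "\<And>z. f z - f (cis (2 * \<theta>) * cnj z) = rIm \<theta> z * q z"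
proof -
  from assms obtain c where f: "\<And>z. f z = (\<Sum>a\<le>n. c a * rRe \<theta> z ^ a * rIm \<theta> z ^ (n - a))"
    unfolding homog_poly_eq_rot[of n \<theta>] hform_def by blast
  have r: "cis (- \<theta>) * (cis (2 * \<theta>) * cnj z) = cnj (cis (- \<theta>) * z)" for z
    by (simp add: mult.assoc[symmetric] cis_mult cis_cnj)
  define q where "q = (\<lambda>z. \<Sum>a\<le>n. if odd (n - a) then 2 * c a * (rRe \<theta> z ^ a * rIm \<theta> z ^ (n - 1 - a)) else 0)"
  have "q \<in> homog_poly (n - 1)"
    unfolding homog_poly_eq_rot[of "n - 1" \<theta>] q_def
  proof (intro hform_sum)
    fix a assume "a \<in> {..n}"
    show "(\<lambda>z. if odd (n - a) then 2 * c a * (rRe \<theta> z ^ a * rIm \<theta> z ^ (n - 1 - a)) else 0) \<in> hform (rRe \<theta>) (rIm \<theta>) (n - 1)"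
    proof (cases "odd (n - a)")
      case True
      then have "a + (n - 1 - a) = n - 1" by (cases "a = n") (use \<open>a \<in> {..n}\<close> in auto)
      then show ?thesis using True by (auto intro!: hform_cmult hform_monom)
    qed (simp add: hform_zero)
  qed
  moreover have "f z - f (cis (2 * \<theta>) * cnj z) = rIm \<theta> z * q z" for z
    unfolding f q_def sum_distrib_left sum_subtractf[symmetric] r
  proof (intro sum.cong refl)
    fix a assume "a \<in> {..n}"
    show "c a * rRe \<theta> z ^ a * rIm \<theta> z ^ (n - a) - c a * complex_of_real (Re (cnj (cis (- \<theta>) * z))) ^ a * complex_of_real (Im (cnj (cis (- \<theta>) * z))) ^ (n - a) =
       rIm \<theta> z * (if odd (n - a) then 2 * c a * (rRe \<theta> z ^ a * rIm \<theta> z ^ (n - 1 - a)) else 0)"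
    proof (cases "odd (n - a)")
      case True
      then have "n - a = Suc (n - 1 - a)" by (cases "a = n") (use \<open>a \<in> {..n}\<close> in auto)
      then have p: "rIm \<theta> z ^ (n - a) = rIm \<theta> z * rIm \<theta> z ^ (n - 1 - a)" by simp
      have "complex_of_real (Im (cnj (cis (- \<theta>) * z))) = - rIm \<theta> z" by simp
      then have "complex_of_real (Im (cnj (cis (- \<theta>) * z))) ^ (n - a) = - (rIm \<theta> z ^ (n - a))"
        by (simp only: power_minus_odd[OF True])
      moreover have "complex_of_real (Re (cnj (cis (- \<theta>) * z))) = rRe \<theta> z" by simp
      moreover have "k * A * (I * J) - k * A * - (I * J) = I * (2 * k * (A * J))" for k A I J :: complex
        by (simp add: algebra_simps)
      ultimately show ?thesis using True by (simp only: p if_True not_False_eq_True)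
    next
      case False
      have "complex_of_real (Im (cnj (cis (- \<theta>) * z))) = - rIm \<theta> z" by simp
      then have "complex_of_real (Im (cnj (cis (- \<theta>) * z))) ^ (n - a) = (rIm \<theta> z ^ (n - a))"
      proof -
        have "even (n - a)" using False by blast
        then show ?thesis using \<open>complex_of_real (Im (cnj (cis (- \<theta>) * z))) = - rIm \<theta> z\<close> by (simp only: power_minus_even)
      qed
      then show ?thesis using False by simp
    qed
  qed
  ultimately show thesis using that by blast
qed

section \<open>Mirrors and locality of the Dunkl operators\<close>

lemma inner2_dih_root: "inner2 (dih_root N j) x = Im (cis (- dih_theta N j) * x)"
  by (simp add: inner2_def dih_root_def)

lemma cis_minus_add_pi_mult: "cis (- (t + pi * real q)) = (-1) ^ q * cis (- t)"
proof (induction q)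
  case (Suc q)
  have "cis (- (t + pi * real (Suc q))) = cis (- (t + pi * real q)) * cis (- pi)"
    unfolding cis_mult by (simp add: algebra_simps)
  moreover have "cis (- pi) = - 1" by (simp add: complex_eq_iff)
  ultimately show ?case unfolding Suc by simp
qed simp

text \<open>Reflection j carries the mirror i to the mirror 2j - i, taken modulo N.\<close>

lemma off_mirrors_refl:
  assumes x: "x \<in> off_mirrors N" and j: "j < N"
  shows "dih_refl N j x \<in> off_mirrors N"
  unfolding off_mirrors_def
proof (intro CollectI allI impI)
  fix i assume i: "i < N"
  let ?\<theta> = "dih_theta N"
  \<comment> \<open>The summand N keeps the index natural. Reducing it modulo N moves the angle by a
    multiple of pi, which changes at most the sign of the root.\<close>
  define m where "m = 2 * j + N - i"
  have N: "real N > 0" using j by simp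
  have mN: "real m = 2 * real j + real N - real i" using i by (simp add: m_def)
  have "?\<theta> m = 2 * ?\<theta> j + pi - ?\<theta> i" using N by (simp add: dih_theta_def mN field_simps)
  then have e: "?\<theta> i - 2 * ?\<theta> j = pi - ?\<theta> m" by simp
  have "real m = real (m mod N) + real N * real (m div N)"
    by (metis of_nat_add of_nat_mult mod_mult_div_eq)
  then have m': "?\<theta> m = ?\<theta> (m mod N) + pi * real (m div N)" using N by (simp add: dih_theta_def field_simps)
  have "inner2 (dih_root N i) (dih_refl N j x) = - Im (cis (?\<theta> i - 2 * ?\<theta> j) * x)"
  proof -
    have "cis (- ?\<theta> i) * (cis (2 * ?\<theta> j) * cnj x) = cnj (cis (?\<theta> i - 2 * ?\<theta> j) * x)"
      by (simp add: mult.assoc[symmetric] cis_mult cis_cnj)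
    then show ?thesis by (simp only: inner2_dih_root dih_refl_def cnj.simps)
  qed
  also have "cis (?\<theta> i - 2 * ?\<theta> j) = - ((-1) ^ (m div N) * cis (- ?\<theta> (m mod N)))"
  proof -
    have "cis (pi - ?\<theta> m) = cis pi * cis (- ?\<theta> m)" by (simp only: cis_mult) simp
    then show ?thesis unfolding e cis_minus_add_pi_mult[symmetric] m'[symmetric] by simp
  qed
  finally have "\<bar>inner2 (dih_root N i) (dih_refl N j x)\<bar> = \<bar>inner2 (dih_root N (m mod N)) x\<bar>"
    by (cases "even (m div N)") (simp_all add: inner2_dih_root)
  moreover have "inner2 (dih_root N (m mod N)) x \<noteq> 0"
    using x j unfolding off_mirrors_def by simp
  ultimately show "inner2 (dih_root N i) (dih_refl N j x) \<noteq> 0" by auto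
qed

lemma open_off_mirrors: "open (off_mirrors N)"
proof -
  have "off_mirrors N = (\<Inter>j\<in>{..<N}. {x. inner2 (dih_root N j) x \<noteq> 0})"
    by (auto simp: off_mirrors_def)
  moreover have "open {x. inner2 c x \<noteq> 0}" for c
    unfolding inner2_def by (intro open_Collect_neq continuous_intros)
  ultimately show ?thesis by auto
qed

text \<open>The operator sees f only near x and at the reflected points, and all of these are off
  the mirrors. This gives access to iterated operators: on the mirrors \<open>dunkl_T\<close> is
  shaped by the value of division by 0 and need not agree with the polynomial that it is
  elsewhere.\<close>

lemma dunkl_T_cong:
  assumes x: "x \<in> off_mirrors N" and eq: "\<And>y. y \<in> off_mirrors N \<Longrightarrow> f y = g y"
  shows "dunkl_T N kap e f x = dunkl_T N kap e g x"
proof -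
  have "((\<lambda>t::real. x + t *\<^sub>R e) \<longlongrightarrow> x + 0 *\<^sub>R e) (nhds 0)"
    by (intro tendsto_intros filterlim_ident)
  then have "\<forall>\<^sub>F t::real in nhds 0. x + t *\<^sub>R e \<in> off_mirrors N"
    using open_off_mirrors x by (auto simp: tendsto_def)
  then have "\<forall>\<^sub>F t::real in nhds 0. f (x + t *\<^sub>R e) = g (x + t *\<^sub>R e)"
    by eventually_elim (rule eq)
  then have "pderiv2 f e x = pderiv2 g e x"
    unfolding pderiv2_def by (intro vector_derivative_cong_eq) (auto elim: eventually_mono)
  then show ?thesis
    unfolding dunkl_T_def using x eq off_mirrors_refl by simp
qed

lemma pderiv2_eq:
  assumes "(f has_derivative D) (at x)"
  shows "pderiv2 f e x = D e"
proof -
  have "((\<lambda>t::real. x + t *\<^sub>R e) has_derivative (\<lambda>t. t *\<^sub>R e)) (at 0)"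
    by (auto intro!: derivative_eq_intros)
  moreover have "(f has_derivative D) (at (x + 0 *\<^sub>R e))" using assms by simp
  ultimately have "((\<lambda>t. f (x + t *\<^sub>R e)) has_derivative (\<lambda>t. D (t *\<^sub>R e))) (at 0)"
    using has_derivative_compose[of "\<lambda>t::real. x + t *\<^sub>R e"] by blast
  moreover have "linear D" using assms by (simp add: has_derivative_linear)
  ultimately have "((\<lambda>t. f (x + t *\<^sub>R e)) has_vector_derivative D e) (at 0)"
    unfolding has_vector_derivative_def by (simp add: linear_cmul)
  then show ?thesis unfolding pderiv2_def by (rule vector_derivative_at)
qed

text \<open>\<open>f1\<close> and \<open>f2\<close> are the partial derivatives, with Euler's
  identity. The clauses for n = 0 are recorded because the truncated degree \<open>n - 1\<close>
  would still permit nonzero constants.\<close>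

lemma homog_poly_deriv:
  assumes "f \<in> homog_poly n"
  obtains f1 f2 where "f1 \<in> homog_poly (n - 1)" "f2 \<in> homog_poly (n - 1)"
    "\<And>x. (f has_derivative (\<lambda>h. of_real (Re h) * f1 x + of_real (Im h) * f2 x)) (at x)"
    "\<And>x. of_real (Re x) * f1 x + of_real (Im x) * f2 x = of_nat n * f x"
    "n = 0 \<Longrightarrow> f1 = (\<lambda>_. 0)" "n = 0 \<Longrightarrow> f2 = (\<lambda>_. 0)"
proof -
  from assms obtain c where f: "\<And>z. f z = (\<Sum>a\<le>n. c a * cRe z ^ a * cIm z ^ (n - a))"
    unfolding homog_poly_eq hform_def by blast
  define f1 where "f1 = (\<lambda>z. \<Sum>a\<le>n. (of_nat a * c a) * (cRe z ^ (a - 1) * cIm z ^ (n - a)))"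
  define f2 where "f2 = (\<lambda>z. \<Sum>a\<le>n. (of_nat (n - a) * c a) * (cRe z ^ a * cIm z ^ (n - a - 1)))"
  show thesis
  proof (rule that[of f1 f2])
    show "f1 \<in> homog_poly (n - 1)"
      unfolding f1_def homog_poly_eq
    proof (intro hform_sum)
      fix a assume a: "a \<in> {..n}"
      show "(\<lambda>z. (of_nat a * c a) * (cRe z ^ (a - 1) * cIm z ^ (n - a))) \<in> hform cRe cIm (n - 1)"
      proof (cases "a = 0")
        case False
        then show ?thesis using a by (intro hform_cmult hform_monom) auto
      qed (simp add: hform_zero)
    qed
    show "f2 \<in> homog_poly (n - 1)"
      unfolding f2_def homog_poly_eq
    proof (intro hform_sum)
      fix a assume a: "a \<in> {..n}"
      show "(\<lambda>z. (of_nat (n - a) * c a) * (cRe z ^ a * cIm z ^ (n - a - 1))) \<in> hform cRe cIm (n - 1)"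
      proof (cases "a = n")
        case False
        then show ?thesis using a by (intro hform_cmult hform_monom) auto
      qed (simp add: hform_zero)
    qed
    show "n = 0 \<Longrightarrow> f1 = (\<lambda>_. 0)" "n = 0 \<Longrightarrow> f2 = (\<lambda>_. 0)" by (auto simp: f1_def f2_def)
    fix x
    have "((\<lambda>z. \<Sum>a\<le>n. c a * cRe z ^ a * cIm z ^ (n - a)) has_derivative
      (\<lambda>h. \<Sum>a\<le>n. c a * cRe x ^ a * (of_nat (n - a) * (of_real (Im h) * cIm x ^ (n - a - 1)))
            + c a * (of_nat a * (of_real (Re h) * cRe x ^ (a - 1))) * cIm x ^ (n - a))) (at x)"
      by (intro has_derivative_sum) (auto intro!: derivative_eq_intros simp: algebra_simps)
    then show "(f has_derivative (\<lambda>h. of_real (Re h) * f1 x + of_real (Im h) * f2 x)) (at x)"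
      unfolding f[abs_def] f1_def f2_def sum_distrib_left sum.distrib[symmetric]
      by (rule has_derivative_eq_rhs) (intro ext sum.cong refl, simp add: algebra_simps)
    show "of_real (Re x) * f1 x + of_real (Im x) * f2 x = of_nat n * f x"
      unfolding f f1_def f2_def sum_distrib_left sum.distrib[symmetric]
    proof (intro sum.cong refl)
      fix a assume a: "a \<in> {..n}"
      have 1: "of_nat a * (cRe x * cRe x ^ (a - 1)) = of_nat a * cRe x ^ a" by (cases a) auto
      have 2: "of_nat (n - a) * (cIm x * cIm x ^ (n - a - 1)) = of_nat (n - a) * cIm x ^ (n - a)" by (cases "n - a") auto
      have "of_real (Re x) * (of_nat a * c a * (cRe x ^ (a - 1) * cIm x ^ (n - a))) + of_real (Im x) * (of_nat (n - a) * c a * (cRe x ^ a * cIm x ^ (n - a - 1)))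
         = c a * cIm x ^ (n - a) * (of_nat a * (cRe x * cRe x ^ (a - 1))) + c a * cRe x ^ a * (of_nat (n - a) * (cIm x * cIm x ^ (n - a - 1)))"
        by (simp only: mult_ac)
      also have "\<dots> = (of_nat a + of_nat (n - a)) * (c a * cRe x ^ a * cIm x ^ (n - a))"
        unfolding 1 2 by (simp add: algebra_simps)
      also have "of_nat a + of_nat (n - a) = (of_nat n :: complex)" using a by (simp flip: of_nat_add)
      finally show "of_real (Re x) * (of_nat a * c a * (cRe x ^ (a - 1) * cIm x ^ (n - a))) + of_real (Im x) * (of_nat (n - a) * c a * (cRe x ^ a * cIm x ^ (n - a - 1)))
         = of_nat n * (c a * cRe x ^ a * cIm x ^ (n - a))" .
    qed
  qed
qed

section \<open>Dunkl operators on polynomials and their product rule\<close>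

text \<open>\<open>g1\<close> and \<open>g2\<close> are the polynomials that T_1 f and T_2 f are off
  the mirrors. The equation for x . T f is Euler's identity for Dunkl operators, with the weighted
  differences f - f o r as correction. The clauses for n = 0 make up for the truncated
  \<open>n - 1\<close>.\<close>

definition dunkl_pair :: "nat \<Rightarrow> (nat \<Rightarrow> real) \<Rightarrow> nat \<Rightarrow> (complex \<Rightarrow> complex) \<Rightarrow> (complex \<Rightarrow> complex) \<Rightarrow> (complex \<Rightarrow> complex) \<Rightarrow> bool" where
  "dunkl_pair N kap n f g1 g2 \<longleftrightarrow> g1 \<in> homog_poly (n - 1) \<and> g2 \<in> homog_poly (n - 1) \<and>
    (\<forall>x \<in> off_mirrors N. dunkl_T N kap 1 f x = g1 x) \<and>
    (\<forall>x \<in> off_mirrors N. dunkl_T N kap \<i> f x = g2 x) \<and>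
    (\<forall>x. of_real (Re x) * g1 x + of_real (Im x) * g2 x
        = of_nat n * f x + (\<Sum>j<N. of_real (kap j) * (f x - f (dih_refl N j x)))) \<and>
    (n = 0 \<longrightarrow> g1 = (\<lambda>_. 0)) \<and> (n = 0 \<longrightarrow> g2 = (\<lambda>_. 0))"

lemma dunkl_pairD:
  assumes "dunkl_pair N kap n f g1 g2"
  shows "g1 \<in> homog_poly (n - 1)" "g2 \<in> homog_poly (n - 1)"
    "\<And>x. x \<in> off_mirrors N \<Longrightarrow> dunkl_T N kap 1 f x = g1 x"
    "\<And>x. x \<in> off_mirrors N \<Longrightarrow> dunkl_T N kap \<i> f x = g2 x"
    "\<And>x. of_real (Re x) * g1 x + of_real (Im x) * g2 x
        = of_nat n * f x + (\<Sum>j<N. of_real (kap j) * (f x - f (dih_refl N j x)))"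
    "n = 0 \<Longrightarrow> g1 = (\<lambda>_. 0)" "n = 0 \<Longrightarrow> g2 = (\<lambda>_. 0)"
  using assms unfolding dunkl_pair_def by blast+

lemma dunkl_T_poly:
  assumes f: "f \<in> homog_poly n"
  shows "\<exists>g1 g2. dunkl_pair N kap n f g1 g2"
proof -
  obtain f1 f2 where F: "f1 \<in> homog_poly (n - 1)" "f2 \<in> homog_poly (n - 1)"
    "\<And>x. (f has_derivative (\<lambda>h. of_real (Re h) * f1 x + of_real (Im h) * f2 x)) (at x)"
    "\<And>x. of_real (Re x) * f1 x + of_real (Im x) * f2 x = of_nat n * f x"
    "n = 0 \<Longrightarrow> f1 = (\<lambda>_. 0)" "n = 0 \<Longrightarrow> f2 = (\<lambda>_. 0)"
    using homog_poly_deriv[OF f] by blast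
  have "\<exists>q. q \<in> homog_poly (n - 1) \<and> (\<forall>z. f z - f (dih_refl N j z) = of_real (inner2 (dih_root N j) z) * q z) \<and> (n = 0 \<longrightarrow> q = (\<lambda>_. 0))" for j
  proof (cases "n = 0")
    case True
    then have "f z = f w" for z w using f by (auto simp: homog_poly_def)
    with True show ?thesis by (intro exI[of _ "\<lambda>_. 0"]) (auto simp: homog_poly_eq hform_zero)
  next
    case False
    then show ?thesis using homog_poly_quotient[OF f, of "dih_theta N j"]
      unfolding dih_refl_def inner2_dih_root by metis
  qed
  then obtain q where q: "\<And>j. q j \<in> homog_poly (n - 1)"
    "\<And>j z. f z - f (dih_refl N j z) = of_real (inner2 (dih_root N j) z) * q j z" "\<And>j. n = 0 \<Longrightarrow> q j = (\<lambda>_. 0)"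
    by metis
  define g where "g = (\<lambda>e x. (of_real (Re e) * f1 x + of_real (Im e) * f2 x) + (\<Sum>j<N. of_real (kap j * inner2 (dih_root N j) e) * q j x))"
  have g: "g e \<in> homog_poly (n - 1)" for e
    unfolding g_def using F q unfolding homog_poly_eq by (intro hform_add hform_sum hform_cmult) auto
  have T: "dunkl_T N kap e f x = g e x" if "x \<in> off_mirrors N" for e x
  proof -
    have "of_real (kap j * inner2 (dih_root N j) e) * (f x - f (dih_refl N j x)) / of_real (inner2 (dih_root N j) x)
        = of_real (kap j * inner2 (dih_root N j) e) * q j x" if "j < N" for j
      unfolding q(2) using \<open>x \<in> off_mirrors N\<close> that by (simp add: off_mirrors_def)
    then show ?thesis unfolding dunkl_T_def pderiv2_eq[OF F(3)] g_def by simp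
  qed
  \<comment> \<open>The components of the root, weighted by those of x, add up to its inner product
    with x, which is the divisor of the difference quotient.\<close>
  have E: "of_real (Re x) * g 1 x + of_real (Im x) * g \<i> x
        = of_nat n * f x + (\<Sum>j<N. of_real (kap j) * (f x - f (dih_refl N j x)))" for x
  proof -
    have "of_real (Re x) * g 1 x + of_real (Im x) * g \<i> x
      = (of_real (Re x) * f1 x + of_real (Im x) * f2 x) + (\<Sum>j<N. of_real (kap j) * (of_real (Re x * inner2 (dih_root N j) 1 + Im x * inner2 (dih_root N j) \<i>) * q j x))"
      unfolding g_def by (simp add: algebra_simps sum_distrib_left sum.distrib)
    also have "\<dots> = of_nat n * f x + (\<Sum>j<N. of_real (kap j) * (f x - f (dih_refl N j x)))"
      unfolding F(4) q(2) by (simp add: inner2_def algebra_simps)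
    finally show ?thesis .
  qed
  have z: "g e = (\<lambda>_. 0)" if "n = 0" for e
    unfolding g_def F(5)[OF that] F(6)[OF that] q(3)[OF that] by simp
  have "dunkl_pair N kap n f (g 1) (g \<i>)"
    unfolding dunkl_pair_def using g T E z by (intro conjI ballI allI impI)
  then show ?thesis by blast
qed

lemma dunkl_T_add:
  assumes "f differentiable at x" "g differentiable at x"
  shows "dunkl_T N kap e (\<lambda>z. f z + g z) x = dunkl_T N kap e f x + dunkl_T N kap e g x"
proof -
  from assms obtain D D' where D: "(f has_derivative D) (at x)" "(g has_derivative D') (at x)"
    unfolding differentiable_def by blast
  show ?thesis
    unfolding dunkl_T_def pderiv2_eq[OF D(1)] pderiv2_eq[OF D(2)] pderiv2_eq[OF has_derivative_add[OF D]]
    by (simp add: algebra_simps add_divide_distrib diff_divide_distrib sum.distrib sum_subtractf)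
qed

lemma dunkl_T_cmult:
  assumes "f differentiable at x"
  shows "dunkl_T N kap e (\<lambda>z. c * f z) x = c * dunkl_T N kap e f x"
proof -
  from assms obtain D where D: "(f has_derivative D) (at x)"
    unfolding differentiable_def by blast
  show ?thesis
    unfolding dunkl_T_def pderiv2_eq[OF D] pderiv2_eq[OF has_derivative_mult_right[OF D]]
    by (simp add: distrib_left sum_distrib_left right_diff_distrib) (simp add: algebra_simps)
qed

text \<open>For a unit root a, reflection changes <c, x> by -2 <a, x> <c, a>. The defect of
  Leibniz's rule for a linear factor is therefore free of denominators and becomes a sum of
  reflected values of g.\<close>

lemma dunkl_T_linear_mult:
  assumes g: "g differentiable at x" and x: "x \<in> off_mirrors N"
  shows "dunkl_T N kap e (\<lambda>z. of_real (inner2 c z) * g z) x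
     = of_real (inner2 c x) * dunkl_T N kap e g x + of_real (inner2 c e) * g x
      + 2 * (\<Sum>j<N. of_real (kap j * inner2 (dih_root N j) e * inner2 c (dih_root N j)) * g (dih_refl N j x))"
proof -
  from g obtain D where D: "(g has_derivative D) (at x)"
    unfolding differentiable_def by blast
  have d: "((\<lambda>z. complex_of_real (inner2 c z)) has_derivative (\<lambda>h. of_real (inner2 c h))) (at x)"
    unfolding inner2_def by (auto intro!: derivative_eq_intros)
  have "of_real (kap j * inner2 (dih_root N j) e) * (of_real (inner2 c x) * g x - of_real (inner2 c (dih_refl N j x)) * g (dih_refl N j x)) / of_real (inner2 (dih_root N j) x)
     = of_real (inner2 c x) * (of_real (kap j * inner2 (dih_root N j) e) * (g x - g (dih_refl N j x)) / of_real (inner2 (dih_root N j) x))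
     + 2 * (of_real (kap j * inner2 (dih_root N j) e * inner2 c (dih_root N j)) * g (dih_refl N j x))" if j: "j < N" for j
  proof -
    let ?\<alpha> = "dih_root N j" and ?t = "dih_theta N j"
    have nz: "inner2 ?\<alpha> x \<noteq> 0" using x j by (simp add: off_mirrors_def)
    have "dih_refl N j x = x - of_real (2 * inner2 ?\<alpha> x) * ?\<alpha>"
    proof -
      have "cis (2 * ?t) = cis ?t * cis ?t" by (simp add: cis_mult)
      moreover have "(sin ?t)\<^sup>2 + (cos ?t)\<^sup>2 = 1" by simp
      then have "(cos ?t * cos ?t - sin ?t * sin ?t) * Re x + (cos ?t * sin ?t + sin ?t * cos ?t) * Im x = Re x - 2 * (- sin ?t * Re x + cos ?t * Im x) * (- sin ?t)"
        "(cos ?t * sin ?t + sin ?t * cos ?t) * Re x - (cos ?t * cos ?t - sin ?t * sin ?t) * Im x = Im x - 2 * (- sin ?t * Re x + cos ?t * Im x) * cos ?t"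
        by algebra+
      ultimately show ?thesis
        unfolding dih_refl_def dih_root_def inner2_def by (simp add: complex_eq_iff)
    qed
    then have "Re (dih_refl N j x) = Re x - 2 * inner2 ?\<alpha> x * Re ?\<alpha>" "Im (dih_refl N j x) = Im x - 2 * inner2 ?\<alpha> x * Im ?\<alpha>"
      by simp_all
    then have eq: "inner2 c (dih_refl N j x) = inner2 c x - 2 * inner2 ?\<alpha> x * inner2 c ?\<alpha>"
      unfolding inner2_def[of c] by algebra
    show ?thesis unfolding eq using nz by (simp add: field_simps)
  qed
  then show ?thesis
    unfolding dunkl_T_def pderiv2_eq[OF D] pderiv2_eq[OF has_derivative_mult[OF d D]]
    by (simp add: sum.distrib sum_distrib_left algebra_simps)
qed

lemma homog_poly_differentiable:
  assumes "f \<in> homog_poly n"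
  shows "f differentiable at x"
  using homog_poly_deriv[OF assms] unfolding differentiable_def by metis

lemma Re_homog: "(\<lambda>z. complex_of_real (Re z)) \<in> homog_poly 1"
  unfolding homog_poly_eq by (rule hform_lin[where p = 1 and q = 0]) simp

lemma Im_homog: "(\<lambda>z. complex_of_real (Im z)) \<in> homog_poly 1"
  unfolding homog_poly_eq by (rule hform_lin[where p = 0 and q = 1]) simp

lemma homog_poly_mult: "f \<in> homog_poly m \<Longrightarrow> g \<in> homog_poly n \<Longrightarrow> (\<lambda>z. f z * g z) \<in> homog_poly (m + n)"
  unfolding homog_poly_eq by (rule hform_mult)

lemma homog_poly_add: "f \<in> homog_poly n \<Longrightarrow> g \<in> homog_poly n \<Longrightarrow> (\<lambda>z. f z + g z) \<in> homog_poly n"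
  unfolding homog_poly_eq by (rule hform_add)

lemma homog_poly_diff: "f \<in> homog_poly n \<Longrightarrow> g \<in> homog_poly n \<Longrightarrow> (\<lambda>z. f z - g z) \<in> homog_poly n"
  unfolding homog_poly_eq by (rule hform_diff)

lemma homog_poly_cmult: "f \<in> homog_poly n \<Longrightarrow> (\<lambda>z. k * f z) \<in> homog_poly n"
  unfolding homog_poly_eq by (rule hform_cmult)

lemma homog_poly_sum: "(\<And>i. i \<in> A \<Longrightarrow> f i \<in> homog_poly n) \<Longrightarrow> (\<lambda>z. \<Sum>i\<in>A. f i z) \<in> homog_poly n"
  unfolding homog_poly_eq by (rule hform_sum)

section \<open>The polar form of the Dunkl Laplacian\<close>

definition refl_sum :: "nat \<Rightarrow> (nat \<Rightarrow> real) \<Rightarrow> (complex \<Rightarrow> complex) \<Rightarrow> complex \<Rightarrow> complex" where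
  "refl_sum N kap f x = (\<Sum>j<N. of_real (kap j) * f (dih_refl N j x))"

definition dunkl_ang :: "nat \<Rightarrow> (nat \<Rightarrow> real) \<Rightarrow> (complex \<Rightarrow> complex) \<Rightarrow> complex \<Rightarrow> complex" where
  "dunkl_ang N kap f x = of_real (Re x) * dunkl_T N kap \<i> f x - of_real (Im x) * dunkl_T N kap 1 f x"

lemma homog_poly_refl_sum:
  assumes "f \<in> homog_poly n"
  shows "refl_sum N kap f \<in> homog_poly n"
proof -
  define F where "F = (\<lambda>j x. of_real (kap j) * f (dih_refl N j x))"
  have "F j \<in> homog_poly n" for j
    using homog_poly_cmult[OF homog_poly_refl[OF assms, of "2 * dih_theta N j"], of "of_real (kap j)"]
    unfolding dih_refl_def F_def .
  then have "(\<lambda>x. \<Sum>j<N. F j x) \<in> homog_poly n" by (intro homog_poly_sum)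
  moreover have "refl_sum N kap f = (\<lambda>x. \<Sum>j<N. F j x)"
    unfolding F_def by (rule ext) (simp only: refl_sum_def)
  ultimately show ?thesis by (simp only:)
qed

lemma dunkl_ang_poly:
  assumes f: "f \<in> homog_poly n"
  obtains B where "B \<in> homog_poly n" "\<And>x. x \<in> off_mirrors N \<Longrightarrow> dunkl_ang N kap f x = B x"
proof -
  obtain g1 g2 where "dunkl_pair N kap n f g1 g2" using dunkl_T_poly[OF f] by blast
  note g = dunkl_pairD[OF this]
  show thesis
  proof (rule that)
    show "dunkl_ang N kap f x = of_real (Re x) * g2 x - of_real (Im x) * g1 x" if "x \<in> off_mirrors N" for x
      using g that by (simp add: dunkl_ang_def)
    show "(\<lambda>x. of_real (Re x) * g2 x - of_real (Im x) * g1 x) \<in> homog_poly n"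
    proof (cases n)
      case 0
      then show ?thesis using g by (simp add: homog_poly_eq hform_zero)
    next
      case (Suc m)
      then show ?thesis
        using homog_poly_diff[OF homog_poly_mult[OF Re_homog g(2)] homog_poly_mult[OF Im_homog g(1)]] by simp
    qed
  qed
qed

text \<open>The clause for n < 2 makes up for the truncated degree n - 2 and ends the recursions
  over degrees.\<close>

lemma dunkl_Lap_poly:
  assumes f: "f \<in> homog_poly n"
  obtains d where "d \<in> homog_poly (n - 2)" "\<And>x. x \<in> off_mirrors N \<Longrightarrow> dunkl_Lap N kap f x = d x"
    "n < 2 \<Longrightarrow> d = (\<lambda>_. 0)"
proof -
  obtain g1 g2 where "dunkl_pair N kap n f g1 g2" using dunkl_T_poly[OF f] by blast
  note g = dunkl_pairD[OF this]
  obtain h1 h1' where "dunkl_pair N kap (n - 1) g1 h1 h1'" using dunkl_T_poly[OF g(1)] by blast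
  note h1 = dunkl_pairD[OF this]
  obtain h2' h2 where "dunkl_pair N kap (n - 1) g2 h2' h2" using dunkl_T_poly[OF g(2)] by blast
  note h2 = dunkl_pairD[OF this]
  show thesis
  proof (rule that[of "\<lambda>x. h1 x + h2 x"])
    show "(\<lambda>x. h1 x + h2 x) \<in> homog_poly (n - 2)"
      using homog_poly_add[OF h1(1) h2(2)] by (simp add: numeral_2_eq_2)
    show "dunkl_Lap N kap f x = h1 x + h2 x" if x: "x \<in> off_mirrors N" for x
    proof -
      have "dunkl_T N kap 1 (dunkl_T N kap 1 f) x = h1 x" using dunkl_T_cong[OF x g(3)] h1(3)[OF x] by simp
      moreover have "dunkl_T N kap \<i> (dunkl_T N kap \<i> f) x = h2 x" using dunkl_T_cong[OF x g(4)] h2(4)[OF x] by simp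
      ultimately show ?thesis unfolding dunkl_Lap_def by simp
    qed
    show "n < 2 \<Longrightarrow> (\<lambda>x. h1 x + h2 x) = (\<lambda>_. 0)" using h1(6) h2(7) by auto
  qed
qed

lemma dih_refl_components:
  fixes N j x
  defines "p \<equiv> Re (dih_root N j)" and "q \<equiv> Im (dih_root N j)"
  shows "Re (dih_refl N j x) = Re x * (q * q - p * p) - 2 * (p * q) * Im x"
    "Im (dih_refl N j x) = Im x * (p * p - q * q) - 2 * (p * q) * Re x"
proof -
  have "cis (2 * dih_theta N j) = cis (dih_theta N j) * cis (dih_theta N j)" by (simp add: cis_mult)
  then show "Re (dih_refl N j x) = Re x * (q * q - p * p) - 2 * (p * q) * Im x"
    "Im (dih_refl N j x) = Im x * (p * p - q * q) - 2 * (p * q) * Re x"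
    unfolding p_def q_def dih_refl_def dih_root_def by (simp_all add: algebra_simps)
qed

lemma sum_kap_diff:
  "(\<Sum>j<N. of_real (kap j) * (f x - f (dih_refl N j x))) = of_real (\<Sum>j<N. kap j) * f x - refl_sum N kap f x"
  by (simp add: refl_sum_def right_diff_distrib sum_subtractf sum_distrib_right)

text \<open>The analogue of |x|^2 \<Delta> = \<partial>_\<theta>^2 + n^2 on degree n. Put E = x . T,
  so that E f = (n + K) f - S f. By the product rule, A A f + E E f equals |x|^2 \<Delta> f up to
  reflection terms, and these add up to -2 S E f. Since E E f = (n + K) E f - S E f, the sum E E f +
  2 S E f is (n + K)^2 f - S S f.\<close>

theorem dunkl_Lap_identity:
  fixes kap :: "nat \<Rightarrow> real"
  assumes f: "f \<in> homog_poly n" and x: "x \<in> off_mirrors N"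
  defines "K \<equiv> \<Sum>j<N. kap j"
  shows "of_real ((cmod x)\<^sup>2) * dunkl_Lap N kap f x
     = dunkl_ang N kap (dunkl_ang N kap f) x + (of_nat n + of_real K)\<^sup>2 * f x - refl_sum N kap (refl_sum N kap f) x"
proof -
  obtain g1 g2 where "dunkl_pair N kap n f g1 g2" using dunkl_T_poly[OF f] by blast
  note g = dunkl_pairD[OF this]
  let ?T = "dunkl_T N kap"
  define G where "G = (\<lambda>z. of_real (inner2 1 z) * g1 z + of_real (inner2 \<i> z) * g2 z)"
  define B where "B = (\<lambda>z. of_real (inner2 1 z) * g2 z + (- 1) * (of_real (inner2 \<i> z) * g1 z))"
  have Geq: "G z = (of_nat n + of_real K) * f z - refl_sum N kap f z" for z
    using g(5)[of z] unfolding sum_kap_diff by (simp add: G_def inner2_def K_def algebra_simps)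
  have "G \<in> homog_poly n"
  proof -
    have "G = (\<lambda>z. (of_nat n + of_real K) * f z - refl_sum N kap f z)" using Geq by auto
    then show ?thesis by (simp only: homog_poly_diff homog_poly_cmult homog_poly_refl_sum f)
  qed
  then obtain G1 G2 where "dunkl_pair N kap n G G1 G2" using dunkl_T_poly by blast
  note G12 = dunkl_pairD[OF this]
  have EG: "of_real (Re x) * ?T 1 G x + of_real (Im x) * ?T \<i> G x = (of_nat n + of_real K) * G x - refl_sum N kap G x"
    unfolding G12(3)[OF x] G12(4)[OF x] G12(5) sum_kap_diff by (simp add: K_def algebra_simps)
  have d: "g1 differentiable at x" "g2 differentiable at x"
    using g homog_poly_differentiable by blast+
  have dl: "(\<lambda>z. complex_of_real (inner2 c z)) differentiable at x" for c
    unfolding inner2_def differentiable_def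
    by (rule exI, (rule derivative_eq_intros refl | simp)+)
  have dm: "(\<lambda>z. complex_of_real (inner2 c z) * g1 z) differentiable at x" "(\<lambda>z. complex_of_real (inner2 c z) * g2 z) differentiable at x" for c
    using differentiable_mult[OF dl d(1)] differentiable_mult[OF dl d(2)] by auto
  have dmm: "(\<lambda>z. (- 1) * (complex_of_real (inner2 c z) * g1 z)) differentiable at x" for c
    using differentiable_mult[OF differentiable_const dm(1)] .
  define s where "s = (\<lambda>e c g. \<Sum>j<N. complex_of_real (kap j * inner2 (dih_root N j) e * inner2 c (dih_root N j)) * g (dih_refl N j x))"
  have s_eq: "s e c g = (\<Sum>j<N. complex_of_real (kap j * inner2 (dih_root N j) e * inner2 c (dih_root N j)) * g (dih_refl N j x))" for e c g
    by (simp only: s_def)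
  note TM = dunkl_T_linear_mult[OF _ x, of _ kap, folded s_eq]
  \<comment> \<open>The reflection terms of the product rule for g1 (P) and g2 (Q), one for each
    pair of directions; they are symmetric in the two directions.\<close>
  define P11 P12 P22 Q11 Q12 Q22 where "P11 = s 1 1 g1" and "P12 = s 1 \<i> g1" and "P22 = s \<i> \<i> g1"
    and "Q11 = s 1 1 g2" and "Q12 = s 1 \<i> g2" and "Q22 = s \<i> \<i> g2"
  note PQ = P11_def P12_def P22_def Q11_def Q12_def Q22_def
  have sym: "s \<i> 1 g = s 1 \<i> g" for g by (simp add: s_def inner2_def mult_ac)
  define x1 x2 where "x1 = complex_of_real (Re x)" and "x2 = complex_of_real (Im x)"
  define a11 a12 a21 a22 where "a11 = ?T 1 g1 x" and "a12 = ?T 1 g2 x" and "a21 = ?T \<i> g1 x" and "a22 = ?T \<i> g2 x"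
  note aa = a11_def a12_def a21_def a22_def
  have i: "inner2 1 z = Re z" "inner2 \<i> z = Im z" for z by (simp_all add: inner2_def)
  have T1G: "?T 1 G x = x1 * a11 + g1 x + 2 * P11 + (x2 * a12 + 2 * Q12)"
    unfolding G_def dunkl_T_add[OF dm] TM[OF d(1)] TM[OF d(2)] by (simp add: i PQ x1_def x2_def aa)
  have T2G: "?T \<i> G x = x1 * a21 + 2 * P12 + (x2 * a22 + g2 x + 2 * Q22)"
    unfolding G_def dunkl_T_add[OF dm] TM[OF d(1)] TM[OF d(2)] by (simp add: i PQ x1_def x2_def aa sym)
  have T1B: "?T 1 B x = x1 * a12 + g2 x + 2 * Q11 - (x2 * a11 + 2 * P12)"
    unfolding B_def dunkl_T_add[OF dm(2) dmm] dunkl_T_cmult[OF dm(1)] TM[OF d(1)] TM[OF d(2)] by (simp add: i PQ x1_def x2_def aa)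
  have T2B: "?T \<i> B x = x1 * a22 + 2 * Q12 - (x2 * a21 + g1 x + 2 * P22)"
    unfolding B_def dunkl_T_add[OF dm(2) dmm] dunkl_T_cmult[OF dm(1)] TM[OF d(1)] TM[OF d(2)] by (simp add: i PQ x1_def x2_def aa sym)
  \<comment> \<open>The same six sums express S G: G is linear in the coordinates of the reflected
    point, and these are quadratic in the components of the root.\<close>
  have SG: "refl_sum N kap G x = x1 * (P22 - P11) - 2 * x2 * P12 + (x2 * (Q11 - Q22) - 2 * x1 * Q12)"
    unfolding refl_sum_def G_def i dih_refl_components PQ s_def x1_def x2_def
    by (simp add: inner2_def sum_distrib_left sum_subtractf[symmetric] sum.distrib[symmetric] algebra_simps)
  have SS: "refl_sum N kap G x = (of_nat n + of_real K) * refl_sum N kap f x - refl_sum N kap (refl_sum N kap f) x"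
    unfolding refl_sum_def[of N kap G] Geq by (simp add: refl_sum_def[of N kap f x] refl_sum_def[of N kap "refl_sum N kap f"] algebra_simps sum_subtractf sum_distrib_left)
  have Lap: "dunkl_Lap N kap f x = a11 + a22"
  proof -
    have "?T 1 (?T 1 f) x = a11" unfolding aa by (rule dunkl_T_cong[OF x g(3)])
    moreover have "?T \<i> (?T \<i> f) x = a22" unfolding aa by (rule dunkl_T_cong[OF x g(4)])
    ultimately show ?thesis unfolding dunkl_Lap_def by simp
  qed
  have AA: "dunkl_ang N kap (dunkl_ang N kap f) x = x1 * ?T \<i> B x - x2 * ?T 1 B x"
  proof -
    have "dunkl_ang N kap f y = B y" if "y \<in> off_mirrors N" for y
      using that g(3,4) by (simp add: dunkl_ang_def B_def i)
    then have "?T e (dunkl_ang N kap f) x = ?T e B x" for e by (rule dunkl_T_cong[OF x])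
    then show ?thesis by (simp add: dunkl_ang_def[of _ _ "dunkl_ang N kap f"] x1_def x2_def)
  qed
  have xx: "complex_of_real ((cmod x)\<^sup>2) = x1 * x1 + x2 * x2"
  proof -
    have "(cmod x)\<^sup>2 = Re x * Re x + Im x * Im x" using cmod_power2[of x] by (simp only: power2_eq_square)
    then show ?thesis by (simp only: x1_def x2_def of_real_add of_real_mult)
  qed
  let ?n = "of_nat n + complex_of_real K"
  have G': "G x = ?n * f x - refl_sum N kap f x" by (rule Geq)
  have EG': "x1 * (x1 * a11 + g1 x + 2 * P11 + (x2 * a12 + 2 * Q12)) + x2 * (x1 * a21 + 2 * P12 + (x2 * a22 + g2 x + 2 * Q22))
     = ?n * G x - refl_sum N kap G x"
    using EG unfolding T1G T2G x1_def[symmetric] x2_def[symmetric] .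
  have "(x1 * x1 + x2 * x2) * (a11 + a22) = x1 * (x1 * a22 + 2 * Q12 - (x2 * a21 + g1 x + 2 * P22)) - x2 * (x1 * a12 + g2 x + 2 * Q11 - (x2 * a11 + 2 * P12))
     + (x1 * (x1 * a11 + g1 x + 2 * P11 + (x2 * a12 + 2 * Q12)) + x2 * (x1 * a21 + 2 * P12 + (x2 * a22 + g2 x + 2 * Q22)))
     + 2 * (x1 * (P22 - P11) - 2 * x2 * P12 + (x2 * (Q11 - Q22) - 2 * x1 * Q12))"
    by (simp add: algebra_simps)
  also have "\<dots> = x1 * (x1 * a22 + 2 * Q12 - (x2 * a21 + g1 x + 2 * P22)) - x2 * (x1 * a12 + g2 x + 2 * Q11 - (x2 * a11 + 2 * P12))
     + (?n * G x + refl_sum N kap G x)"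
    unfolding EG' SG[symmetric] by simp
  also have "?n * G x + refl_sum N kap G x = ?n\<^sup>2 * f x - refl_sum N kap (refl_sum N kap f) x"
    unfolding SS G' by (simp add: power2_eq_square algebra_simps)
  finally show ?thesis
    unfolding xx Lap AA T1B T2B by simp
qed

section \<open>Integration over the circle\<close>

text \<open>The shift is reduced to one in [0, p]; then the two pieces into which it cuts the
  interval change places.\<close>

lemma has_integral_periodic_shift:
  fixes f :: "real \<Rightarrow> 'a::banach"
  assumes p: "p > 0" and f: "(f has_integral I) {0..p}" and per: "\<And>x. f (x + p) = f x"
  shows "((\<lambda>x. f (x + c)) has_integral I) {0..p}"
proof -
  have pern: "f (x + real n * p) = f x" for x n
  proof (induction n)
    case (Suc n)
    have "f (x + real (Suc n) * p) = f ((x + real n * p) + p)" by (simp add: algebra_simps)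
    then show ?case using per Suc by simp
  qed simp
  have peri: "f (x + of_int k * p) = f x" for x k
  proof (cases "k \<ge> 0")
    case True
    then show ?thesis using pern[of x "nat k"] by simp
  next
    case False
    then show ?thesis using pern[of "x + of_int k * p" "nat (- k)"] by simp
  qed
  define c' where "c' = c - of_int \<lfloor>c / p\<rfloor> * p"
  have c': "0 \<le> c'" "c' \<le> p"
  proof -
    have "of_int \<lfloor>c / p\<rfloor> * p \<le> c" using p floor_divide_lower[OF p, of c] by simp
    then show "0 \<le> c'" by (simp add: c'_def)
    have "c < (of_int \<lfloor>c / p\<rfloor> + 1) * p" using floor_divide_upper[OF p, of c] .
    then show "c' \<le> p" by (simp add: c'_def algebra_simps)
  qed
  have eq: "f (x + c) = f (x + c')" for x
    using peri[of "x + c'" "\<lfloor>c / p\<rfloor>"] by (simp add: c'_def add.assoc)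
  have i: "f integrable_on {0..p}" using f by blast
  obtain I1 I2 where I1: "(f has_integral I1) {0..c'}" and I2: "(f has_integral I2) {c'..p}"
    using integrable_subinterval_real[OF i] c' by (metis atLeastatMost_subset_iff integrable_on_def order_refl)
  have I: "I = I1 + I2"
    using has_integral_unique[OF f has_integral_combine[OF c' I1 I2]] .
  have 2: "((\<lambda>x. f (x + c')) has_integral I2) {0..p - c'}"
    using has_integral_shift_real_ivl[OF I2, of c'] by simp
  have "((\<lambda>x. f (x + (c' - p))) has_integral I1) {p - c'..p}"
    using has_integral_shift_real_ivl[OF I1, of "c' - p"] by simp
  moreover have "f (x + (c' - p)) = f (x + c')" for x
    using per[of "x + (c' - p)"] by (simp add: algebra_simps)
  ultimately have 1: "((\<lambda>x. f (x + c')) has_integral I1) {p - c'..p}" by simp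
  have "((\<lambda>x. f (x + c')) has_integral (I2 + I1)) {0..p}"
    using has_integral_combine[OF _ _ 2 1] c' by simp
  then show ?thesis unfolding eq I by (simp add: add.commute)
qed

lemma has_integral_periodic_reflect:
  fixes f :: "real \<Rightarrow> 'a::banach"
  assumes p: "p > 0" and f: "(f has_integral I) {0..p}" and per: "\<And>x. f (x + p) = f x"
  shows "((\<lambda>x. f (c - x)) has_integral I) {0..p}"
proof -
  let ?g = "\<lambda>x. f (- x)"
  have gp: "?g (x + p) = ?g x" for x using per[of "- (x + p)"] by simp
  have "(?g has_integral I) {-p..0}" using f has_integral_reflect_real[of f I p 0] by simp
  from has_integral_shift_real_ivl[OF this, of "- p"]
  have "((\<lambda>x. ?g (x - p)) has_integral I) {0..p}" by simp
  moreover have "?g (x - p) = ?g x" for x using gp[of "x - p"] by simp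
  ultimately have "(?g has_integral I) {0..p}" by simp
  from has_integral_periodic_shift[OF p this gp, of "- c"]
  show ?thesis by simp
qed

section \<open>Powers of the sine and the singular cotangent\<close>

lemma finite_sin_zeros:
  fixes a b t :: real
  shows "finite {\<theta> \<in> {a..b}. sin (\<theta> - t) = 0}"
proof (rule finite_subset)
  show "{\<theta> \<in> {a..b}. sin (\<theta> - t) = 0} \<subseteq> (\<lambda>n::int. t + of_int n * pi) ` {\<lfloor>(a - t) / pi\<rfloor>..\<lceil>(b - t) / pi\<rceil>}"
  proof
    fix \<theta> assume "\<theta> \<in> {\<theta> \<in> {a..b}. sin (\<theta> - t) = 0}"
    then obtain n :: int where n: "\<theta> - t = of_int n * pi" and ab: "a \<le> \<theta>" "\<theta> \<le> b"
      by (auto simp: sin_zero_iff_int2)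
    have "(a - t) / pi \<le> of_int n" "of_int n \<le> (b - t) / pi"
      using n ab pi_gt_zero by (auto simp: field_simps)
    then have "\<lfloor>(a - t) / pi\<rfloor> \<le> n" "n \<le> \<lceil>(b - t) / pi\<rceil>" by linarith+
    then show "\<theta> \<in> (\<lambda>n::int. t + of_int n * pi) ` {\<lfloor>(a - t) / pi\<rfloor>..\<lceil>(b - t) / pi\<rceil>}"
      using n by (intro image_eqI[of _ _ n]) auto
  qed
qed simp

text \<open>The square removes the absolute value, so that the chain rule applies on either side of
  a zero.\<close>

lemma abs_sin_powr_eq:
  fixes x c :: real
  shows "\<bar>sin x\<bar> powr c = ((sin x)\<^sup>2) powr (c / 2)"
proof (cases "sin x = 0")
  case False
  have "((sin x)\<^sup>2) = \<bar>sin x\<bar> powr 2" using False by (simp add: powr_numeral)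
  then show ?thesis by (simp only: powr_powr) simp
qed simp

lemma DERIV_abs_sin_powr:
  fixes x c :: real
  assumes "sin x \<noteq> 0"
  shows "((\<lambda>x. \<bar>sin x\<bar> powr c) has_real_derivative (c * cot x * \<bar>sin x\<bar> powr c)) (at x)"
proof -
  have D: "((\<lambda>x. ((sin x)\<^sup>2) powr (c / 2)) has_real_derivative ((c / 2) * ((sin x)\<^sup>2) powr (c / 2 - 1) * (2 * sin x * cos x))) (at x)"
    using assms by (auto intro!: derivative_eq_intros simp: algebra_simps)
  have eq: "(c / 2) * ((sin x)\<^sup>2) powr (c / 2 - 1) * (2 * sin x * cos x) = c * cot x * ((sin x)\<^sup>2) powr (c / 2)"
    using assms by (simp add: powr_diff cot_def power2_eq_square)
  show ?thesis unfolding abs_sin_powr_eq using D eq by (rule DERIV_cong)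
qed

lemma continuous_on_abs_sin_powr:
  fixes c t :: real
  assumes "c > 0"
  shows "continuous_on S (\<lambda>x. \<bar>sin (x - t)\<bar> powr c)"
  using assms by (intro continuous_on_powr' continuous_intros) auto

text \<open>For c < 1 the function is unbounded at the zeros of the sine, but c times it is the
  derivative of the continuous function |sin|^c. It has constant sign on [0, pi/2] and on
  [pi/2, pi], so integrability there is absolute; periodicity carries this to the whole
  circle.\<close>

lemma cot_sin_absolutely_integrable:
  fixes c t :: real
  assumes c: "c > 0"
  shows "(\<lambda>x. cot (x - t) * \<bar>sin (x - t)\<bar> powr c) absolutely_integrable_on {0..2 * pi}"
proof -
  let ?f = "\<lambda>x. cot x * \<bar>sin x\<bar> powr c" and ?h = "\<lambda>x. \<bar>sin x\<bar> powr c"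
  have cont: "continuous_on S ?h" for S using continuous_on_abs_sin_powr[OF c, of S 0] by simp
  have I: "((\<lambda>x. c * cot x * ?h x) has_integral (?h v - ?h u)) {u..v}" if "u \<le> v" "\<And>x. u < x \<Longrightarrow> x < v \<Longrightarrow> sin x \<noteq> 0" for u v
    by (rule fundamental_theorem_of_calculus_interior[OF that(1) cont])
      (use DERIV_abs_sin_powr that(2) in \<open>auto simp flip: has_real_derivative_iff_has_vector_derivative\<close>)
  have sp: "sin x > 0" if "0 < x" "x < pi" for x using that by (rule sin_gt_zero)
  have A: "?f integrable_on {u..v}" if "u \<le> v" "\<And>x. u < x \<Longrightarrow> x < v \<Longrightarrow> sin x \<noteq> 0" for u v
    using has_integral_mult_right[OF I[OF that], of "1 / c"] c by (auto simp: integrable_on_def mult.assoc)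
  have a1: "?f absolutely_integrable_on {0..pi/2}"
  proof (rule nonnegative_absolutely_integrable_1)
    show "?f integrable_on {0..pi/2}" by (rule A) (use sp in force)+
    show "0 \<le> ?f x" if "x \<in> {0..pi/2}" for x
      using that sin_ge_zero[of x] cos_ge_zero[of x] by (auto simp: cot_def)
  qed
  have "(\<lambda>x. - ?f x) absolutely_integrable_on {pi/2..pi}"
  proof (rule nonnegative_absolutely_integrable_1)
    have "sin x \<noteq> 0" if "pi/2 < x" "x < pi" for x
      using sp[of x] that pi_gt_zero by linarith
    then show "(\<lambda>x. - ?f x) integrable_on {pi/2..pi}" by (intro integrable_neg A) auto
    show "0 \<le> - ?f x" if "x \<in> {pi/2..pi}" for x
    proof -
      have "cos x \<le> 0" using that cos_monotone_0_pi_le[of "pi/2" x] by auto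
      moreover have "sin x \<ge> 0" using that by (intro sin_ge_zero) auto
      ultimately have "cot x \<le> 0" by (simp add: cot_def divide_nonpos_nonneg)
      then show ?thesis by (simp add: mult_nonpos_nonneg)
    qed
  qed
  then have a2: "?f absolutely_integrable_on {pi/2..pi}"
    using absolutely_integrable_on_scaleR_iff[where c = "- 1" and f = ?f] by simp
  have comb: "g integrable_on {0..pi}" if "g integrable_on {0..pi/2}" "g integrable_on {pi/2..pi}" for g :: "real \<Rightarrow> real"
    by (rule Henstock_Kurzweil_Integration.integrable_combine[where c = "pi/2"]) (use that in auto)
  have comb2: "g integrable_on {0..2*pi}" if "g integrable_on {0..pi}" "g integrable_on {pi..2*pi}" for g :: "real \<Rightarrow> real"
    by (rule Henstock_Kurzweil_Integration.integrable_combine[where c = pi]) (use that in auto)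
  have i0: "?f integrable_on {0..pi}" "(\<lambda>x. norm (?f x)) integrable_on {0..pi}"
    using a1 a2 comb[where g = ?f] comb[where g = "\<lambda>x. norm (?f x)"] unfolding absolutely_integrable_on_def by blast+
  have per: "?f (x + pi) = ?f x" for x by (simp add: cot_def)
  have i1: "?f integrable_on {pi..2*pi}" "(\<lambda>x. norm (?f x)) integrable_on {pi..2*pi}"
  proof -
    define g where "g = ?f"
    have g: "g (x + - pi) = g x" for x unfolding g_def using per[of "x + - pi"] by (simp only: add.assoc add.left_inverse add_0_right)
    have "g integrable_on {pi..2*pi}" "(\<lambda>x. norm (g x)) integrable_on {pi..2*pi}"
      using integrable_shift_real_ivl[OF i0(1)[folded g_def], of "- pi"] integrable_shift_real_ivl[where f = "\<lambda>x. norm (g x)" and a = 0 and b = pi and c = "- pi"]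
        i0(2) unfolding g by (auto simp: g_def)
    then show "?f integrable_on {pi..2*pi}" "(\<lambda>x. norm (?f x)) integrable_on {pi..2*pi}" unfolding g_def .
  qed
  have i2: "?f integrable_on {0..2*pi}" "(\<lambda>x. norm (?f x)) integrable_on {0..2*pi}"
    using i0 i1 comb2[where g = ?f] comb2[where g = "\<lambda>x. norm (?f x)"] by blast+
  have per2: "?f (x + 2 * pi) = ?f x" for x by (simp add: cot_def)
  have "(\<lambda>x. ?f (x + (- t))) integrable_on {0..2*pi}" "(\<lambda>x. norm (?f (x + (- t)))) integrable_on {0..2*pi}"
    using i2 has_integral_periodic_shift[where p = "2 * pi" and f = ?f and c = "- t"] has_integral_periodic_shift[where p = "2 * pi" and f = "\<lambda>x. norm (?f x)" and c = "- t"] per2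
    unfolding integrable_on_def by (metis pi_gt_zero zero_less_mult_iff zero_less_numeral)+
  then show ?thesis by (intro absolutely_integrable_onI) auto
qed

lemma absolutely_integrable_mult_continuous:
  fixes g :: "real \<Rightarrow> real" and F :: "real \<Rightarrow> complex"
  assumes g: "g absolutely_integrable_on {a..b}" and F: "continuous_on {a..b} F"
  shows "(\<lambda>x. of_real (g x) * F x) absolutely_integrable_on {a..b}"
proof -
  have bl: "bilinear (\<lambda>(z::complex) (r::real). of_real r * z)"
    by (simp add: bilinear_def linear_iff algebra_simps scaleR_conv_of_real)
  show ?thesis
    by (rule absolutely_integrable_bounded_measurable_product[OF bl _ _ _ g])
      (use F in \<open>auto intro!: continuous_imp_measurable_on_sets_lebesgue compact_imp_bounded compact_continuous_image\<close>)
qed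

lemma cis_off_mirrors: "cis \<theta> \<in> off_mirrors N \<longleftrightarrow> (\<forall>j<N. sin (\<theta> - dih_theta N j) \<noteq> 0)"
  by (simp add: off_mirrors_def inner2_dih_root sin_diff algebra_simps)

lemma dih_refl_cis: "dih_refl N j (cis \<theta>) = cis (2 * dih_theta N j - \<theta>)"
  by (simp add: dih_refl_def cis_cnj cis_mult)

lemma continuous_on_cis_comp:
  assumes "continuous_on UNIV f"
  shows "continuous_on S (\<lambda>\<theta>. f (cis \<theta>))"
proof -
  have "continuous_on S cis" by (intro continuous_intros)
  then show ?thesis using continuous_on_compose2[OF assms] by auto
qed

lemma homog_poly_continuous: "f \<in> homog_poly n \<Longrightarrow> continuous_on UNIV f"
  by (intro differentiable_imp_continuous_on) (auto simp: differentiable_on_def homog_poly_differentiable differentiable_at_withinI)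

section \<open>The angular Dunkl operator on the circle\<close>

text \<open>What integration by parts on the circle asks of a weight, in a form shared by both
  families of groups. \<open>C\<close> absorbs the powers of 2 that arise when sin (k \<theta>) is
  factored into sines.\<close>

locale dunkl_weight =
  fixes N :: nat and kap :: "nat \<Rightarrow> real" and ups :: "complex \<Rightarrow> real" and C :: real
  assumes N_pos: "N > 0" and kap_pos: "\<And>j. j < N \<Longrightarrow> kap j > 0" and C_pos: "C > 0"
    and ups_cis: "\<And>\<theta>. ups (cis \<theta>) = C * (\<Prod>j<N. \<bar>sin (\<theta> - dih_theta N j)\<bar> powr (2 * kap j))"
    and ups_refl: "\<And>j \<theta>. j < N \<Longrightarrow> ups (cis (2 * dih_theta N j - \<theta>)) = ups (cis \<theta>)"
begin

abbreviation W :: "real \<Rightarrow> real" where "W \<theta> \<equiv> ups (cis \<theta>)"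
abbreviation th :: "nat \<Rightarrow> real" where "th \<equiv> dih_theta N"

definition mirror_angles :: "real set" where "mirror_angles = {\<theta> \<in> {0..2 * pi}. \<exists>j<N. sin (\<theta> - th j) = 0}"

lemma finite_mirror_angles: "finite mirror_angles"
proof -
  have "mirror_angles = (\<Union>j<N. {\<theta> \<in> {0..2 * pi}. sin (\<theta> - th j) = 0})" by (auto simp: mirror_angles_def)
  then show ?thesis using finite_sin_zeros by simp
qed

lemma not_mirror_angles: "\<theta> \<in> {0..2 * pi} - mirror_angles \<Longrightarrow> cis \<theta> \<in> off_mirrors N"
  unfolding cis_off_mirrors mirror_angles_def by auto

lemma W_continuous: "continuous_on S W"
  unfolding ups_cis by (intro continuous_intros continuous_on_abs_sin_powr) (use kap_pos in auto)

lemma W_nonneg: "W \<theta> \<ge> 0"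
  unfolding ups_cis using C_pos by (intro mult_nonneg_nonneg prod_nonneg) auto

lemma W_pos: "cis \<theta> \<in> off_mirrors N \<Longrightarrow> W \<theta> > 0"
  unfolding ups_cis cis_off_mirrors using C_pos by (intro mult_pos_pos prod_pos) auto

lemma cis_periodic: "cis (\<theta> + 2 * pi) = cis \<theta>"
  by (simp add: complex_eq_iff)

lemma W_deriv:
  assumes "\<And>j. j < N \<Longrightarrow> sin (\<theta> - th j) \<noteq> 0"
  shows "(W has_real_derivative (W \<theta> * (\<Sum>j<N. 2 * kap j * cot (\<theta> - th j)))) (at \<theta>)"
proof -
  let ?f = "\<lambda>j \<theta>. \<bar>sin (\<theta> - th j)\<bar> powr (2 * kap j)"
  have nz: "?f j \<theta> \<noteq> 0" if "j < N" for j using assms[OF that] by simp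
  have d: "(?f j has_real_derivative (2 * kap j * cot (\<theta> - th j) * ?f j \<theta>)) (at \<theta>)" if "j < N" for j
  proof -
    have "((\<lambda>x. x - th j) has_real_derivative 1) (at \<theta>)" by (auto intro!: derivative_eq_intros)
    from DERIV_chain2[OF DERIV_abs_sin_powr[OF assms[OF that]] this] show ?thesis by simp
  qed
  have "((\<lambda>u. \<Prod>j<N. ?f j u) has_real_derivative ((\<Prod>j<N. ?f j \<theta>) * (\<Sum>j<N. 2 * kap j * cot (\<theta> - th j) * ?f j \<theta> / ?f j \<theta>))) (at \<theta>)"
    by (rule has_field_derivative_prod') (use nz d in auto)
  also have "(\<Sum>j<N. 2 * kap j * cot (\<theta> - th j) * ?f j \<theta> / ?f j \<theta>) = (\<Sum>j<N. 2 * kap j * cot (\<theta> - th j))"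
    by (intro sum.cong refl) (use nz in simp)
  finally show ?thesis
    unfolding ups_cis mult.assoc by (rule DERIV_cmult)
qed

text \<open>The j-th factor of \<open>W\<close> tames the pole of the j-th cotangent; the other
  factors are continuous.\<close>

lemma cot_W_integrable:
  fixes F :: "real \<Rightarrow> complex"
  assumes j: "j < N" and F: "continuous_on UNIV F"
  shows "(\<lambda>\<theta>. of_real (cot (\<theta> - th j) * W \<theta>) * F \<theta>) absolutely_integrable_on {0..2 * pi}"
proof -
  let ?R = "\<lambda>\<theta>. C * (\<Prod>i\<in>{..<N} - {j}. \<bar>sin (\<theta> - th i)\<bar> powr (2 * kap i))"
  have W: "W \<theta> = \<bar>sin (\<theta> - th j)\<bar> powr (2 * kap j) * ?R \<theta>" for \<theta>
    unfolding ups_cis using j by (subst prod.remove[of _ j]) auto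
  have "continuous_on {0..2 * pi} (\<lambda>\<theta>. complex_of_real (?R \<theta>) * F \<theta>)"
    by (intro continuous_intros continuous_on_abs_sin_powr continuous_on_subset[OF F]) (use kap_pos in auto)
  from absolutely_integrable_mult_continuous[OF cot_sin_absolutely_integrable this, of "2 * kap j" "th j"] kap_pos[OF j]
  show ?thesis unfolding W by (simp add: mult_ac)
qed

text \<open>The operator \<open>dunkl_ang\<close> in the angle, with the derivative as a separate
  argument: at x = cis \<theta> a root a satisfies <a, x> = sin (\<theta> - th j) and has tangential
  component cos (\<theta> - th j), whose quotient is the cotangent.\<close>

definition ang :: "(real \<Rightarrow> complex) \<Rightarrow> (real \<Rightarrow> complex) \<Rightarrow> real \<Rightarrow> complex" where
  "ang f f' \<theta> = f' \<theta> + (\<Sum>j<N. of_real (kap j) * of_real (cot (\<theta> - th j)) * (f \<theta> - f (2 * th j - \<theta>)))"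

definition smooth_per :: "(real \<Rightarrow> complex) \<Rightarrow> (real \<Rightarrow> complex) \<Rightarrow> bool" where
  "smooth_per f f' \<longleftrightarrow> (\<forall>\<theta>. (f has_vector_derivative f' \<theta>) (at \<theta>)) \<and> continuous_on UNIV f' \<and> (\<forall>\<theta>. f (\<theta> + 2 * pi) = f \<theta>)"

lemma smooth_per_cont: "smooth_per f f' \<Longrightarrow> continuous_on UNIV f"
  unfolding smooth_per_def
  by (intro differentiable_imp_continuous_on) (auto simp: differentiable_on_def has_vector_derivative_def differentiable_def)

text \<open>The reflection negates the cotangent and preserves \<open>W\<close>.\<close>

lemma cot_W_reflect:
  fixes F :: "real \<Rightarrow> complex"
  assumes j: "j < N" and F: "continuous_on UNIV F" and per: "\<And>\<theta>. F (\<theta> + 2 * pi) = F \<theta>"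
    and I: "((\<lambda>\<theta>. of_real (cot (\<theta> - th j) * W \<theta>) * F \<theta>) has_integral I) {0..2 * pi}"
  shows "((\<lambda>\<theta>. of_real (cot (\<theta> - th j) * W \<theta>) * F (2 * th j - \<theta>)) has_integral (- I)) {0..2 * pi}"
proof -
  let ?g = "\<lambda>\<theta>. of_real (cot (\<theta> - th j) * W \<theta>) * F \<theta>"
  have p: "?g (\<theta> + 2 * pi) = ?g \<theta>" for \<theta>
  proof -
    have "cot (\<theta> + 2 * pi - th j) = cot (\<theta> - th j)"
      unfolding cot_def using sin_periodic[of "\<theta> - th j"] cos_periodic[of "\<theta> - th j"] by (simp add: algebra_simps)
    then show ?thesis using per cis_periodic by simp
  qed
  have "((\<lambda>\<theta>. ?g (2 * th j - \<theta>)) has_integral I) {0..2 * pi}"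
    by (rule has_integral_periodic_reflect[OF _ I p]) simp
  moreover have "?g (2 * th j - \<theta>) = - (of_real (cot (\<theta> - th j) * W \<theta>) * F (2 * th j - \<theta>))" for \<theta>
  proof -
    have "cot (2 * th j - \<theta> - th j) = - cot (\<theta> - th j)"
      using cot_minus[of "\<theta> - th j"] by (simp add: algebra_simps)
    then show ?thesis using ups_refl[OF j] by simp
  qed
  ultimately have "((\<lambda>\<theta>. - (of_real (cot (\<theta> - th j) * W \<theta>) * F (2 * th j - \<theta>))) has_integral I) {0..2 * pi}" by simp
  from has_integral_neg[OF this] show ?thesis by simp
qed

text \<open>By the reflection symmetry of \<open>W\<close> the cotangent terms integrate to the integral of \<open>f W'\<close>,
  so the integrand can be replaced by the derivative of \<open>f W\<close>.\<close>

lemma ang_zero: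
  assumes f: "smooth_per f f'"
  shows "((\<lambda>\<theta>. ang f f' \<theta> * of_real (W \<theta>)) has_integral 0) {0..2 * pi}"
proof -
  note fc = smooth_per_cont[OF f]
  have f': "continuous_on UNIV f'" and d: "\<And>\<theta>. (f has_vector_derivative f' \<theta>) (at \<theta>)" and per: "\<And>\<theta>. f (\<theta> + 2 * pi) = f \<theta>"
    using f by (auto simp: smooth_per_def)
  let ?T = "\<lambda>j \<theta>. of_real (cot (\<theta> - th j) * W \<theta>) * f \<theta>"
  have "\<exists>I. (?T j has_integral I) {0..2 * pi}" if "j < N" for j
    using cot_W_integrable[OF that fc] by (auto simp: absolutely_integrable_on_def integrable_on_def)
  then obtain I where I: "\<And>j. j < N \<Longrightarrow> (?T j has_integral I j) {0..2 * pi}" by metis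
  have "(\<lambda>\<theta>. f' \<theta> * of_real (W \<theta>)) integrable_on {0..2 * pi}"
    by (intro integrable_continuous_real continuous_intros W_continuous continuous_on_subset[OF f']) auto
  then obtain J where J: "((\<lambda>\<theta>. f' \<theta> * of_real (W \<theta>)) has_integral J) {0..2 * pi}" by blast
  have G: "((\<lambda>\<theta>. f \<theta> * of_real (W \<theta> * (\<Sum>j<N. 2 * kap j * cot (\<theta> - th j))) + f' \<theta> * of_real (W \<theta>)) has_integral
     (f (2 * pi) * of_real (W (2 * pi)) - f 0 * of_real (W 0))) {0..2 * pi}"
  proof (rule fundamental_theorem_of_calculus_interior_strong[OF finite_mirror_angles])
    fix x assume x: "x \<in> {0<..<2 * pi} - mirror_angles"
    then have "cis x \<in> off_mirrors N" using not_mirror_angles[of x] by auto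
    then have nz: "\<And>j. j < N \<Longrightarrow> sin (x - th j) \<noteq> 0" by (simp add: cis_off_mirrors)
    have "((\<lambda>\<theta>. complex_of_real (W \<theta>)) has_vector_derivative of_real (W x * (\<Sum>j<N. 2 * kap j * cot (x - th j)))) (at x)"
      using W_deriv[OF nz] by (intro has_vector_derivative_of_real) (simp flip: has_real_derivative_iff_has_vector_derivative)
    from has_vector_derivative_mult[OF d this]
    show "((\<lambda>\<theta>. f \<theta> * of_real (W \<theta>)) has_vector_derivative f x * of_real (W x * (\<Sum>j<N. 2 * kap j * cot (x - th j))) + f' x * of_real (W x)) (at x)" .
  next
    show "continuous_on {0..2 * pi} (\<lambda>\<theta>. f \<theta> * of_real (W \<theta>))"
      by (intro continuous_intros W_continuous continuous_on_subset[OF fc]) auto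
  qed simp
  have "((\<lambda>\<theta>. (\<Sum>j<N. of_real (2 * kap j) * ?T j \<theta>) + f' \<theta> * of_real (W \<theta>)) has_integral ((\<Sum>j<N. of_real (2 * kap j) * I j) + J)) {0..2 * pi}"
    by (intro has_integral_add has_integral_sum has_integral_mult_right I J) auto
  moreover have "(\<Sum>j<N. of_real (2 * kap j) * ?T j \<theta>) = f \<theta> * of_real (W \<theta> * (\<Sum>j<N. 2 * kap j * cot (\<theta> - th j)))" for \<theta>
    by (simp add: sum_distrib_left mult_ac)
  ultimately have "(\<Sum>j<N. of_real (2 * kap j) * I j) + J = f (2 * pi) * of_real (W (2 * pi)) - f 0 * of_real (W 0)"
    using G by (simp add: has_integral_unique)
  also have "\<dots> = 0" using per[of 0] by simp
  finally have z: "(\<Sum>j<N. of_real (2 * kap j) * I j) + J = 0" .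
  have R: "((\<lambda>\<theta>. of_real (cot (\<theta> - th j) * W \<theta>) * f (2 * th j - \<theta>)) has_integral - I j) {0..2 * pi}" if "j < N" for j
    by (rule cot_W_reflect[OF that fc per I[OF that]])
  have "((\<lambda>\<theta>. f' \<theta> * of_real (W \<theta>) + (\<Sum>j<N. of_real (kap j) * (?T j \<theta> - of_real (cot (\<theta> - th j) * W \<theta>) * f (2 * th j - \<theta>)))) has_integral
       (J + (\<Sum>j<N. of_real (kap j) * (I j - (- I j))))) {0..2 * pi}"
    by (intro has_integral_add has_integral_sum has_integral_mult_right has_integral_diff I J R) auto
  moreover have "f' \<theta> * of_real (W \<theta>) + (\<Sum>j<N. of_real (kap j) * (?T j \<theta> - of_real (cot (\<theta> - th j) * W \<theta>) * f (2 * th j - \<theta>))) = ang f f' \<theta> * of_real (W \<theta>)" for \<theta>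
    unfolding ang_def distrib_right sum_distrib_right by (intro arg_cong2[where f = "(+)"] sum.cong refl) (simp add: algebra_simps)
  moreover have "J + (\<Sum>j<N. of_real (kap j) * (I j - (- I j))) = 0"
  proof -
    have "of_real (kap j) * (I j - (- I j)) = of_real (2 * kap j) * I j" for j by simp
    then show ?thesis using z by (simp only: add.commute)
  qed
  ultimately show ?thesis by simp
qed

text \<open>On the product f h, \<open>ang\<close> misses Leibniz's rule by the terms \<kappa>_j cot
  (\<theta> - th j) (f - f o r_j) (h - h o r_j). Weighted by \<open>W\<close>, each of them is odd
  under r_j and integrates to 0; the integral of \<open>ang\<close> of the product is 0 as
  well.\<close>

lemma ang_antisym:
  assumes f: "smooth_per f f'" and h: "smooth_per h h'"
  shows "((\<lambda>\<theta>. (ang f f' \<theta> * h \<theta> + f \<theta> * ang h h' \<theta>) * of_real (W \<theta>)) has_integral 0) {0..2 * pi}"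
proof -
  note fc = smooth_per_cont[OF f] and hc = smooth_per_cont[OF h]
  have f': "continuous_on UNIV f'" "\<And>\<theta>. (f has_vector_derivative f' \<theta>) (at \<theta>)" "\<And>\<theta>. f (\<theta> + 2 * pi) = f \<theta>"
    and h': "continuous_on UNIV h'" "\<And>\<theta>. (h has_vector_derivative h' \<theta>) (at \<theta>)" "\<And>\<theta>. h (\<theta> + 2 * pi) = h \<theta>"
    using f h by (auto simp: smooth_per_def)
  let ?p' = "\<lambda>\<theta>. f \<theta> * h' \<theta> + f' \<theta> * h \<theta>"
  have sp: "smooth_per (\<lambda>\<theta>. f \<theta> * h \<theta>) ?p'"
    unfolding smooth_per_def using f' h' fc hc by (auto intro!: has_vector_derivative_mult continuous_intros)
  let ?F = "\<lambda>j \<theta>. (f \<theta> - f (2 * th j - \<theta>)) * (h \<theta> - h (2 * th j - \<theta>))"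
  have Fj: "((\<lambda>\<theta>. of_real (cot (\<theta> - th j) * W \<theta>) * ?F j \<theta>) has_integral 0) {0..2 * pi}" if j: "j < N" for j
  proof -
    have fr: "continuous_on UNIV (\<lambda>\<theta>. g (2 * th j - \<theta>))" if "continuous_on UNIV g" for g :: "real \<Rightarrow> complex"
      by (rule continuous_on_compose2[OF that]) (auto intro!: continuous_intros)
    have Fc: "continuous_on UNIV (?F j)" by (intro continuous_intros fc hc fr[OF fc] fr[OF hc])
    have pr: "f (2 * th j - (\<theta> + 2 * pi)) = f (2 * th j - \<theta>)" "h (2 * th j - (\<theta> + 2 * pi)) = h (2 * th j - \<theta>)" for \<theta>
      using f'(3)[of "2 * th j - (\<theta> + 2 * pi)"] h'(3)[of "2 * th j - (\<theta> + 2 * pi)"] by simp_all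
    have per: "?F j (\<theta> + 2 * pi) = ?F j \<theta>" for \<theta> unfolding pr f'(3) h'(3) ..
    obtain I where I: "((\<lambda>\<theta>. of_real (cot (\<theta> - th j) * W \<theta>) * ?F j \<theta>) has_integral I) {0..2 * pi}"
      using cot_W_integrable[OF j Fc] by (auto simp: absolutely_integrable_on_def integrable_on_def)
    have "?F j (2 * th j - \<theta>) = ?F j \<theta>" for \<theta> by (simp add: algebra_simps)
    with cot_W_reflect[OF j Fc per I] have "((\<lambda>\<theta>. of_real (cot (\<theta> - th j) * W \<theta>) * ?F j \<theta>) has_integral - I) {0..2 * pi}" by simp
    with I have "I = - I" by (rule has_integral_unique)
    then have "I = 0" by simp
    with I show ?thesis by simp
  qed
  have "((\<lambda>\<theta>. ang (\<lambda>\<theta>. f \<theta> * h \<theta>) ?p' \<theta> * of_real (W \<theta>) + (\<Sum>j<N. of_real (kap j) * (of_real (cot (\<theta> - th j) * W \<theta>) * ?F j \<theta>)))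
     has_integral (0 + (\<Sum>j<N. of_real (kap j) * 0))) {0..2 * pi}"
    by (intro has_integral_add has_integral_sum has_integral_mult_right ang_zero[OF sp] Fj) auto
  moreover have "ang (\<lambda>\<theta>. f \<theta> * h \<theta>) ?p' \<theta> * of_real (W \<theta>) + (\<Sum>j<N. of_real (kap j) * (of_real (cot (\<theta> - th j) * W \<theta>) * ?F j \<theta>))
     = (ang f f' \<theta> * h \<theta> + f \<theta> * ang h h' \<theta>) * of_real (W \<theta>)" for \<theta>
  proof -
    define S0 where "S0 = (\<Sum>j<N. of_real (kap j) * of_real (cot (\<theta> - th j)) * (f \<theta> * h \<theta> - f (2 * th j - \<theta>) * h (2 * th j - \<theta>)))"
    define SF where "SF = (\<Sum>j<N. of_real (kap j) * of_real (cot (\<theta> - th j)) * ?F j \<theta>)"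
    define Sf where "Sf = (\<Sum>j<N. of_real (kap j) * of_real (cot (\<theta> - th j)) * (f \<theta> - f (2 * th j - \<theta>)))"
    define Sh where "Sh = (\<Sum>j<N. of_real (kap j) * of_real (cot (\<theta> - th j)) * (h \<theta> - h (2 * th j - \<theta>)))"
    have 1: "(\<Sum>j<N. of_real (kap j) * (of_real (cot (\<theta> - th j) * W \<theta>) * ?F j \<theta>)) = SF * of_real (W \<theta>)"
      unfolding SF_def sum_distrib_right by (simp add: mult_ac)
    have 2: "S0 + SF = Sf * h \<theta> + f \<theta> * Sh"
      unfolding S0_def SF_def Sf_def Sh_def sum_distrib_right sum_distrib_left sum.distrib[symmetric]
      by (intro sum.cong refl) (simp add: algebra_simps)
    have "(?p' \<theta> + S0) * of_real (W \<theta>) + SF * of_real (W \<theta>) = (?p' \<theta> + (S0 + SF)) * of_real (W \<theta>)"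
      by (simp only: distrib_right add.assoc)
    also have "\<dots> = ((f' \<theta> + Sf) * h \<theta> + f \<theta> * (h' \<theta> + Sh)) * of_real (W \<theta>)"
      unfolding 2 by (simp add: algebra_simps)
    finally show ?thesis
      unfolding 1 ang_def S0_def[symmetric] Sf_def[symmetric] Sh_def[symmetric] .
  qed
  ultimately show ?thesis by simp
qed

end

section \<open>Green's formula and h-harmonics as an orthogonal complement\<close>

context dunkl_weight
begin

text \<open>Unnormalised and without conjugation, so that integrals of products are symmetric and
  bilinear. Conjugates are put in where they are wanted; the conjugate of a homogeneous polynomial
  is again one.\<close>

definition circ_int :: "(complex \<Rightarrow> complex) \<Rightarrow> complex" where
  "circ_int f = integral {0..2 * pi} (\<lambda>\<theta>. f (cis \<theta>) * of_real (W \<theta>))"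

lemma circ_int_has_integral:
  assumes "continuous_on UNIV f"
  shows "((\<lambda>\<theta>. f (cis \<theta>) * of_real (W \<theta>)) has_integral circ_int f) {0..2 * pi}"
  unfolding circ_int_def
  by (intro integrable_integral integrable_continuous_real continuous_intros W_continuous continuous_on_cis_comp assms)

lemma circ_int_add: "continuous_on UNIV f \<Longrightarrow> continuous_on UNIV g \<Longrightarrow> circ_int (\<lambda>z. f z + g z) = circ_int f + circ_int g"
  using has_integral_add[OF circ_int_has_integral circ_int_has_integral, of f g] unfolding circ_int_def
  by (simp add: integral_unique distrib_right)

lemma circ_int_cmult: "continuous_on UNIV f \<Longrightarrow> circ_int (\<lambda>z. c * f z) = c * circ_int f"
  using has_integral_mult_right[OF circ_int_has_integral, of f c] unfolding circ_int_def
  by (simp add: integral_unique mult.assoc)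

lemma circ_int_diff: "continuous_on UNIV f \<Longrightarrow> continuous_on UNIV g \<Longrightarrow> circ_int (\<lambda>z. f z - g z) = circ_int f - circ_int g"
  using has_integral_diff[OF circ_int_has_integral circ_int_has_integral, of f g] unfolding circ_int_def
  by (simp add: integral_unique left_diff_distrib)

lemma circ_int_sum: "(\<And>i. i \<in> A \<Longrightarrow> continuous_on UNIV (f i)) \<Longrightarrow> circ_int (\<lambda>z. \<Sum>i\<in>A. f i z) = (\<Sum>i\<in>A. circ_int (f i))"
proof (induction A rule: infinite_finite_induct)
  case (insert x A)
  then show ?case by (simp add: circ_int_add continuous_on_sum)
qed (simp_all add: circ_int_def)

lemma circ_int_cong_off:
  assumes "\<And>\<theta>. cis \<theta> \<in> off_mirrors N \<Longrightarrow> f (cis \<theta>) = g (cis \<theta>)"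
  shows "circ_int f = circ_int g"
  unfolding circ_int_def
  by (rule integral_spike[OF negligible_finite[OF finite_mirror_angles]]) (use assms not_mirror_angles in auto)

lemma circ_int_cong: "(\<And>\<theta>. f (cis \<theta>) = g (cis \<theta>)) \<Longrightarrow> circ_int f = circ_int g"
  by (rule circ_int_cong_off)

lemma circ_int_refl:
  assumes f: "continuous_on UNIV f" and j: "j < N"
  shows "circ_int (\<lambda>z. f (dih_refl N j z)) = circ_int f"
proof -
  have "((\<lambda>\<theta>. f (cis (2 * th j - \<theta>)) * of_real (W (2 * th j - \<theta>))) has_integral circ_int f) {0..2 * pi}"
    by (rule has_integral_periodic_reflect[OF _ circ_int_has_integral[OF f]]) (simp_all add: cis_periodic)
  then show ?thesis unfolding ups_refl[OF j] circ_int_def[of "\<lambda>z. f (dih_refl N j z)"] dih_refl_cis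
    by (rule integral_unique)
qed

lemma dih_refl_involution: "dih_refl N j (dih_refl N j z) = z"
  by (simp add: dih_refl_def cis_cnj mult.assoc[symmetric] cis_mult)

lemma continuous_dih_refl: "continuous_on UNIV f \<Longrightarrow> continuous_on UNIV (\<lambda>z. f (dih_refl N j z))"
  unfolding dih_refl_def by (rule continuous_on_compose2[of UNIV f]) (auto intro!: continuous_intros)

lemma continuous_refl_sum: "continuous_on UNIV f \<Longrightarrow> continuous_on UNIV (refl_sum N kap f)"
  unfolding refl_sum_def[abs_def] by (intro continuous_intros continuous_dih_refl)

text \<open>Reflections are involutions that preserve the weight, so each of them moves to the other
  factor unchanged.\<close>

lemma circ_int_refl_sum:
  assumes f: "continuous_on UNIV f" and h: "continuous_on UNIV h"
  shows "circ_int (\<lambda>z. refl_sum N kap f z * h z) = circ_int (\<lambda>z. f z * refl_sum N kap h z)"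
proof -
  have eq: "circ_int (\<lambda>z. f (dih_refl N j z) * h z) = circ_int (\<lambda>z. f z * h (dih_refl N j z))" if j: "j < N" for j
    using circ_int_refl[OF _ j, of "\<lambda>z. f z * h (dih_refl N j z)"] f h
    by (simp add: dih_refl_involution continuous_on_mult continuous_dih_refl)
  have "circ_int (\<lambda>z. refl_sum N kap f z * h z) = circ_int (\<lambda>z. \<Sum>j<N. of_real (kap j) * (f (dih_refl N j z) * h z))"
    by (simp add: refl_sum_def sum_distrib_right mult.assoc)
  also have "\<dots> = (\<Sum>j<N. of_real (kap j) * circ_int (\<lambda>z. f (dih_refl N j z) * h z))"
    using f h by (simp add: circ_int_sum circ_int_cmult continuous_on_mult continuous_dih_refl continuous_on_mult_left)
  also have "\<dots> = (\<Sum>j<N. of_real (kap j) * circ_int (\<lambda>z. f z * h (dih_refl N j z)))"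
    using eq by simp
  also have "\<dots> = circ_int (\<lambda>z. \<Sum>j<N. of_real (kap j) * (f z * h (dih_refl N j z)))"
    using f h by (simp add: circ_int_sum circ_int_cmult continuous_on_mult continuous_dih_refl continuous_on_mult_left)
  also have "\<dots> = circ_int (\<lambda>z. f z * refl_sum N kap h z)"
    by (simp add: refl_sum_def sum_distrib_left mult_ac)
  finally show ?thesis .
qed

lemma homog_smooth_per:
  assumes f: "f \<in> homog_poly n"
  shows "\<exists>f'. smooth_per (\<lambda>\<theta>. f (cis \<theta>)) f' \<and>
     (\<forall>\<theta>. cis \<theta> \<in> off_mirrors N \<longrightarrow> ang (\<lambda>\<theta>. f (cis \<theta>)) f' \<theta> = dunkl_ang N kap f (cis \<theta>))"
proof -
  obtain f1 f2 where F: "f1 \<in> homog_poly (n - 1)" "f2 \<in> homog_poly (n - 1)"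
    "\<And>x. (f has_derivative (\<lambda>h. of_real (Re h) * f1 x + of_real (Im h) * f2 x)) (at x)"
    "\<And>x. of_real (Re x) * f1 x + of_real (Im x) * f2 x = of_nat n * f x"
    "n = 0 \<Longrightarrow> f1 = (\<lambda>_. 0)" "n = 0 \<Longrightarrow> f2 = (\<lambda>_. 0)"
    using homog_poly_deriv[OF f] by blast
  define f' where "f' = (\<lambda>\<theta>. of_real (- sin \<theta>) * f1 (cis \<theta>) + of_real (cos \<theta>) * f2 (cis \<theta>))"
  have "smooth_per (\<lambda>\<theta>. f (cis \<theta>)) f'"
    unfolding smooth_per_def
  proof (intro conjI allI)
    fix \<theta>
    have "(cis has_derivative (\<lambda>t. t *\<^sub>R (\<i> * cis \<theta>))) (at \<theta>)"
    proof -
      have "((\<lambda>\<theta>. complex_of_real (cos \<theta>) + \<i> * complex_of_real (sin \<theta>)) has_vector_derivative (of_real (- sin \<theta>) + \<i> * of_real (cos \<theta>))) (at \<theta>)"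
        by (intro has_vector_derivative_add has_vector_derivative_mult_right has_vector_derivative_of_real)
          (auto intro!: derivative_eq_intros simp flip: has_real_derivative_iff_has_vector_derivative)
      moreover have "(\<lambda>\<theta>. complex_of_real (cos \<theta>) + \<i> * complex_of_real (sin \<theta>)) = cis" by (auto simp: complex_eq_iff)
      moreover have "of_real (- sin \<theta>) + \<i> * of_real (cos \<theta>) = \<i> * cis \<theta>" by (simp add: complex_eq_iff)
      ultimately show ?thesis by (simp only: has_vector_derivative_def)
    qed
    from has_derivative_compose[OF this F(3)]
    have "((\<lambda>\<theta>. f (cis \<theta>)) has_derivative (\<lambda>t. of_real (Re (t *\<^sub>R (\<i> * cis \<theta>))) * f1 (cis \<theta>) + of_real (Im (t *\<^sub>R (\<i> * cis \<theta>))) * f2 (cis \<theta>))) (at \<theta>)" .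
    then show "((\<lambda>\<theta>. f (cis \<theta>)) has_vector_derivative f' \<theta>) (at \<theta>)"
      unfolding has_vector_derivative_def f'_def by (rule has_derivative_eq_rhs) (auto simp: scaleR_conv_of_real algebra_simps)
    show "continuous_on UNIV f'"
      unfolding f'_def by (intro continuous_intros continuous_on_cis_comp homog_poly_continuous[OF F(1)] homog_poly_continuous[OF F(2)])
    show "f (cis (\<theta> + 2 * pi)) = f (cis \<theta>)" by (simp only: cis_periodic)
  qed
  moreover have "ang (\<lambda>\<theta>. f (cis \<theta>)) f' \<theta> = dunkl_ang N kap f (cis \<theta>)" if off: "cis \<theta> \<in> off_mirrors N" for \<theta>
  proof -
    have e: "of_real (kap j) * of_real (cot (\<theta> - th j)) * (f (cis \<theta>) - f (cis (2 * th j - \<theta>)))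
       = of_real (cos \<theta>) * (of_real (kap j * inner2 (dih_root N j) \<i>) * (f (cis \<theta>) - f (dih_refl N j (cis \<theta>))) / of_real (inner2 (dih_root N j) (cis \<theta>)))
       - of_real (sin \<theta>) * (of_real (kap j * inner2 (dih_root N j) 1) * (f (cis \<theta>) - f (dih_refl N j (cis \<theta>))) / of_real (inner2 (dih_root N j) (cis \<theta>)))" if "j < N" for j
    proof -
      have s: "inner2 (dih_root N j) (cis \<theta>) = sin (\<theta> - th j)" by (simp add: inner2_dih_root sin_diff algebra_simps)
      have c: "inner2 (dih_root N j) \<i> = cos (th j)" "inner2 (dih_root N j) 1 = - sin (th j)" by (simp_all add: inner2_dih_root)
      have "cos (\<theta> - th j) = cos \<theta> * cos (th j) + sin \<theta> * sin (th j)" by (rule cos_diff)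
      then show ?thesis
        unfolding s c cot_def dih_refl_cis by (simp add: diff_divide_distrib[symmetric] add_divide_distrib[symmetric] algebra_simps)
    qed
    have p: "pderiv2 f \<i> (cis \<theta>) = f2 (cis \<theta>)" "pderiv2 f 1 (cis \<theta>) = f1 (cis \<theta>)"
      unfolding pderiv2_eq[OF F(3)] by simp_all
    show ?thesis
    proof -
      define c1 where "c1 = (\<lambda>j. of_real (kap j * inner2 (dih_root N j) \<i>) * (f (cis \<theta>) - f (dih_refl N j (cis \<theta>))) / of_real (inner2 (dih_root N j) (cis \<theta>)))"
      define s1 where "s1 = (\<lambda>j. of_real (kap j * inner2 (dih_root N j) 1) * (f (cis \<theta>) - f (dih_refl N j (cis \<theta>))) / of_real (inner2 (dih_root N j) (cis \<theta>)))"
      have "(\<Sum>j<N. of_real (kap j) * of_real (cot (\<theta> - th j)) * (f (cis \<theta>) - f (cis (2 * th j - \<theta>))))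
         = of_real (cos \<theta>) * (\<Sum>j<N. c1 j) - of_real (sin \<theta>) * (\<Sum>j<N. s1 j)"
        unfolding sum_distrib_left sum_subtractf[symmetric] c1_def s1_def by (intro sum.cong refl e) simp
      moreover have "dunkl_ang N kap f (cis \<theta>) = of_real (cos \<theta>) * (f2 (cis \<theta>) + (\<Sum>j<N. c1 j)) - of_real (sin \<theta>) * (f1 (cis \<theta>) + (\<Sum>j<N. s1 j))"
        unfolding dunkl_ang_def dunkl_T_def p c1_def s1_def by simp
      ultimately show ?thesis unfolding ang_def f'_def by (simp only:) (simp add: algebra_simps)
    qed
  qed
  ultimately show ?thesis by blast
qed

lemma circ_int_ang_antisym:
  assumes f: "f \<in> homog_poly n" and h: "h \<in> homog_poly m"
    and Bf: "Bf \<in> homog_poly n" "\<And>x. x \<in> off_mirrors N \<Longrightarrow> dunkl_ang N kap f x = Bf x"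
    and Bh: "Bh \<in> homog_poly m" "\<And>x. x \<in> off_mirrors N \<Longrightarrow> dunkl_ang N kap h x = Bh x"
  shows "circ_int (\<lambda>z. Bf z * h z) = - circ_int (\<lambda>z. f z * Bh z)"
proof -
  obtain f' where f': "smooth_per (\<lambda>\<theta>. f (cis \<theta>)) f'" "\<And>\<theta>. cis \<theta> \<in> off_mirrors N \<Longrightarrow> ang (\<lambda>\<theta>. f (cis \<theta>)) f' \<theta> = dunkl_ang N kap f (cis \<theta>)"
    using homog_smooth_per[OF f] by blast
  obtain h' where h': "smooth_per (\<lambda>\<theta>. h (cis \<theta>)) h'" "\<And>\<theta>. cis \<theta> \<in> off_mirrors N \<Longrightarrow> ang (\<lambda>\<theta>. h (cis \<theta>)) h' \<theta> = dunkl_ang N kap h (cis \<theta>)"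
    using homog_smooth_per[OF h] by blast
  have c: "continuous_on UNIV f" "continuous_on UNIV h" "continuous_on UNIV Bf" "continuous_on UNIV Bh"
    using homog_poly_continuous f h Bf Bh by blast+
  have "((\<lambda>\<theta>. (Bf (cis \<theta>) * h (cis \<theta>) + f (cis \<theta>) * Bh (cis \<theta>)) * of_real (W \<theta>)) has_integral 0) {0..2 * pi}"
  proof (rule has_integral_spike[OF negligible_finite[OF finite_mirror_angles] _ ang_antisym[OF f'(1) h'(1)]])
    fix \<theta> assume "\<theta> \<in> {0..2 * pi} - mirror_angles"
    then have "cis \<theta> \<in> off_mirrors N" by (rule not_mirror_angles)
    then show "(Bf (cis \<theta>) * h (cis \<theta>) + f (cis \<theta>) * Bh (cis \<theta>)) * of_real (W \<theta>) =
      (ang (\<lambda>\<theta>. f (cis \<theta>)) f' \<theta> * h (cis \<theta>) + f (cis \<theta>) * ang (\<lambda>\<theta>. h (cis \<theta>)) h' \<theta>) * of_real (W \<theta>)"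
      using f'(2) h'(2) Bf(2) Bh(2) by simp
  qed
  then have "circ_int (\<lambda>z. Bf z * h z + f z * Bh z) = 0" unfolding circ_int_def by (rule integral_unique)
  then have "circ_int (\<lambda>z. Bf z * h z) + circ_int (\<lambda>z. f z * Bh z) = 0"
    using c by (subst circ_int_add[symmetric]) (auto intro!: continuous_intros)
  then show ?thesis by (simp add: eq_neg_iff_add_eq_0)
qed

definition K where "K = (\<Sum>j<N. kap j)"

lemma K_pos: "K > 0"
  unfolding K_def by (rule sum_pos) (use N_pos kap_pos in auto)

text \<open>The polar form integrated against h: A moves over with a sign, S without. What remains
  besides the scalar term is symmetric in f and h; the shape of \<open>M\<close> records this for
  \<open>circ_int_Green\<close>.\<close>

lemma circ_int_Lap:
  assumes f: "f \<in> homog_poly n" and h: "h \<in> homog_poly m"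
    and d: "d \<in> homog_poly n'" "\<And>x. x \<in> off_mirrors N \<Longrightarrow> dunkl_Lap N kap f x = d x"
  shows "\<exists>M. circ_int (\<lambda>z. d z * h z) = M + of_real ((real n + K)\<^sup>2) * circ_int (\<lambda>z. f z * h z) \<and>
    (\<exists>B\<in>homog_poly n. \<exists>B'\<in>homog_poly m. M = - circ_int (\<lambda>z. B z * B' z) - circ_int (\<lambda>z. refl_sum N kap f z * refl_sum N kap h z) \<and>
       (\<forall>x \<in> off_mirrors N. dunkl_ang N kap f x = B x) \<and> (\<forall>x \<in> off_mirrors N. dunkl_ang N kap h x = B' x))"
proof -
  obtain B where B: "B \<in> homog_poly n" "\<And>x. x \<in> off_mirrors N \<Longrightarrow> dunkl_ang N kap f x = B x"
    using dunkl_ang_poly[OF f] by blast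
  obtain B2 where B2: "B2 \<in> homog_poly n" "\<And>x. x \<in> off_mirrors N \<Longrightarrow> dunkl_ang N kap B x = B2 x"
    using dunkl_ang_poly[OF B(1)] by blast
  obtain B' where B': "B' \<in> homog_poly m" "\<And>x. x \<in> off_mirrors N \<Longrightarrow> dunkl_ang N kap h x = B' x"
    using dunkl_ang_poly[OF h] by blast
  note c = homog_poly_continuous[OF f] homog_poly_continuous[OF h] homog_poly_continuous[OF B2(1)]
  note cS = continuous_refl_sum[OF c(1)] continuous_refl_sum[OF continuous_refl_sum[OF c(1)]]
  let ?s = "refl_sum N kap"
  have "d (cis \<theta>) = (B2 (cis \<theta>) + of_real ((real n + K)\<^sup>2) * f (cis \<theta>)) - ?s (?s f) (cis \<theta>)" if off: "cis \<theta> \<in> off_mirrors N" for \<theta>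
  proof -
    have "dunkl_ang N kap (dunkl_ang N kap f) (cis \<theta>) = dunkl_ang N kap B (cis \<theta>)"
      unfolding dunkl_ang_def[of N kap "dunkl_ang N kap f"] dunkl_ang_def[of N kap B]
      using dunkl_T_cong[OF off B(2)] by simp
    then show ?thesis
      using dunkl_Lap_identity[OF f off, of kap] d(2)[OF off] B2(2)[OF off] by (simp add: K_def)
  qed
  then have "circ_int (\<lambda>z. d z * h z) = circ_int (\<lambda>z. (B2 z * h z + of_real ((real n + K)\<^sup>2) * (f z * h z)) - ?s (?s f) z * h z)"
    by (intro circ_int_cong_off) (simp only: left_diff_distrib distrib_right mult.assoc)
  also have "\<dots> = circ_int (\<lambda>z. B2 z * h z) + of_real ((real n + K)\<^sup>2) * circ_int (\<lambda>z. f z * h z) - circ_int (\<lambda>z. ?s (?s f) z * h z)"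
    using c cS by (simp add: circ_int_add circ_int_diff circ_int_cmult continuous_on_mult continuous_on_add continuous_on_mult_left del: of_real_power of_real_add)
  also have "circ_int (\<lambda>z. B2 z * h z) = - circ_int (\<lambda>z. B z * B' z)"
    by (rule circ_int_ang_antisym[OF B(1) h B2 B'])
  also have "circ_int (\<lambda>z. ?s (?s f) z * h z) = circ_int (\<lambda>z. ?s f z * ?s h z)"
    by (rule circ_int_refl_sum[OF cS(1) c(2)])
  finally show ?thesis using B B' by (intro exI[of _ "- circ_int (\<lambda>z. B z * B' z) - circ_int (\<lambda>z. ?s f z * ?s h z)"] conjI bexI[OF _ B(1)] bexI[OF _ B'(1)]) auto
qed

text \<open>Both sides are the symmetric remainder of \<open>circ_int_Lap\<close>, computed once
  from the Laplacian of f and once from that of h.\<close>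

lemma circ_int_Green:
  assumes f: "f \<in> homog_poly n" and h: "h \<in> homog_poly m"
    and d: "d \<in> homog_poly n'" "\<And>x. x \<in> off_mirrors N \<Longrightarrow> dunkl_Lap N kap f x = d x"
    and e: "e \<in> homog_poly m'" "\<And>x. x \<in> off_mirrors N \<Longrightarrow> dunkl_Lap N kap h x = e x"
  shows "circ_int (\<lambda>z. d z * h z) - of_real ((real n + K)\<^sup>2) * circ_int (\<lambda>z. f z * h z)
       = circ_int (\<lambda>z. f z * e z) - of_real ((real m + K)\<^sup>2) * circ_int (\<lambda>z. f z * h z)"
proof -
  let ?s = "refl_sum N kap"
  obtain B B' where 1: "circ_int (\<lambda>z. d z * h z) = - circ_int (\<lambda>z. B z * B' z) - circ_int (\<lambda>z. ?s f z * ?s h z) + of_real ((real n + K)\<^sup>2) * circ_int (\<lambda>z. f z * h z)"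
    "\<And>x. x \<in> off_mirrors N \<Longrightarrow> dunkl_ang N kap f x = B x" "\<And>x. x \<in> off_mirrors N \<Longrightarrow> dunkl_ang N kap h x = B' x"
    using circ_int_Lap[OF f h d] by blast
  obtain C' C where 2: "circ_int (\<lambda>z. e z * f z) = - circ_int (\<lambda>z. C' z * C z) - circ_int (\<lambda>z. ?s h z * ?s f z) + of_real ((real m + K)\<^sup>2) * circ_int (\<lambda>z. h z * f z)"
    "\<And>x. x \<in> off_mirrors N \<Longrightarrow> dunkl_ang N kap h x = C' x" "\<And>x. x \<in> off_mirrors N \<Longrightarrow> dunkl_ang N kap f x = C x"
    using circ_int_Lap[OF h f e] by blast
  have "circ_int (\<lambda>z. C' z * C z) = circ_int (\<lambda>z. B z * B' z)"
    by (rule circ_int_cong_off) (use 1(2,3) 2(2,3) in \<open>simp add: mult.commute\<close>)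
  then show ?thesis using 1(1) 2(1) by (simp add: mult.commute)
qed

text \<open>As \<Delta> f = 0, Green's formula gives ((m + K)^2 - (n + K)^2) times the integral of f
  h as the integral of f \<Delta> h. The latter vanishes by induction, \<Delta> h having degree m -
  2, and the scalar is nonzero because K > 0 and m < n.\<close>

lemma h_harm_orth:
  assumes f: "f \<in> h_harm N kap n"
  shows "h \<in> homog_poly m \<Longrightarrow> m < n \<Longrightarrow> circ_int (\<lambda>z. f z * h z) = 0"
proof (induction m arbitrary: h rule: less_induct)
  case (less m)
  have fp: "f \<in> homog_poly n" and f0: "\<And>x. x \<in> off_mirrors N \<Longrightarrow> dunkl_Lap N kap f x = 0"
    using f by (auto simp: h_harm_def)
  obtain e where e: "e \<in> homog_poly (m - 2)" "\<And>x. x \<in> off_mirrors N \<Longrightarrow> dunkl_Lap N kap h x = e x"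
    "m < 2 \<Longrightarrow> e = (\<lambda>_. 0)"
    using dunkl_Lap_poly[OF less.prems(1)] by blast
  have "circ_int (\<lambda>z. f z * e z) = 0"
  proof (cases "m < 2")
    case True
    then show ?thesis using e(3) by (simp add: circ_int_def)
  next
    case False
    then show ?thesis using less.IH[of "m - 2" e] e(1) less.prems by auto
  qed
  moreover have "(\<lambda>_. 0) \<in> homog_poly 0" by (simp add: homog_poly_eq hform_zero)
  then have "circ_int (\<lambda>z. 0 * h z) - of_real ((real n + K)\<^sup>2) * circ_int (\<lambda>z. f z * h z)
       = circ_int (\<lambda>z. f z * e z) - of_real ((real m + K)\<^sup>2) * circ_int (\<lambda>z. f z * h z)"
    by (rule circ_int_Green[OF fp less.prems(1) _ f0 e(1,2)])
  moreover have "circ_int (\<lambda>z. 0 * h z) = 0" by (simp add: circ_int_def)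
  ultimately have "0 - of_real ((real n + K)\<^sup>2) * circ_int (\<lambda>z. f z * h z) = 0 - of_real ((real m + K)\<^sup>2) * circ_int (\<lambda>z. f z * h z)"
    by (simp only:)
  then have "of_real ((real n + K)\<^sup>2 - (real m + K)\<^sup>2) * circ_int (\<lambda>z. f z * h z) = 0"
    unfolding of_real_diff left_diff_distrib by (simp only: diff_0 neg_equal_iff_equal diff_self)
  moreover have "(real m + K)\<^sup>2 < (real n + K)\<^sup>2"
    using less.prems(2) K_pos by (intro power_strict_mono) auto
  ultimately show ?case by (simp del: of_real_diff of_real_power of_real_add)
qed

text \<open>The weight is positive off finitely many angles, so p vanishes there, by continuity on
  the whole circle, and by homogeneity everywhere.\<close>

lemma circ_int_definite:
  assumes p: "p \<in> homog_poly n" and z: "circ_int (\<lambda>z. p z * cnj (p z)) = 0"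
  shows "p = (\<lambda>_. 0)"
proof -
  note pc = homog_poly_continuous[OF p]
  let ?g = "\<lambda>\<theta>. (cmod (p (cis \<theta>)))\<^sup>2 * W \<theta>"
  have gc: "continuous_on {0..2 * pi} ?g"
    by (intro continuous_intros W_continuous continuous_on_cis_comp[OF pc])
  have "((\<lambda>\<theta>. p (cis \<theta>) * cnj (p (cis \<theta>)) * of_real (W \<theta>)) has_integral 0) {0..2 * pi}"
  proof -
    have "continuous_on UNIV (\<lambda>z. p z * cnj (p z))" by (intro continuous_intros pc)
    from circ_int_has_integral[OF this] show ?thesis by (simp only: z)
  qed
  moreover have "p (cis \<theta>) * cnj (p (cis \<theta>)) * of_real (W \<theta>) = complex_of_real (?g \<theta>)" for \<theta>
    by (simp only: of_real_mult complex_norm_square)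
  ultimately have "((\<lambda>\<theta>. complex_of_real (?g \<theta>)) has_integral 0) {0..2 * pi}" by (simp only:)
  from has_integral_linear[OF this bounded_linear_Re]
  have "(?g has_integral 0) {0..2 * pi}" by (simp only: o_def Re_complex_of_real zero_complex.sel)
  then have "integral {0..2 * pi} ?g = 0" by (rule integral_unique)
  then have g0: "?g \<theta> = 0" if "\<theta> \<in> {0..2 * pi}" for \<theta>
    using integral_eq_0_iff[of 0 "2 * pi" ?g] gc W_nonneg that by auto
  have off: "p (cis \<theta>) = 0" if "\<theta> \<in> {0..2 * pi} - mirror_angles" for \<theta>
    using g0[of \<theta>] W_pos[OF not_mirror_angles[OF that]] that by auto
  have circ: "p (cis \<theta>) = 0" if "\<theta> \<in> {0<..<2 * pi}" for \<theta>
  proof (rule ccontr)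
    assume nz: "p (cis \<theta>) \<noteq> 0"
    let ?U = "{\<theta>. p (cis \<theta>) \<noteq> 0} \<inter> {0<..<2 * pi}"
    have "open ?U"
      by (intro open_Int open_Collect_neq continuous_on_cis_comp[OF pc] continuous_on_const open_greaterThanLessThan)
    moreover have "?U \<subseteq> mirror_angles"
    proof
      fix x assume "x \<in> ?U"
      then have "p (cis x) \<noteq> 0" "x \<in> {0..2 * pi}" by auto
      then show "x \<in> mirror_angles" using off[of x] by blast
    qed
    then have "finite ?U" using finite_mirror_angles finite_subset by blast
    ultimately have "?U = {}" using finite_imp_not_open by blast
    then show False using nz that by auto
  qed
  have all: "p (cis \<theta>) = 0" if "\<theta> \<in> {0..2 * pi}" for \<theta>
  proof -
    have "continuous_on (closure {0<..<2 * pi}) (\<lambda>\<theta>. p (cis \<theta>))" by (rule continuous_on_cis_comp[OF pc])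
    then show ?thesis
      using continuous_constant_on_closure[of "{0<..<2 * pi}" "\<lambda>\<theta>. p (cis \<theta>)" 0 \<theta>] circ that by auto
  qed
  show ?thesis
  proof
    fix x
    have "p x = of_real (cmod x ^ n) * p (cis (Arg2pi x))"
      using homog_poly_scale[OF p, of "cmod x" "cis (Arg2pi x)"] Arg2pi_eq[of x] by (simp add: cis_conv_exp mult.commute)
    then show "p x = 0" using all[of "Arg2pi x"] Arg2pi_ge_0[of x] Arg2pi_lt_2pi[of x] by simp
  qed
qed

text \<open>Let d be \<Delta> p and h its conjugate. Green's formula expresses the integral of |d|^2
  W by those of p h and p \<Delta> h, and both vanish by orthogonality; hence d = 0.\<close>

lemma orth_h_harm:
  assumes p: "p \<in> homog_poly n"
    and orth: "\<And>h. n \<ge> 2 \<Longrightarrow> h \<in> homog_poly (n - 2) \<Longrightarrow> circ_int (\<lambda>z. p z * h z) = 0"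
  shows "p \<in> h_harm N kap n"
proof -
  obtain d where d: "d \<in> homog_poly (n - 2)" "\<And>x. x \<in> off_mirrors N \<Longrightarrow> dunkl_Lap N kap p x = d x"
    "n < 2 \<Longrightarrow> d = (\<lambda>_. 0)"
    using dunkl_Lap_poly[OF p] by blast
  have "d = (\<lambda>_. 0)"
  proof (cases "n < 2")
    case False
    define h where "h = (\<lambda>z. cnj (d z))"
    have h: "h \<in> homog_poly (n - 2)" unfolding h_def by (rule homog_poly_cnj[OF d(1)])
    obtain e where e: "e \<in> homog_poly (n - 2 - 2)" "\<And>x. x \<in> off_mirrors N \<Longrightarrow> dunkl_Lap N kap h x = e x"
      "n - 2 < 2 \<Longrightarrow> e = (\<lambda>_. 0)"
      using dunkl_Lap_poly[OF h] by blast
    have ph: "circ_int (\<lambda>z. p z * h z) = 0" using orth h False by simp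
    have pe: "circ_int (\<lambda>z. p z * e z) = 0"
    proof (cases "n - 2 < 2")
      case True
      then show ?thesis using e(3) by (simp add: circ_int_def)
    next
      case False
      \<comment> \<open>\<Delta> h has degree n - 4. The factor |z|^2, which is 1 on the circle,
        raises it to the degree n - 2 of the hypothesis.\<close>
      define e' where "e' = (\<lambda>z. (z * cnj z) * e z)"
      have zz: "(\<lambda>z. z * cnj z) \<in> homog_poly 2"
        unfolding homog_poly_eq' using hform_monom[of 1 1 2 "\<lambda>z. z" cnj] by simp
      have "e' \<in> homog_poly (2 + (n - 2 - 2))" unfolding e'_def by (rule homog_poly_mult[OF zz e(1)])
      moreover have "2 + (n - 2 - 2) = n - 2" "2 \<le> n" using False by auto
      ultimately have "circ_int (\<lambda>z. p z * e' z) = 0" using orth[of e'] by simp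
      moreover have "circ_int (\<lambda>z. p z * e z) = circ_int (\<lambda>z. p z * e' z)"
        by (rule circ_int_cong) (simp add: e'_def cis_cnj cis_mult)
      ultimately show ?thesis by simp
    qed
    have "circ_int (\<lambda>z. d z * h z) = 0"
      using circ_int_Green[OF p h d(1,2) e(1,2)] ph pe by simp
    then show ?thesis unfolding h_def by (rule circ_int_definite[OF d(1)])
  qed (use d(3) in auto)
  then show ?thesis using p d(2) by (simp add: h_harm_def)
qed

end

section \<open>Reproducing kernels\<close>

lemma sum_even_index:
  fixes n :: nat
  shows "(\<Sum>j\<le>n. if even j then f (j div 2) else (0::'a::comm_monoid_add)) = (\<Sum>i\<le>n div 2. f i)"
proof -
  have "(\<Sum>j\<le>n. if even j then f (j div 2) else 0) = (\<Sum>j\<in>{j. j \<le> n \<and> even j}. f (j div 2))"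
    by (rule sum.mono_neutral_cong_right) auto
  also have "\<dots> = (\<Sum>i\<le>n div 2. f i)"
    by (rule sum.reindex_bij_witness[of _ "\<lambda>i. 2 * i" "\<lambda>j. j div 2"]) auto
  finally show ?thesis .
qed

text \<open>The formal series exp (- c X^2). With c = 1 it encodes the alternating sum over i in the
  Gegenbauer coefficients, and its functional equation separates the two variables of the
  kernel.\<close>

definition fps_gauss :: "real \<Rightarrow> real fps" where
  "fps_gauss c = Abs_fps (\<lambda>n. if even n then (- c) ^ (n div 2) / fact (n div 2) else 0)"

lemma fps_gauss_mult_nth:
  "fps_nth (fps_gauss c * F) n = (\<Sum>i\<le>n div 2. (- c) ^ i / fact i * fps_nth F (n - 2 * i))"
proof -
  have "fps_nth (fps_gauss c * F) n = (\<Sum>j\<le>n. if even j then (- c) ^ (j div 2) / fact (j div 2) * fps_nth F (n - 2 * (j div 2)) else 0)"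
    unfolding fps_mult_nth atMost_atLeast0 by (intro sum.cong refl) (auto simp: fps_gauss_def)
  also have "\<dots> = (\<Sum>i\<le>n div 2. (- c) ^ i / fact i * fps_nth F (n - 2 * i))"
    by (rule sum_even_index)
  finally show ?thesis .
qed

lemma fps_gauss_add: "fps_gauss c * fps_gauss d = fps_gauss (c + d)"
proof (rule fps_ext)
  fix n
  show "fps_nth (fps_gauss c * fps_gauss d) n = fps_nth (fps_gauss (c + d)) n"
  proof (cases "even n")
    case True
    then obtain m where n: "n = 2 * m" by blast
    have "fps_nth (fps_gauss c * fps_gauss d) n = (\<Sum>i\<le>m. (- c) ^ i / fact i * ((- d) ^ (m - i) / fact (m - i)))"
      unfolding fps_gauss_mult_nth n by (intro sum.cong) (auto simp: fps_gauss_def simp flip: diff_mult_distrib2)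
    also have "\<dots> = (\<Sum>i\<le>m. of_nat (m choose i) * (- c) ^ i * (- d) ^ (m - i)) / fact m"
      unfolding sum_divide_distrib by (intro sum.cong refl) (simp add: binomial_fact)
    also have "\<dots> = (- c + - d) ^ m / fact m" unfolding binomial_ring ..
    also have "\<dots> = fps_nth (fps_gauss (c + d)) n" by (simp add: fps_gauss_def n)
    finally show ?thesis .
  next
    case False
    then show ?thesis unfolding fps_gauss_mult_nth by (auto simp: fps_gauss_def intro!: sum.neutral)
  qed
qed

text \<open>The share of one variable in a term of the integral of Im^p Re^q against the kernel: 2^a
  / a! from the Gegenbauer and binomial coefficients, the moment of the measure, and the Pochhammer
  symbol in the circle moment of order p + a, which is 0 for odd order.\<close>

definition mom_coeff :: "real \<Rightarrow> nat \<Rightarrow> nat \<Rightarrow> real" where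
  "mom_coeff \<gamma> p a = (if even (p + a) then 2 ^ a * mu_mom \<gamma> a / fact a * pochhammer (\<gamma> + 1 / 2) ((p + a) div 2) else 0)"

lemma pochhammer_half_pos: "\<gamma> \<ge> 0 \<Longrightarrow> pochhammer (\<gamma> + 1 / 2 :: real) n > 0"
  by (rule pochhammer_pos) simp

text \<open>By the duplication formula (2A)! = 4^A A! (1/2)_A the numerator of \<open>mu_mom\<close>
  cancels, and its denominator shortens the last Pochhammer symbol. The result is a polynomial of
  degree P in A, divided by A!, as finite differences require.\<close>

lemma mom_coeff_even:
  assumes "\<gamma> \<ge> 0"
  shows "mom_coeff \<gamma> (2 * P) (2 * A) = pochhammer (\<gamma> + 1 / 2 + real A) P / fact A"
proof -
  have f: "(fact (2 * A) :: real) = 2 ^ (2 * A) * pochhammer (1 / 2) A * fact A" by (rule fact_double)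
  have p: "pochhammer (\<gamma> + 1 / 2) (P + A) = pochhammer (\<gamma> + 1 / 2) A * pochhammer (\<gamma> + 1 / 2 + real A) P"
    using pochhammer_product'[of "\<gamma> + 1 / 2" A P] by (simp add: add.commute)
  have "(2 * P + 2 * A) div 2 = P + A" "(2 * A + 1) div 2 = A" by auto
  then show ?thesis
    unfolding mom_coeff_def mu_mom_def f
    using pochhammer_half_pos[OF assms, of A] pochhammer_half_pos[of 0 A] by (simp add: p)
qed

text \<open>At odd order \<open>mu_mom\<close> has index A + 1, so the duplication formula for (2A +
  2)!, divided by 2A + 2, gives the same cancellation.\<close>

lemma mom_coeff_odd:
  assumes "\<gamma> \<ge> 0"
  shows "mom_coeff \<gamma> (2 * P + 1) (2 * A + 1) = pochhammer (\<gamma> + 3 / 2 + real A) P / fact A"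
proof -
  have "(fact (2 * (A + 1)) :: real) = 2 ^ (2 * (A + 1)) * pochhammer (1 / 2) (A + 1) * fact (A + 1)" by (rule fact_double)
  then have "(2 * (real A + 1)) * fact (2 * A + 1) = (2 * (real A + 1)) * (2 ^ (2 * A + 1) * pochhammer (1 / 2) (A + 1) * fact A)"
    by (simp add: algebra_simps)
  then have f: "(fact (2 * A + 1) :: real) = 2 ^ (2 * A + 1) * pochhammer (1 / 2) (A + 1) * fact A"
    by (metis mult_cancel_left add_nonneg_eq_0_iff mult_eq_0_iff of_nat_0_le_iff zero_le_one zero_neq_numeral zero_neq_one)
  have p: "pochhammer (\<gamma> + 1 / 2) (P + A + 1) = pochhammer (\<gamma> + 1 / 2) (A + 1) * pochhammer (\<gamma> + 3 / 2 + real A) P"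
    using pochhammer_product'[of "\<gamma> + 1 / 2" "A + 1" P] by (simp add: add_ac)
  have e: "(2 * P + 1 + (2 * A + 1)) div 2 = P + A + 1" "(2 * A + 1 + 1) div 2 = A + 1" by auto
  show ?thesis
    unfolding mom_coeff_def mu_mom_def f e p
    using pochhammer_half_pos[OF assms, of "A + 1"] pochhammer_half_pos[of 0 "A + 1"] by simp
qed

text \<open>Multiplying by the Gaussian series truncates the series of moments to a polynomial of degree \<open>p\<close>
  with leading coefficient 1: all higher coefficients are finite differences of too high an order.\<close>

lemma gauss_mom_coeff:
  assumes g: "\<gamma> \<ge> 0" and d: "p \<le> d"
  shows "(\<Sum>i\<le>d div 2. (-1) ^ i / fact i * mom_coeff \<gamma> p (d - 2 * i)) = (if d = p then 1 else 0)"
proof (cases "even (p + d)")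
  case False
  have "mom_coeff \<gamma> p (d - 2 * i) = 0" if "i \<in> {..d div 2}" for i
  proof -
    have "2 * i \<le> d" using that by auto
    then show ?thesis using False by (auto simp: mom_coeff_def)
  qed
  then show ?thesis using False by auto
next
  case True
  show ?thesis
  proof (cases "even p")
    case ep: True
    then obtain P D where P: "p = 2 * P" and D: "d = 2 * D" using True by (metis dvd_def even_add)
    have PD: "P \<le> D" using d P D by simp
    have "(\<Sum>i\<le>d div 2. (-1) ^ i / fact i * mom_coeff \<gamma> p (d - 2 * i)) = (\<Sum>i\<le>D. (-1) ^ i / (fact i * fact (D - i)) * pochhammer (\<gamma> + 1 / 2 + real (D - i)) P)"
      unfolding P D
    proof (intro sum.cong)
      fix i assume "i \<in> {..D}"
      have "2 * D - 2 * i = 2 * (D - i)" by simp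
      then show "(-1) ^ i / fact i * mom_coeff \<gamma> (2 * P) (2 * D - 2 * i) = (-1) ^ i / (fact i * fact (D - i)) * pochhammer (\<gamma> + 1 / 2 + real (D - i)) P"
        by (simp only: mom_coeff_even[OF g]) simp
    qed simp
    then show ?thesis using alternating_sum_pochhammer'[OF PD, of "\<gamma> + 1 / 2"] P D by auto
  next
    case op: False
    then obtain P D where P: "p = 2 * P + 1" and D: "d = 2 * D + 1" using True by (metis even_add oddE)
    have PD: "P \<le> D" using d P D by simp
    have "(\<Sum>i\<le>d div 2. (-1) ^ i / fact i * mom_coeff \<gamma> p (d - 2 * i)) = (\<Sum>i\<le>D. (-1) ^ i / (fact i * fact (D - i)) * pochhammer (\<gamma> + 3 / 2 + real (D - i)) P)"
      unfolding P D
    proof (intro sum.cong)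
      fix i assume "i \<in> {..D}"
      then have "2 * D + 1 - 2 * i = 2 * (D - i) + 1" by auto
      then show "(-1) ^ i / fact i * mom_coeff \<gamma> (2 * P + 1) (2 * D + 1 - 2 * i) = (-1) ^ i / (fact i * fact (D - i)) * pochhammer (\<gamma> + 3 / 2 + real (D - i)) P"
        by (simp only: mom_coeff_odd[OF g]) simp
    qed simp
    then show ?thesis using alternating_sum_pochhammer'[OF PD, of "\<gamma> + 3 / 2"] P D by auto
  qed
qed

text \<open>The left side is the coefficient of X^m in exp (- X^2) times two series of moments. As
  x^2 + y^2 = 1, the Gaussian splits into exp (- x^2 X^2) and exp (- y^2 X^2), one for each series.
  By \<open>gauss_mom_coeff\<close> these products are polynomials of degrees p and q with leading
  coefficients x^p and y^q, and p + q = m.\<close>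

lemma reproducing_identity:
  assumes \<alpha>: "\<alpha> \<ge> 0" and \<beta>: "\<beta> \<ge> 0" and x: "x\<^sup>2 + y\<^sup>2 = 1" and m: "p + q = m"
  shows "(\<Sum>i\<le>m div 2. (-1) ^ i / fact i * (\<Sum>a\<le>m - 2 * i. (mom_coeff \<alpha> p a * x ^ a) * (mom_coeff \<beta> q (m - 2 * i - a) * y ^ (m - 2 * i - a)))) = x ^ p * y ^ q"
proof -
  define F G where "F = Abs_fps (\<lambda>n. mom_coeff \<alpha> p n * x ^ n)" and "G = Abs_fps (\<lambda>n. mom_coeff \<beta> q n * y ^ n)"
  have one: "fps_nth (fps_gauss (z\<^sup>2) * Abs_fps (\<lambda>n. c n * z ^ n)) d = (\<Sum>i\<le>d div 2. (-1) ^ i / fact i * c (d - 2 * i)) * z ^ d" for c z d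
    unfolding fps_gauss_mult_nth sum_distrib_right
  proof (intro sum.cong refl)
    fix i assume "i \<in> {..d div 2}"
    then have "2 * i \<le> d" by auto
    then have "z ^ d = (z\<^sup>2) ^ i * z ^ (d - 2 * i)" by (simp flip: power_add power_mult)
    then show "(- (z\<^sup>2)) ^ i / fact i * fps_nth (Abs_fps (\<lambda>n. c n * z ^ n)) (d - 2 * i) = (- 1) ^ i / fact i * c (d - 2 * i) * z ^ d"
      by (simp add: power_minus[of "z\<^sup>2"])
  qed
  have "(\<Sum>i\<le>m div 2. (-1) ^ i / fact i * (\<Sum>a\<le>m - 2 * i. (mom_coeff \<alpha> p a * x ^ a) * (mom_coeff \<beta> q (m - 2 * i - a) * y ^ (m - 2 * i - a))))
     = fps_nth (fps_gauss 1 * (F * G)) m"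
    unfolding fps_gauss_mult_nth by (simp add: fps_mult_nth F_def G_def atMost_atLeast0)
  also have "fps_gauss 1 * (F * G) = (fps_gauss (x\<^sup>2) * F) * (fps_gauss (y\<^sup>2) * G)"
    unfolding x[symmetric] fps_gauss_add[symmetric] by (simp add: mult_ac)
  also have "fps_nth \<dots> m = (\<Sum>d\<le>m. fps_nth (fps_gauss (x\<^sup>2) * F) d * fps_nth (fps_gauss (y\<^sup>2) * G) (m - d))"
    by (simp add: fps_mult_nth atMost_atLeast0)
  also have "\<dots> = (\<Sum>d\<le>m. if d = p then x ^ p * y ^ q else 0)"
  proof (intro sum.cong refl)
    fix d assume "d \<in> {..m}"
    then have d: "d \<le> m" by simp
    show "fps_nth (fps_gauss (x\<^sup>2) * F) d * fps_nth (fps_gauss (y\<^sup>2) * G) (m - d) = (if d = p then x ^ p * y ^ q else 0)"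
    proof (cases "p \<le> d")
      case True
      have "fps_nth (fps_gauss (x\<^sup>2) * F) d = (if d = p then 1 else 0) * x ^ d"
        unfolding F_def one gauss_mom_coeff[OF \<alpha> True] ..
      moreover have "fps_nth (fps_gauss (y\<^sup>2) * G) (m - d) = 1 * y ^ q" if "d = p"
      proof -
        have q: "m - d = q" using m that by simp
        show ?thesis unfolding G_def one q gauss_mom_coeff[OF \<beta> order_refl] by simp
      qed
      ultimately show ?thesis by auto
    next
      case False
      \<comment> \<open>For d < p the complementary index exceeds q, so the second factor
        vanishes.\<close>
      then have "q \<le> m - d" "m - d \<noteq> q" using m d by auto
      then have "fps_nth (fps_gauss (y\<^sup>2) * G) (m - d) = 0"
        unfolding G_def one gauss_mom_coeff[OF \<beta> \<open>q \<le> m - d\<close>] by simp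
      then show ?thesis using False by auto
    qed
  qed
  also have "\<dots> = x ^ p * y ^ q" using m by simp
  finally show ?thesis .
qed

text \<open>The case distinction is needed since \<open>0 powr 0 = 0\<close>.\<close>

locale kernel_weight = dunkl_weight +
  fixes k :: nat and \<alpha> \<beta> :: real
  assumes k_pos: "k \<ge> 1" and \<alpha>_pos: "\<alpha> > 0" and \<beta>_nonneg: "\<beta> \<ge> 0"
    and W_eq: "\<And>\<theta>. ups (cis \<theta>) = \<bar>sin (real k * \<theta>)\<bar> powr (2 * \<alpha>) * (if \<beta> = 0 then 1 else \<bar>cos (real k * \<theta>)\<bar> powr (2 * \<beta>))"
begin

section \<open>Symmetries and moments of the weight\<close>

lemma cis_power: "cis \<theta> ^ k = cis (real k * \<theta>)"
  by (rule Complex.DeMoivre)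

lemma k_real: "real k > 0" using k_pos by simp

lemma W_shift: "W (pi / real k + \<theta>) = W \<theta>" "W (pi / real k - \<theta>) = W \<theta>" "W (0 - \<theta>) = W \<theta>"
proof -
  have 1: "real k * (pi / real k + \<theta>) = real k * \<theta> + pi" "real k * (pi / real k - \<theta>) = pi - real k * \<theta>" "real k * (0 - \<theta>) = - (real k * \<theta>)"
    using k_real by (simp_all add: field_simps)
  show "W (pi / real k + \<theta>) = W \<theta>" "W (pi / real k - \<theta>) = W \<theta>" "W (0 - \<theta>) = W \<theta>"
    unfolding W_eq 1 by simp_all
qed

lemma circ_int_rot:
  assumes f: "continuous_on UNIV f"
  shows "circ_int (\<lambda>z. f (cis (pi / real k) * z)) = circ_int f"
proof -
  have "((\<lambda>\<theta>. f (cis (\<theta> + pi / real k)) * of_real (W (\<theta> + pi / real k))) has_integral circ_int f) {0..2 * pi}"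
    by (rule has_integral_periodic_shift[OF _ circ_int_has_integral[OF f]]) (simp_all add: cis_periodic)
  then show ?thesis unfolding add.commute[of _ "pi / real k"] W_shift circ_int_def[of "\<lambda>z. f (cis (pi / real k) * z)"] cis_mult
    by (rule integral_unique)
qed

lemma circ_int_rot_cnj:
  assumes f: "continuous_on UNIV f" and W: "\<And>\<theta>. W (c - \<theta>) = W \<theta>"
  shows "circ_int (\<lambda>z. f (cis c * cnj z)) = circ_int f"
proof -
  have "((\<lambda>\<theta>. f (cis (c - \<theta>)) * of_real (W (c - \<theta>))) has_integral circ_int f) {0..2 * pi}"
    by (rule has_integral_periodic_reflect[OF _ circ_int_has_integral[OF f]]) (simp_all add: cis_periodic)
  then have "((\<lambda>\<theta>. f (cis (c - \<theta>)) * of_real (W \<theta>)) has_integral circ_int f) {0..2 * pi}" unfolding W .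
  then show ?thesis unfolding circ_int_def[of "\<lambda>z. f (cis c * cnj z)"] cis_cnj cis_mult diff_conv_add_uminus
    by (rule integral_unique)
qed

definition moment :: "nat \<Rightarrow> nat \<Rightarrow> complex" where
  "moment p q = circ_int (\<lambda>z. of_real (Im (z ^ k) ^ p * Re (z ^ k) ^ q))"

lemma moment_continuous: "continuous_on UNIV (\<lambda>z. complex_of_real (Im (z ^ k) ^ p * Re (z ^ k) ^ q))"
  by (intro continuous_intros)

text \<open>Conjugation negates the imaginary part of z^k, and z -> cis (pi/k) cnj z negates its
  real part; both preserve the weight.\<close>

lemma moment_odd:
  assumes "odd p \<or> odd q"
  shows "moment p q = 0"
proof -
  let ?f = "\<lambda>z. complex_of_real (Im (z ^ k) ^ p * Re (z ^ k) ^ q)"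
  have "moment p q = - moment p q"
  proof (cases "odd p")
    case True
    have "circ_int ?f = circ_int (\<lambda>z. ?f (cis 0 * cnj z))"
      by (rule circ_int_rot_cnj[OF moment_continuous W_shift(3), symmetric])
    also have "\<dots> = circ_int (\<lambda>z. (- 1) * ?f z)"
      using True by (simp add: power_mult_distrib flip: complex_cnj_power)
    also have "\<dots> = - 1 * circ_int ?f" by (rule circ_int_cmult[OF moment_continuous])
    finally show ?thesis by (simp add: moment_def)
  next
    case False
    then have q: "odd q" using assms by simp
    have p: "cis (pi / real k) ^ k = - 1" using k_real by (simp add: Complex.DeMoivre)
    have "circ_int ?f = circ_int (\<lambda>z. ?f (cis (pi / real k) * cnj z))"
      by (rule circ_int_rot_cnj[OF moment_continuous W_shift(2), symmetric])
    also have "\<dots> = circ_int (\<lambda>z. (- 1) * ?f z)"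
      using q by (simp add: power_mult_distrib p flip: complex_cnj_power)
    also have "\<dots> = - 1 * circ_int ?f" by (rule circ_int_cmult[OF moment_continuous])
    finally show ?thesis by (simp add: moment_def)
  qed
  then show ?thesis by simp
qed

lemma moment_add: "moment (2 * a + 2) (2 * b) + moment (2 * a) (2 * b + 2) = moment (2 * a) (2 * b)"
proof -
  have "moment (2 * a + 2) (2 * b) + moment (2 * a) (2 * b + 2) = circ_int (\<lambda>z. of_real (Im (z ^ k) ^ (2 * a + 2) * Re (z ^ k) ^ (2 * b)) + of_real (Im (z ^ k) ^ (2 * a) * Re (z ^ k) ^ (2 * b + 2)))"
    unfolding moment_def by (rule circ_int_add[symmetric]; rule moment_continuous)
  also have "\<dots> = moment (2 * a) (2 * b)"
    unfolding moment_def
  proof (rule circ_int_cong)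
    fix \<theta>
    let ?s = "sin (real k * \<theta>)" and ?c = "cos (real k * \<theta>)"
    have "?s ^ (2 * a + 2) * ?c ^ (2 * b) + ?s ^ (2 * a) * ?c ^ (2 * b + 2) = ?s ^ (2 * a) * ?c ^ (2 * b) * (?s\<^sup>2 + ?c\<^sup>2)"
      by (simp only: power_add distrib_left mult_ac)
    then show "complex_of_real (Im (cis \<theta> ^ k) ^ (2 * a + 2) * Re (cis \<theta> ^ k) ^ (2 * b)) + of_real (Im (cis \<theta> ^ k) ^ (2 * a) * Re (cis \<theta> ^ k) ^ (2 * b + 2))
       = of_real (Im (cis \<theta> ^ k) ^ (2 * a) * Re (cis \<theta> ^ k) ^ (2 * b))"
      unfolding cis_power of_real_add[symmetric] by simp
  qed
  finally show ?thesis .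
qed

text \<open>The derivative of s^(2a+1) c^(2b+1) W integrates to 0 over a period, s and c being sine
  and cosine of k \<theta>. Together with s^2 + c^2 = 1 this reduces every even moment to the total
  mass.\<close>

lemma moment_rec: "of_real (2 * \<alpha> + 1 + 2 * real a) * moment (2 * a) (2 * b + 2) = of_real (2 * \<beta> + 1 + 2 * real b) * moment (2 * a + 2) (2 * b)"
proof -
  let ?s = "\<lambda>\<theta>. sin (real k * \<theta>)" and ?c = "\<lambda>\<theta>. cos (real k * \<theta>)"
  \<comment> \<open>At the zeros of s and c the weight need not be differentiable. There are
    finitely many, the cosine being a shifted sine.\<close>
  define S where "S = {\<theta> \<in> {0..2 * pi}. ?s \<theta> = 0 \<or> ?c \<theta> = 0}"
  have fin: "finite S"
  proof -
    have "S \<subseteq> (\<lambda>x. x / real k) ` ({x \<in> {0..real k * (2 * pi)}. sin (x - 0) = 0} \<union> {x \<in> {0..real k * (2 * pi)}. sin (x - (- (pi / 2))) = 0})"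
    proof
      fix \<theta> assume "\<theta> \<in> S"
      then have "real k * \<theta> \<in> {x \<in> {0..real k * (2 * pi)}. sin (x - 0) = 0} \<union> {x \<in> {0..real k * (2 * pi)}. sin (x - (- (pi / 2))) = 0}"
        using k_real by (auto simp: S_def sin_add)
      then show "\<theta> \<in> (\<lambda>x. x / real k) ` ({x \<in> {0..real k * (2 * pi)}. sin (x - 0) = 0} \<union> {x \<in> {0..real k * (2 * pi)}. sin (x - (- (pi / 2))) = 0})"
        using k_real by (intro image_eqI[of _ _ "real k * \<theta>"]) auto
    qed
    then show ?thesis by (rule finite_subset) (intro finite_imageI finite_UnI finite_sin_zeros)
  qed
  let ?P = "\<lambda>\<theta>. ?s \<theta> ^ (2 * a + 1) * ?c \<theta> ^ (2 * b + 1)"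
  let ?D = "\<lambda>\<theta>. real k * ((2 * \<alpha> + 1 + 2 * real a) * (?s \<theta> ^ (2 * a) * ?c \<theta> ^ (2 * b + 2)) - (2 * \<beta> + 1 + 2 * real b) * (?s \<theta> ^ (2 * a + 2) * ?c \<theta> ^ (2 * b))) * W \<theta>"
  have "(?D has_integral (?P (2 * pi) * W (2 * pi) - ?P 0 * W 0)) {0..2 * pi}"
  proof (rule fundamental_theorem_of_calculus_interior_strong[OF fin])
    show "continuous_on {0..2 * pi} (\<lambda>\<theta>. ?P \<theta> * W \<theta>)" by (intro continuous_intros W_continuous)
    fix x assume "x \<in> {0<..<2 * pi} - S"
    then have nz: "?s x \<noteq> 0" "?c x \<noteq> 0" by (auto simp: S_def)
    have lin: "((\<lambda>x. real k * x) has_real_derivative real k) (at x)" "((\<lambda>x. real k * x + pi / 2) has_real_derivative real k) (at x)"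
      by (auto intro!: derivative_eq_intros)
    have d1: "((\<lambda>x. \<bar>?s x\<bar> powr (2 * \<alpha>)) has_real_derivative (2 * \<alpha> * (?c x / ?s x) * \<bar>?s x\<bar> powr (2 * \<alpha>)) * real k) (at x)"
      using DERIV_chain2[OF DERIV_abs_sin_powr[OF nz(1), of "2 * \<alpha>"] lin(1)] by (simp only: cot_def)
    have d2: "((\<lambda>x. if \<beta> = 0 then 1 else \<bar>?c x\<bar> powr (2 * \<beta>)) has_real_derivative (2 * \<beta> * (- ?s x / ?c x) * (if \<beta> = 0 then 1 else \<bar>?c x\<bar> powr (2 * \<beta>))) * real k) (at x)"
    proof (cases "\<beta> = 0")
      case False
      have sc: "sin (y + pi / 2) = cos y" "cos (y + pi / 2) = - sin y" for y :: real by (simp_all add: sin_add cos_add)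
      have nz2: "sin (real k * x + pi / 2) \<noteq> 0" unfolding sc by (rule nz(2))
      show ?thesis using False DERIV_chain2[OF DERIV_abs_sin_powr[OF nz2, of "2 * \<beta>"] lin(2)] by (simp add: cot_def sc)
    qed simp
    have dW: "(W has_real_derivative (2 * \<alpha> * (?c x / ?s x) - 2 * \<beta> * (?s x / ?c x)) * real k * W x) (at x)"
      unfolding W_eq by (rule DERIV_cong[OF DERIV_mult[OF d1 d2]]) (simp add: algebra_simps)
    have dP: "(?P has_real_derivative real k * ((real (2 * a + 1)) * (?s x ^ (2 * a) * ?c x) * ?c x ^ (2 * b + 1) - (real (2 * b + 1)) * (?c x ^ (2 * b) * ?s x) * ?s x ^ (2 * a + 1))) (at x)"
      by (rule derivative_eq_intros lin(1) refl | simp)+ (simp add: algebra_simps)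
    have "((\<lambda>\<theta>. ?P \<theta> * W \<theta>) has_real_derivative ?D x) (at x)"
    proof (rule DERIV_cong[OF DERIV_mult[OF dP dW]])
      have 1: "?P x * (?c x / ?s x) = ?s x ^ (2 * a) * ?c x ^ (2 * b + 2)" using nz by (simp add: field_simps)
      have 2: "?P x * (?s x / ?c x) = ?s x ^ (2 * a + 2) * ?c x ^ (2 * b)" using nz by (simp add: field_simps)
      have 3: "?P x * ((2 * \<alpha> * (?c x / ?s x) - 2 * \<beta> * (?s x / ?c x)) * real k * W x) = (2 * \<alpha> * (?P x * (?c x / ?s x)) - 2 * \<beta> * (?P x * (?s x / ?c x))) * real k * W x"
        by (simp only: algebra_simps)
      show "real k * ((real (2 * a + 1)) * (?s x ^ (2 * a) * ?c x) * ?c x ^ (2 * b + 1) - (real (2 * b + 1)) * (?c x ^ (2 * b) * ?s x) * ?s x ^ (2 * a + 1)) * W x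
          + (2 * \<alpha> * (?c x / ?s x) - 2 * \<beta> * (?s x / ?c x)) * real k * W x * ?P x = ?D x"
        unfolding mult.commute[of _ "?P x"] 3 1 2 by (simp add: algebra_simps power_add power2_eq_square)
    qed
    then show "((\<lambda>\<theta>. ?P \<theta> * W \<theta>) has_vector_derivative ?D x) (at x)"
      by (simp only: has_real_derivative_iff_has_vector_derivative)
  qed simp
  moreover have "?P (2 * pi) * W (2 * pi) - ?P 0 * W 0 = 0"
  proof -
    have "sin (real k * (2 * pi)) = 0" using sin_int_2pin[of "int k"] by (simp add: mult_ac)
    then show ?thesis by simp
  qed
  ultimately have "(?D has_integral 0) {0..2 * pi}" by (simp only:)
  from has_integral_linear[OF this bounded_linear_of_real[where ?'a = complex]]
  have I: "((\<lambda>\<theta>. complex_of_real (?D \<theta>)) has_integral 0) {0..2 * pi}" by (simp only: o_def of_real_0)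
  let ?f = "\<lambda>z. complex_of_real (real k * (2 * \<alpha> + 1 + 2 * real a)) * of_real (Im (z ^ k) ^ (2 * a) * Re (z ^ k) ^ (2 * b + 2))"
  let ?g = "\<lambda>z. complex_of_real (real k * (2 * \<beta> + 1 + 2 * real b)) * of_real (Im (z ^ k) ^ (2 * a + 2) * Re (z ^ k) ^ (2 * b))"
  have "complex_of_real (?D \<theta>) = (?f (cis \<theta>) - ?g (cis \<theta>)) * of_real (W \<theta>)" for \<theta>
    unfolding cis_power cis.sel of_real_mult[symmetric] of_real_diff[symmetric] of_real_eq_iff by (simp only: algebra_simps)
  then have "((\<lambda>\<theta>. (?f (cis \<theta>) - ?g (cis \<theta>)) * of_real (W \<theta>)) has_integral 0) {0..2 * pi}" using I by (simp only:)
  then have "circ_int (\<lambda>z. ?f z - ?g z) = 0" unfolding circ_int_def by (rule integral_unique)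
  moreover have "continuous_on UNIV ?f" "continuous_on UNIV ?g" by (intro continuous_on_mult_left moment_continuous)+
  ultimately have "circ_int ?f - circ_int ?g = 0" by (simp only: circ_int_diff)
  moreover have "circ_int ?f = of_real (real k * (2 * \<alpha> + 1 + 2 * real a)) * moment (2 * a) (2 * b + 2)"
    unfolding moment_def by (rule circ_int_cmult[OF moment_continuous])
  moreover have "circ_int ?g = of_real (real k * (2 * \<beta> + 1 + 2 * real b)) * moment (2 * a + 2) (2 * b)"
    unfolding moment_def by (rule circ_int_cmult[OF moment_continuous])
  ultimately have "of_real (real k) * (of_real (2 * \<alpha> + 1 + 2 * real a) * moment (2 * a) (2 * b + 2)) = of_real (real k) * (of_real (2 * \<beta> + 1 + 2 * real b) * moment (2 * a + 2) (2 * b))"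
    by (simp only: of_real_mult mult.assoc) simp
  then show ?thesis using k_real by (simp only: mult_cancel_left) simp
qed

definition mass :: complex where "mass = moment 0 0"

text \<open>Two linear equations for two moments: \<open>moment_add\<close> gives their sum and
  \<open>moment_rec\<close> their ratio.\<close>

lemma moment_step:
  "moment (2 * a + 2) (2 * b) = of_real ((\<alpha> + 1 / 2 + real a) / (\<alpha> + \<beta> + 1 + real (a + b))) * moment (2 * a) (2 * b)"
  "moment (2 * a) (2 * b + 2) = of_real ((\<beta> + 1 / 2 + real b) / (\<alpha> + \<beta> + 1 + real (a + b))) * moment (2 * a) (2 * b)"
proof -
  define x y z where "x = moment (2 * a + 2) (2 * b)" and "y = moment (2 * a) (2 * b + 2)" and "z = moment (2 * a) (2 * b)"
  define A B where "A = complex_of_real (\<alpha> + 1 / 2 + real a)" and "B = complex_of_real (\<beta> + 1 / 2 + real b)"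
  have s: "x + y = z" unfolding x_def y_def z_def by (rule moment_add)
  have "of_real (2 * \<alpha> + 1 + 2 * real a) = 2 * A" "of_real (2 * \<beta> + 1 + 2 * real b) = 2 * B" by (simp_all add: A_def B_def)
  with moment_rec[of a b] have r: "A * y = B * x" unfolding x_def y_def by simp
  have AB: "A + B = of_real (\<alpha> + \<beta> + 1 + real (a + b))" by (simp add: A_def B_def)
  have "A + B \<noteq> 0" unfolding AB of_real_eq_0_iff using \<alpha>_pos \<beta>_nonneg by linarith
  moreover have "(A + B) * x = A * z" by (simp add: distrib_right distrib_left r flip: s)
  moreover have "(A + B) * y = B * z" by (simp add: distrib_right distrib_left r flip: s)
  ultimately have "x = A / (A + B) * z" "y = B / (A + B) * z" by (simp_all add: field_simps)
  then show "moment (2 * a + 2) (2 * b) = of_real ((\<alpha> + 1 / 2 + real a) / (\<alpha> + \<beta> + 1 + real (a + b))) * moment (2 * a) (2 * b)"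
    "moment (2 * a) (2 * b + 2) = of_real ((\<beta> + 1 / 2 + real b) / (\<alpha> + \<beta> + 1 + real (a + b))) * moment (2 * a) (2 * b)"
    unfolding x_def y_def z_def AB by (simp_all only: A_def B_def of_real_divide)
qed

text \<open>Under the normalised weight sin^2 (k \<theta>) has a Beta distribution with parameters
  \<alpha> + 1/2 and \<beta> + 1/2. Only the denominator couples a and b.\<close>

lemma moment_even:
  "moment (2 * a) (2 * b) = of_real (pochhammer (\<alpha> + 1 / 2) a * pochhammer (\<beta> + 1 / 2) b / pochhammer (\<alpha> + \<beta> + 1) (a + b)) * mass"
proof (induction a)
  case 0
  show ?case
  proof (induction b)
    case (Suc b)
    have "moment (2 * 0) (2 * Suc b) = of_real ((\<beta> + 1 / 2 + real b) / (\<alpha> + \<beta> + 1 + real (0 + b))) * moment (2 * 0) (2 * b)"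
      using moment_step(2)[of 0 b] by simp
    then show ?case unfolding Suc by (simp add: pochhammer_Suc mult_ac)
  qed (simp add: mass_def)
next
  case (Suc a)
  have "moment (2 * Suc a) (2 * b) = of_real ((\<alpha> + 1 / 2 + real a) / (\<alpha> + \<beta> + 1 + real (a + b))) * moment (2 * a) (2 * b)"
    using moment_step(1)[of a b] by simp
  then show ?case unfolding Suc by (simp add: pochhammer_Suc mult_ac)
qed

end

lemma homog_poly_comp_power:
  assumes "f \<in> homog_poly m"
  shows "(\<lambda>z. f (z ^ k)) \<in> homog_poly (m * k)"
proof -
  from assms obtain c where f: "\<And>z. f z = (\<Sum>a\<le>m. c a * z ^ a * cnj z ^ (m - a))"
    unfolding homog_poly_eq' hform_def by blast
  have "(\<lambda>z. c a * ((\<lambda>z. z ^ (k * a) * cnj z ^ (k * (m - a))) z)) \<in> homog_poly (m * k)" if "a \<le> m" for a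
  proof -
    have "k * a + k * (m - a) = m * k" using that by (simp add: diff_mult_distrib2 mult.commute)
    then show ?thesis unfolding homog_poly_eq' by (intro hform_cmult hform_monom)
  qed
  then have "(\<lambda>z. \<Sum>a\<le>m. c a * (z ^ (k * a) * cnj z ^ (k * (m - a)))) \<in> homog_poly (m * k)"
    by (intro homog_poly_sum) auto
  moreover have "(\<lambda>z. f (z ^ k)) = (\<lambda>z. \<Sum>a\<le>m. c a * (z ^ (k * a) * cnj z ^ (k * (m - a))))"
    unfolding f by (intro ext sum.cong refl) (simp add: power_mult mult.assoc)
  ultimately show ?thesis by (simp only:)
qed

lemma norm_square_homog: "(\<lambda>z. complex_of_real ((cmod z) ^ (2 * i))) \<in> homog_poly (2 * i)"
proof -
  have "(\<lambda>z. complex_of_real ((cmod z) ^ (2 * i))) = (\<lambda>z. z ^ i * cnj z ^ i)"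
  proof
    fix z
    have "complex_of_real ((cmod z) ^ (2 * i)) = (of_real ((cmod z)\<^sup>2)) ^ i" by (simp only: power_mult of_real_power)
    then show "complex_of_real ((cmod z) ^ (2 * i)) = z ^ i * cnj z ^ i" by (simp only: complex_norm_square power_mult_distrib)
  qed
  then show ?thesis unfolding homog_poly_eq' using hform_monom[of i i "2 * i" "\<lambda>z. z" cnj] by (simp add: mult_2)
qed

section \<open>The kernel of all homogeneous polynomials\<close>

context kernel_weight
begin

text \<open>\<open>Qker\<close> continued from the unit circle to a homogeneous polynomial in x: the
  powers of |x|^2 fill the terms of lower degree up to degree m.\<close>

definition Qpoly :: "nat \<Rightarrow> complex \<Rightarrow> complex \<Rightarrow> complex" where
  "Qpoly m x y = (\<Sum>i\<le>m div 2. \<Sum>a\<le>m - 2 * i.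
     of_real (gegen_coeff (\<alpha> + \<beta> + 1) m i * of_nat ((m - 2 * i) choose a) * mu_mom \<alpha> a * mu_mom \<beta> (m - 2 * i - a)
        * (Im y ^ a * Re y ^ (m - 2 * i - a)))
     * (of_real (cmod x ^ (2 * i)) * (of_real (Im x) ^ a * of_real (Re x) ^ (m - 2 * i - a))))"

lemma Qpoly_eq: "cmod x = 1 \<Longrightarrow> Qpoly m x y = of_real (Qker \<alpha> \<beta> m (Im x * Im y) (Re x * Re y))"
  unfolding Qpoly_def Qker_def by (simp add: sum_distrib_left power_mult_distrib mult_ac)

lemma Qpoly_homog: "(\<lambda>x. Qpoly m x y) \<in> homog_poly m"
  unfolding Qpoly_def
proof (intro homog_poly_sum)
  fix i a assume i: "i \<in> {..m div 2}" and a: "a \<in> {..m - 2 * i}"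
  have 1: "(\<lambda>x. complex_of_real (Im x) ^ a * complex_of_real (Re x) ^ (m - 2 * i - a)) \<in> homog_poly (m - 2 * i)"
    using hform_monom[of "m - 2 * i - a" a "m - 2 * i" cRe cIm] a unfolding homog_poly_eq by (simp add: mult.commute)
  have "2 * i + (m - 2 * i) = m" using i by auto
  with homog_poly_mult[OF norm_square_homog[of i] 1]
  have 2: "(\<lambda>x. complex_of_real (cmod x ^ (2 * i)) * (complex_of_real (Im x) ^ a * complex_of_real (Re x) ^ (m - 2 * i - a))) \<in> homog_poly m" by simp
  show "(\<lambda>x. complex_of_real (gegen_coeff (\<alpha> + \<beta> + 1) m i * of_nat ((m - 2 * i) choose a) * mu_mom \<alpha> a * mu_mom \<beta> (m - 2 * i - a) * (Im y ^ a * Re y ^ (m - 2 * i - a)))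
     * (of_real (cmod x ^ (2 * i)) * (of_real (Im x) ^ a * of_real (Re x) ^ (m - 2 * i - a)))) \<in> homog_poly m"
    by (rule homog_poly_cmult[OF 2])
qed

lemma cmod_cis_power: "cmod (cis \<theta> ^ n) = 1"
  by (simp add: norm_power)

text \<open>After expansion, the denominator (\<alpha> + \<beta> + 1)_(m-i) of each circle moment
  cancels the Pochhammer symbol of the Gegenbauer coefficient; this is what singles out the index
  \<alpha> + \<beta> + 1. The rest factors into one \<open>mom_coeff\<close> for \<alpha> and one
  for \<beta>, and \<open>reproducing_identity\<close> applies at (Im y, Re y).\<close>

lemma circ_int_Qpoly_monom:
  assumes y: "cmod y = 1" and m: "p + q = m"
  shows "circ_int (\<lambda>z. of_real (Im (z ^ k) ^ p * Re (z ^ k) ^ q) * Qpoly m (z ^ k) y) = of_real (Im y ^ p * Re y ^ q) * mass"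
proof -
  let ?c = "\<lambda>i a. gegen_coeff (\<alpha> + \<beta> + 1) m i * of_nat ((m - 2 * i) choose a) * mu_mom \<alpha> a * mu_mom \<beta> (m - 2 * i - a) * (Im y ^ a * Re y ^ (m - 2 * i - a))"
  let ?M = "\<lambda>p q z. complex_of_real (Im (z ^ k) ^ p * Re (z ^ k) ^ q)"
  have "circ_int (\<lambda>z. ?M p q z * Qpoly m (z ^ k) y) = circ_int (\<lambda>z. \<Sum>i\<le>m div 2. \<Sum>a\<le>m - 2 * i. of_real (?c i a) * ?M (p + a) (q + (m - 2 * i - a)) z)"
  proof (rule circ_int_cong)
    fix \<theta>
    show "?M p q (cis \<theta>) * Qpoly m (cis \<theta> ^ k) y = (\<Sum>i\<le>m div 2. \<Sum>a\<le>m - 2 * i. of_real (?c i a) * ?M (p + a) (q + (m - 2 * i - a)) (cis \<theta>))"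
      unfolding Qpoly_def cmod_cis_power power_one sum_distrib_left
      by (intro sum.cong refl) (simp only: power_add of_real_mult of_real_power of_real_1 mult_1_left mult_ac)
  qed
  also have "\<dots> = (\<Sum>i\<le>m div 2. \<Sum>a\<le>m - 2 * i. of_real (?c i a) * moment (p + a) (q + (m - 2 * i - a)))"
  proof -
    have c: "continuous_on UNIV (\<lambda>z. of_real (?c i a) * ?M p q z)" for i a p q
      by (intro continuous_on_mult_left moment_continuous)
    have "circ_int (\<lambda>z. \<Sum>i\<le>m div 2. \<Sum>a\<le>m - 2 * i. of_real (?c i a) * ?M (p + a) (q + (m - 2 * i - a)) z)
       = (\<Sum>i\<le>m div 2. circ_int (\<lambda>z. \<Sum>a\<le>m - 2 * i. of_real (?c i a) * ?M (p + a) (q + (m - 2 * i - a)) z))"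
      by (rule circ_int_sum) (intro continuous_on_sum c)
    also have "\<dots> = (\<Sum>i\<le>m div 2. \<Sum>a\<le>m - 2 * i. circ_int (\<lambda>z. of_real (?c i a) * ?M (p + a) (q + (m - 2 * i - a)) z))"
      by (intro sum.cong refl circ_int_sum c)
    also have "\<dots> = (\<Sum>i\<le>m div 2. \<Sum>a\<le>m - 2 * i. of_real (?c i a) * moment (p + a) (q + (m - 2 * i - a)))"
      unfolding moment_def by (intro sum.cong refl circ_int_cmult moment_continuous)
    finally show ?thesis .
  qed
  also have "\<dots> = (\<Sum>i\<le>m div 2. \<Sum>a\<le>m - 2 * i. of_real ((-1) ^ i / fact i * ((mom_coeff \<alpha> p a * Im y ^ a) * (mom_coeff \<beta> q (m - 2 * i - a) * Re y ^ (m - 2 * i - a)))) * mass)"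
  proof (intro sum.cong refl)
    fix i a assume "i \<in> {..m div 2}" and "a \<in> {..m - 2 * i}"
    then have i: "2 * i \<le> m" and a: "a \<le> m - 2 * i" by auto
    define b where "b = m - 2 * i - a"
    have ab: "p + a + (q + b) = 2 * (m - i)" "a + b = m - 2 * i" using i a m by (auto simp: b_def)
    show "of_real (?c i a) * moment (p + a) (q + (m - 2 * i - a)) = of_real ((-1) ^ i / fact i * ((mom_coeff \<alpha> p a * Im y ^ a) * (mom_coeff \<beta> q (m - 2 * i - a) * Re y ^ (m - 2 * i - a)))) * mass"
      unfolding b_def[symmetric]
    proof (cases "even (p + a)")
      case False
      then show "of_real (gegen_coeff (\<alpha> + \<beta> + 1) m i * of_nat ((m - 2 * i) choose a) * mu_mom \<alpha> a * mu_mom \<beta> b * (Im y ^ a * Re y ^ b)) * moment (p + a) (q + b)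
        = of_real ((-1) ^ i / fact i * ((mom_coeff \<alpha> p a * Im y ^ a) * (mom_coeff \<beta> q b * Re y ^ b))) * mass"
        by (simp add: moment_odd mom_coeff_def)
    next
      case True
      then obtain r where r: "p + a = 2 * r" by blast
      have "even (q + b)" using ab(1) True by (metis even_add even_mult_iff even_numeral)
      then obtain s where s: "q + b = 2 * s" by blast
      \<comment> \<open>The half-orders add up to exactly the length of the Pochhammer symbol in
        \<open>gegen_coeff\<close>.\<close>
      have rs: "r + s = m - i" using ab(1) r s by simp
      have ev: "moment (p + a) (q + b) = of_real (pochhammer (\<alpha> + 1 / 2) r * pochhammer (\<beta> + 1 / 2) s / pochhammer (\<alpha> + \<beta> + 1) (m - i)) * mass"
        unfolding r s moment_even rs ..
      have p0: "pochhammer (\<alpha> + \<beta> + 1) (m - i) > 0" using \<alpha>_pos \<beta>_nonneg by (intro pochhammer_pos) simp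
      have ch: "real ((m - 2 * i) choose a) = fact (m - 2 * i) / (fact a * fact b)"
        using binomial_fact[OF a, where 'a = real] by (simp add: b_def)
      have pw: "(2::real) ^ (m - 2 * i) = 2 ^ a * 2 ^ b" unfolding ab(2)[symmetric] by (rule power_add)
      have mc: "mom_coeff \<alpha> p a = 2 ^ a * mu_mom \<alpha> a / fact a * pochhammer (\<alpha> + 1 / 2) r" "mom_coeff \<beta> q b = 2 ^ b * mu_mom \<beta> b / fact b * pochhammer (\<beta> + 1 / 2) s"
        unfolding mom_coeff_def r s by simp_all
      have "(gegen_coeff (\<alpha> + \<beta> + 1) m i * of_nat ((m - 2 * i) choose a) * mu_mom \<alpha> a * mu_mom \<beta> b * (Im y ^ a * Re y ^ b)) * (pochhammer (\<alpha> + 1 / 2) r * pochhammer (\<beta> + 1 / 2) s / pochhammer (\<alpha> + \<beta> + 1) (m - i))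
         = (-1) ^ i / fact i * ((mom_coeff \<alpha> p a * Im y ^ a) * (mom_coeff \<beta> q b * Re y ^ b))"
        unfolding gegen_coeff_def ch pw mc using p0 by simp
      then show "of_real (gegen_coeff (\<alpha> + \<beta> + 1) m i * of_nat ((m - 2 * i) choose a) * mu_mom \<alpha> a * mu_mom \<beta> b * (Im y ^ a * Re y ^ b)) * moment (p + a) (q + b)
        = of_real ((-1) ^ i / fact i * ((mom_coeff \<alpha> p a * Im y ^ a) * (mom_coeff \<beta> q b * Re y ^ b))) * mass"
        unfolding ev mult.assoc[symmetric] of_real_mult[symmetric] by (simp only: mult.assoc)
    qed
  qed
  also have "\<dots> = of_real (\<Sum>i\<le>m div 2. (-1) ^ i / fact i * (\<Sum>a\<le>m - 2 * i. (mom_coeff \<alpha> p a * Im y ^ a) * (mom_coeff \<beta> q (m - 2 * i - a) * Re y ^ (m - 2 * i - a)))) * mass"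
    by (simp only: of_real_sum sum_distrib_left sum_distrib_right)
  also have "(\<Sum>i\<le>m div 2. (-1) ^ i / fact i * (\<Sum>a\<le>m - 2 * i. (mom_coeff \<alpha> p a * Im y ^ a) * (mom_coeff \<beta> q (m - 2 * i - a) * Re y ^ (m - 2 * i - a)))) = Im y ^ p * Re y ^ q"
  proof (rule reproducing_identity[OF _ \<beta>_nonneg _ m])
    show "\<alpha> \<ge> 0" using \<alpha>_pos by simp
    show "(Im y)\<^sup>2 + (Re y)\<^sup>2 = 1" using y cmod_power2[of y] by simp
  qed
  finally show ?thesis .
qed

lemma circ_int_Qpoly:
  assumes y: "cmod y = 1" and f: "f \<in> homog_poly m"
  shows "circ_int (\<lambda>z. f (z ^ k) * Qpoly m (z ^ k) y) = f y * mass"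
proof -
  from f obtain c where c: "\<And>z. f z = (\<Sum>a\<le>m. c a * of_real (Re z ^ a * Im z ^ (m - a)))"
    unfolding homog_poly_def by blast
  let ?F = "\<lambda>a z. of_real (Im (z ^ k) ^ (m - a) * Re (z ^ k) ^ a) * Qpoly m (z ^ k) y"
  have Qc: "continuous_on UNIV (\<lambda>z. Qpoly m (z ^ k) y)"
    by (rule homog_poly_continuous[OF homog_poly_comp_power[OF Qpoly_homog]])
  have Fc: "continuous_on UNIV (?F a)" for a
    by (intro continuous_on_mult moment_continuous Qc)
  have "circ_int (\<lambda>z. f (z ^ k) * Qpoly m (z ^ k) y) = circ_int (\<lambda>z. \<Sum>a\<le>m. c a * ?F a z)"
    unfolding c sum_distrib_right by (simp add: mult_ac)
  also have "\<dots> = (\<Sum>a\<le>m. circ_int (\<lambda>z. c a * ?F a z))"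
    by (rule circ_int_sum) (intro continuous_on_mult_left Fc)
  also have "\<dots> = (\<Sum>a\<le>m. c a * circ_int (?F a))"
    by (intro sum.cong refl circ_int_cmult Fc)
  also have "\<dots> = (\<Sum>a\<le>m. c a * (of_real (Im y ^ (m - a) * Re y ^ a) * mass))"
    by (intro sum.cong refl arg_cong2[where f = "(*)"] circ_int_Qpoly_monom[OF y]) auto
  also have "\<dots> = f y * mass" unfolding c sum_distrib_right by (simp add: mult_ac)
  finally show ?thesis .
qed

text \<open>On the circle, \<open>poly_kernel n\<close> reproduces all homogeneous polynomials of degree \<open>n\<close>. It is the coefficient
  of \<open>w\<close> to the power \<open>n\<close> in the product of the two geometric sums of \<open>w z cnj \<eta>\<close> and \<open>w cnj z \<eta>\<close> with \<open>k\<close> terms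
  and the series of the \<open>Qpoly m\<close> in powers of \<open>w ^ k\<close>. The summand with index \<open>i\<close> sees only the monomials
  \<open>z ^ a * cnj z ^ (n - a)\<close> with \<open>a mod k = i\<close>.\<close>

definition poly_kernel_term :: "nat \<Rightarrow> complex \<Rightarrow> nat \<Rightarrow> complex \<Rightarrow> complex" where
  "poly_kernel_term n \<eta> i z = (z * cnj \<eta>) ^ i * (cnj z * \<eta>) ^ ((n - i) mod k) * Qpoly ((n - i) div k) (z ^ k) (\<eta> ^ k)"

definition poly_kernel :: "nat \<Rightarrow> complex \<Rightarrow> complex \<Rightarrow> complex" where
  "poly_kernel n \<eta> z = (\<Sum>i | i < k \<and> i \<le> n. poly_kernel_term n \<eta> i z)"

lemma poly_kernel_term_homog:
  assumes "i \<le> n"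
  shows "poly_kernel_term n \<eta> i \<in> homog_poly n"
proof -
  let ?r = "(n - i) mod k" and ?m = "(n - i) div k"
  have "(\<lambda>z. z ^ i * cnj z ^ ?r) \<in> homog_poly (i + ?r)" unfolding homog_poly_eq' by (rule hform_monom) simp
  from homog_poly_cmult[OF homog_poly_mult[OF this homog_poly_comp_power[OF Qpoly_homog, of ?m k "\<eta> ^ k"]], of "cnj \<eta> ^ i * \<eta> ^ ?r"]
  have "(\<lambda>z. cnj \<eta> ^ i * \<eta> ^ ?r * (z ^ i * cnj z ^ ?r * Qpoly ?m (z ^ k) (\<eta> ^ k))) \<in> homog_poly (i + ?r + ?m * k)" .
  moreover have "i + ?r + ?m * k = n" using assms by simp
  moreover have "poly_kernel_term n \<eta> i = (\<lambda>z. cnj \<eta> ^ i * \<eta> ^ ?r * (z ^ i * cnj z ^ ?r * Qpoly ?m (z ^ k) (\<eta> ^ k)))"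
    unfolding poly_kernel_term_def by (rule ext) (simp add: power_mult_distrib mult_ac)
  ultimately show ?thesis by (simp only:)
qed

lemma poly_kernel_homog: "poly_kernel n \<eta> \<in> homog_poly n"
  unfolding poly_kernel_def[abs_def] by (intro homog_poly_sum poly_kernel_term_homog) auto

lemma Qpoly_neg: "Qpoly m (- x) y = (-1) ^ m * Qpoly m x y"
  using homog_poly_scale[OF Qpoly_homog, where r = "- 1" and z = x] by simp

lemma Qpoly_cnj: "cnj (Qpoly m x y) = Qpoly m x y"
  by (simp add: Qpoly_def)

lemma unit_cnj: "cmod \<eta> = 1 \<Longrightarrow> \<eta> * cnj \<eta> = 1"
  using complex_norm_square[of \<eta>] by simp

text \<open>If i = a mod k, leftover powers of z pair with conjugate ones to 1 on the circle, and a
  function of z^k remains, to which \<open>circ_int_Qpoly\<close> applies. Otherwise a rotation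
  preserving the weight multiplies the integrand by a number other than 1.\<close>

lemma circ_int_poly_kernel_term:
  assumes \<eta>: "cmod \<eta> = 1" and a: "a \<le> n" and i: "i < k" "i \<le> n"
  shows "circ_int (\<lambda>z. (z ^ a * cnj z ^ (n - a)) * cnj (poly_kernel_term n \<eta> i z)) = (if i = a mod k then \<eta> ^ a * cnj \<eta> ^ (n - a) * mass else 0)"
proof -
  define r where "r = (n - i) mod k"
  define m where "m = (n - i) div k"
  have nrm: "n - i = k * m + r" by (simp add: r_def m_def)
  have tm_eq: "cnj (poly_kernel_term n \<eta> i z) = (\<eta> ^ i * cnj \<eta> ^ r) * (cnj z ^ i * z ^ r * Qpoly m (z ^ k) (\<eta> ^ k))" for z
    unfolding poly_kernel_term_def r_def[symmetric] m_def[symmetric] by (simp add: Qpoly_cnj power_mult_distrib mult_ac)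
  define H where "H = (\<lambda>z. z ^ a * cnj z ^ (n - a) * (cnj z ^ i * z ^ r * Qpoly m (z ^ k) (\<eta> ^ k)))"
  have Qc: "continuous_on UNIV (\<lambda>z. Qpoly m (z ^ k) (\<eta> ^ k))"
    by (rule homog_poly_continuous[OF homog_poly_comp_power[OF Qpoly_homog]])
  have Hc: "continuous_on UNIV H" unfolding H_def by (intro continuous_intros Qc)
  have "circ_int (\<lambda>z. (z ^ a * cnj z ^ (n - a)) * cnj (poly_kernel_term n \<eta> i z)) = circ_int (\<lambda>z. (\<eta> ^ i * cnj \<eta> ^ r) * H z)"
    unfolding tm_eq H_def by (simp only: mult.left_commute)
  also have "\<dots> = (\<eta> ^ i * cnj \<eta> ^ r) * circ_int H" by (rule circ_int_cmult[OF Hc])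
  finally have 1: "circ_int (\<lambda>z. (z ^ a * cnj z ^ (n - a)) * cnj (poly_kernel_term n \<eta> i z)) = (\<eta> ^ i * cnj \<eta> ^ r) * circ_int H" .
  show ?thesis
  proof (cases "i = a mod k")
    case True
    define t where "t = a div k"
    have at: "a = k * t + i" unfolding t_def True by simp
    \<comment> \<open>This secures t \<le> m, so that m - t is a genuine exponent: a \<le> n bounds
      k t by k m + r, and r < k.\<close>
    have "k * t \<le> k * m + r" using at a nrm i by linarith
    moreover have "r < k" using k_pos by (simp add: r_def)
    ultimately have "k * t < k * (m + 1)" by simp
    then have "t < m + 1" unfolding nat_mult_less_cancel_disj by (rule conjunct2)
    then have tm: "t \<le> m" by simp
    have na: "n - a = k * (m - t) + r" using at a nrm i tm by (simp add: diff_mult_distrib2)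
    have "circ_int H = circ_int (\<lambda>z. (\<lambda>x. x ^ t * cnj x ^ (m - t)) (z ^ k) * Qpoly m (z ^ k) (\<eta> ^ k))"
    proof (rule circ_int_cong)
      fix \<theta>
      let ?z = "cis \<theta>"
      have u: "?z * cnj ?z = 1" by (rule unit_cnj) simp
      have "?z ^ a * cnj ?z ^ (n - a) * (cnj ?z ^ i * ?z ^ r) = ((?z ^ k) ^ t * cnj (?z ^ k) ^ (m - t)) * ((?z * cnj ?z) ^ i * (?z * cnj ?z) ^ r)"
        unfolding na unfolding at by (simp only: power_add power_mult power_mult_distrib complex_cnj_power mult_ac)
      then show "H ?z = (\<lambda>x. x ^ t * cnj x ^ (m - t)) (?z ^ k) * Qpoly m (?z ^ k) (\<eta> ^ k)"
        unfolding H_def u by (simp only: power_one mult_1_right mult.assoc[symmetric])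
    qed
    also have "\<dots> = (\<eta> ^ k) ^ t * cnj (\<eta> ^ k) ^ (m - t) * mass"
    proof (rule circ_int_Qpoly)
      show "cmod (\<eta> ^ k) = 1" using \<eta> by (simp add: norm_power)
      show "(\<lambda>x. x ^ t * cnj x ^ (m - t)) \<in> homog_poly m" unfolding homog_poly_eq' by (rule hform_monom) (use tm in simp)
    qed
    finally have lH: "circ_int H = (\<eta> ^ k) ^ t * cnj (\<eta> ^ k) ^ (m - t) * mass" .
    have "(\<eta> ^ i * cnj \<eta> ^ r) * circ_int H = \<eta> ^ a * cnj \<eta> ^ (n - a) * mass"
      unfolding lH na unfolding at by (simp only: power_add power_mult complex_cnj_power mult_ac)
    then show ?thesis unfolding 1 using True by simp
  next
    case False
    \<comment> \<open>Rotation by 2 pi/k would give the factor cis (4 pi (a - i)/k), which is 1 when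
      a - i = k/2. Half of it separates all residues. It negates z^k, whence (-1)^m by the parity of
      \<open>Qpoly m\<close>.\<close>
    let ?\<rho> = "cis (pi / real k)"
    let ?c = "?\<rho> ^ a * cnj ?\<rho> ^ (n - a) * (cnj ?\<rho> ^ i * ?\<rho> ^ r * (-1) ^ m)"
    have \<rho>k: "?\<rho> ^ k = - 1" using k_real by (simp add: Complex.DeMoivre)
    have "H (?\<rho> * z) = ?c * H z" for z
    proof -
      have "(?\<rho> * z) ^ k = - (z ^ k)" by (simp add: power_mult_distrib \<rho>k)
      then show ?thesis unfolding H_def by (simp add: Qpoly_neg power_mult_distrib mult_ac)
    qed
    then have "circ_int H = circ_int (\<lambda>z. ?c * H z)" using circ_int_rot[OF Hc] by simp
    also have "\<dots> = ?c * circ_int H" by (rule circ_int_cmult[OF Hc])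
    finally have e: "circ_int H = ?c * circ_int H" .
    have "?c = cis (2 * pi * (real a - real i) / real k)"
    proof -
      have "(-1::complex) ^ m = ?\<rho> ^ (k * m)" by (simp only: power_mult \<rho>k)
      then have "?c = cis (real a * (pi / real k)) * cis (real (n - a) * (- (pi / real k))) * (cis (real i * (- (pi / real k))) * cis (real r * (pi / real k)) * cis (real (k * m) * (pi / real k)))"
        by (simp only: cis_cnj Complex.DeMoivre)
      also have "\<dots> = cis ((real a - real (n - a) - real i + real r + real (k * m)) * (pi / real k))"
        unfolding cis_mult by (rule arg_cong[where f = cis]) (simp add: algebra_simps)
      also have "real a - real (n - a) - real i + real r + real (k * m) = 2 * (real a - real i)"
      proof -
        have "real (n - i) = real (k * m) + real r" unfolding nrm by simp
        then show ?thesis using a i by (simp add: of_nat_diff)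
      qed
      also have "2 * (real a - real i) * (pi / real k) = 2 * pi * (real a - real i) / real k" by simp
      finally show ?thesis .
    qed
    moreover have "cis (2 * pi * (real a - real i) / real k) \<noteq> 1"
    proof
      assume "cis (2 * pi * (real a - real i) / real k) = 1"
      then have "cos (2 * pi * (real a - real i) / real k) = 1" by (simp add: complex_eq_iff)
      then obtain l :: int where l: "2 * pi * (real a - real i) / real k = of_int l * 2 * pi"
        unfolding cos_one_2pi_int by blast
      have "real a - real i = (2 * pi * (real a - real i) / real k) * (real k / (2 * pi))" using k_real by simp
      also have "\<dots> = of_int l * real k" unfolding l by simp
      finally have "real a - real i = of_int l * real k" .
      then have "of_int (int a - int i) = (of_int (l * int k) :: real)" by simp
      then have "int a - int i = l * int k" by (simp only: of_int_eq_iff)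
      then have "int a mod int k = int i mod int k" by (metis diff_add_cancel mod_mult_self2 add.commute mult.commute)
      then have "a mod k = i mod k" by (metis zmod_int of_nat_eq_iff)
      then show False using False i by simp
    qed
    ultimately have "circ_int H = 0" using e by (metis mult_cancel_right1)
    then show ?thesis unfolding 1 using False by simp
  qed
qed

text \<open>The monomial with exponent a is reproduced by the single term i = a mod k, which is
  present in the sum since a mod k \<le> a \<le> n.\<close>

lemma circ_int_poly_kernel:
  assumes \<eta>: "cmod \<eta> = 1" and f: "f \<in> homog_poly n"
  shows "circ_int (\<lambda>z. f z * cnj (poly_kernel n \<eta> z)) = f \<eta> * mass"
proof -
  from f obtain c where c: "\<And>z. f z = (\<Sum>a\<le>n. c a * z ^ a * cnj z ^ (n - a))"
    unfolding homog_poly_eq' hform_def by blast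
  let ?I = "{i. i < k \<and> i \<le> n}"
  let ?F = "\<lambda>a i z. (z ^ a * cnj z ^ (n - a)) * cnj (poly_kernel_term n \<eta> i z)"
  have Fc: "continuous_on UNIV (?F a i)" if "i \<in> ?I" for a i
    by (intro continuous_intros homog_poly_continuous[OF poly_kernel_term_homog]) (use that in auto)
  have "circ_int (\<lambda>z. f z * cnj (poly_kernel n \<eta> z)) = circ_int (\<lambda>z. \<Sum>a\<le>n. c a * (\<Sum>i\<in>?I. ?F a i z))"
  proof (rule arg_cong[where f = circ_int], rule ext)
    fix z
    have "f z * cnj (poly_kernel n \<eta> z) = (\<Sum>a\<le>n. c a * (z ^ a * cnj z ^ (n - a) * cnj (poly_kernel n \<eta> z)))"
      unfolding c sum_distrib_right by (simp only: mult.assoc)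
    also have "\<dots> = (\<Sum>a\<le>n. c a * (\<Sum>i\<in>?I. ?F a i z))"
      unfolding poly_kernel_def cnj_sum sum_distrib_left ..
    finally show "f z * cnj (poly_kernel n \<eta> z) = (\<Sum>a\<le>n. c a * (\<Sum>i\<in>?I. ?F a i z))" .
  qed
  also have "\<dots> = (\<Sum>a\<le>n. circ_int (\<lambda>z. c a * (\<Sum>i\<in>?I. ?F a i z)))"
    by (rule circ_int_sum) (intro continuous_on_mult_left continuous_on_sum Fc)
  also have "\<dots> = (\<Sum>a\<le>n. c a * (\<Sum>i\<in>?I. circ_int (?F a i)))"
  proof (intro sum.cong refl)
    fix a
    have "circ_int (\<lambda>z. c a * (\<Sum>i\<in>?I. ?F a i z)) = c a * circ_int (\<lambda>z. \<Sum>i\<in>?I. ?F a i z)"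
      by (rule circ_int_cmult) (intro continuous_on_sum Fc)
    also have "circ_int (\<lambda>z. \<Sum>i\<in>?I. ?F a i z) = (\<Sum>i\<in>?I. circ_int (?F a i))" by (rule circ_int_sum[OF Fc])
    finally show "circ_int (\<lambda>z. c a * (\<Sum>i\<in>?I. ?F a i z)) = c a * (\<Sum>i\<in>?I. circ_int (?F a i))" .
  qed
  also have "\<dots> = (\<Sum>a\<le>n. c a * (\<eta> ^ a * cnj \<eta> ^ (n - a) * mass))"
  proof (intro sum.cong refl)
    fix a assume "a \<in> {..n}"
    then have a: "a \<le> n" by simp
    have "(\<Sum>i\<in>?I. circ_int (?F a i)) = (\<Sum>i\<in>?I. if i = a mod k then \<eta> ^ a * cnj \<eta> ^ (n - a) * mass else 0)"
      by (intro sum.cong refl circ_int_poly_kernel_term \<eta> a) auto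
    also have "\<dots> = \<eta> ^ a * cnj \<eta> ^ (n - a) * mass"
    proof -
      have "finite ?I" by simp
      moreover have "a mod k \<in> ?I" using k_pos a le_trans[OF mod_less_eq_dividend a] by simp
      ultimately show ?thesis by (simp add: sum.delta)
    qed
    finally show "c a * (\<Sum>i\<in>?I. circ_int (?F a i)) = c a * (\<eta> ^ a * cnj \<eta> ^ (n - a) * mass)" by simp
  qed
  also have "\<dots> = f \<eta> * mass" unfolding c sum_distrib_right by (simp add: mult_ac)
  finally show ?thesis .
qed

lemma circ_int_cnj:
  assumes "continuous_on UNIV f"
  shows "circ_int (\<lambda>z. cnj (f z)) = cnj (circ_int f)"
  using has_integral_linear[OF circ_int_has_integral[OF assms] bounded_linear_cnj]
  unfolding circ_int_def[of "\<lambda>z. cnj (f z)"] by (intro integral_unique) (simp add: o_def)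

lemma mass_eq: "mass = circ_int (\<lambda>_. 1)"
  by (simp add: mass_def moment_def)

lemma mass_nonzero: "mass \<noteq> 0"
proof
  assume "mass = 0"
  moreover have "(\<lambda>_. 1::complex) \<in> homog_poly 0" by (auto simp: homog_poly_def intro!: exI[of _ "\<lambda>_. 1"])
  ultimately have "(\<lambda>_::complex. 1::complex) = (\<lambda>_. 0)" by (intro circ_int_definite[of _ 0]) (simp_all add: mass_eq)
  then show False by (simp add: fun_eq_iff)
qed

section \<open>The reproducing kernel of the h-harmonics\<close>

text \<open>On the circle this is the difference of two kernels; the factor z * cnj z makes it
  homogeneous.\<close>

definition harm_kernel :: "nat \<Rightarrow> complex \<Rightarrow> complex \<Rightarrow> complex" where
  "harm_kernel n \<eta> z = poly_kernel n \<eta> z - (if n \<ge> 2 then (z * cnj z) * poly_kernel (n - 2) \<eta> z else 0)"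

lemma norm2_homog: "(\<lambda>z. z * cnj z) \<in> homog_poly 2"
  using hform_monom[of 1 1 2 "\<lambda>z. z" cnj] unfolding homog_poly_eq' by simp

lemma norm2_mult_homog:
  assumes "n \<ge> 2" "h \<in> homog_poly (n - 2)"
  shows "(\<lambda>z. (z * cnj z) * h z) \<in> homog_poly n"
proof -
  have "2 + (n - 2) = n" using assms by simp
  with homog_poly_mult[OF norm2_homog assms(2)] show ?thesis by simp
qed

lemma harm_kernel_homog: "harm_kernel n \<eta> \<in> homog_poly n"
proof (cases "n \<ge> 2")
  case True
  then have "harm_kernel n \<eta> = (\<lambda>z. poly_kernel n \<eta> z - (z * cnj z) * poly_kernel (n - 2) \<eta> z)" by (auto simp: harm_kernel_def)
  then show ?thesis using homog_poly_diff[OF poly_kernel_homog norm2_mult_homog[OF True poly_kernel_homog]] by (simp only:)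
next
  case False
  then have "harm_kernel n \<eta> = poly_kernel n \<eta>" by (auto simp: harm_kernel_def)
  then show ?thesis using poly_kernel_homog by (simp only:)
qed

lemmas poly_kernel_continuous = homog_poly_continuous[OF poly_kernel_homog]
lemmas harm_kernel_continuous = homog_poly_continuous[OF harm_kernel_homog]

lemma harm_kernel_cis: "harm_kernel n \<eta> (cis \<theta>) = poly_kernel n \<eta> (cis \<theta>) - (if n \<ge> 2 then poly_kernel (n - 2) \<eta> (cis \<theta>) else 0)"
  using unit_cnj[of "cis \<theta>"] by (simp add: harm_kernel_def)

lemma circ_int_mult_cnj_harm_kernel:
  assumes f: "continuous_on UNIV f"
  shows "circ_int (\<lambda>z. f z * cnj (harm_kernel n \<eta> z)) = circ_int (\<lambda>z. f z * cnj (poly_kernel n \<eta> z)) - (if n \<ge> 2 then circ_int (\<lambda>z. f z * cnj (poly_kernel (n - 2) \<eta> z)) else 0)"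
proof (cases "n \<ge> 2")
  case True
  have "circ_int (\<lambda>z. f z * cnj (harm_kernel n \<eta> z)) = circ_int (\<lambda>z. f z * cnj (poly_kernel n \<eta> z) - f z * cnj (poly_kernel (n - 2) \<eta> z))"
    by (rule circ_int_cong) (simp add: harm_kernel_cis True right_diff_distrib)
  also have "\<dots> = circ_int (\<lambda>z. f z * cnj (poly_kernel n \<eta> z)) - circ_int (\<lambda>z. f z * cnj (poly_kernel (n - 2) \<eta> z))"
    by (rule circ_int_diff) (intro continuous_intros f poly_kernel_continuous)+
  finally show ?thesis using True by simp
next
  case False
  have "circ_int (\<lambda>z. f z * cnj (harm_kernel n \<eta> z)) = circ_int (\<lambda>z. f z * cnj (poly_kernel n \<eta> z))"
    by (rule circ_int_cong) (simp add: harm_kernel_cis False)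
  then show ?thesis using False by simp
qed

text \<open>\<open>poly_kernel n\<close> reproduces f, and \<open>poly_kernel (n - 2)\<close>
  contributes 0 because f is orthogonal to lower degrees.\<close>

lemma harm_kernel_reproducing:
  assumes \<eta>: "cmod \<eta> = 1" and f: "f \<in> h_harm N kap n"
  shows "circ_int (\<lambda>z. f z * cnj (harm_kernel n \<eta> z)) = f \<eta> * mass"
proof -
  have fp: "f \<in> homog_poly n" using f by (simp add: h_harm_def)
  have "circ_int (\<lambda>z. f z * cnj (poly_kernel (n - 2) \<eta> z)) = 0" if "n \<ge> 2"
    by (rule h_harm_orth[OF f homog_poly_cnj[OF poly_kernel_homog]]) (use that in simp)
  then show ?thesis
    unfolding circ_int_mult_cnj_harm_kernel[OF homog_poly_continuous[OF fp]] circ_int_poly_kernel[OF \<eta> fp] by simp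
qed

text \<open>On the circle a polynomial f of degree n - 2 agrees with |z|^2 f of degree n. Both
  kernels therefore reproduce it at \<eta>, their difference is orthogonal to it, and
  \<open>orth_h_harm\<close> turns this into harmonicity.\<close>

lemma harm_kernel_harm:
  assumes \<eta>: "cmod \<eta> = 1"
  shows "harm_kernel n \<eta> \<in> h_harm N kap n"
proof (rule orth_h_harm[OF harm_kernel_homog])
  fix h assume n: "n \<ge> 2" and h: "h \<in> homog_poly (n - 2)"
  define f where "f = (\<lambda>z. cnj (h z))"
  have f: "f \<in> homog_poly (n - 2)" unfolding f_def by (rule homog_poly_cnj[OF h])
  note fc = homog_poly_continuous[OF f]
  have "circ_int (\<lambda>z. f z * cnj (poly_kernel n \<eta> z)) = circ_int (\<lambda>z. ((z * cnj z) * f z) * cnj (poly_kernel n \<eta> z))"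
    by (rule circ_int_cong) (use unit_cnj in simp)
  also have "\<dots> = f \<eta> * mass"
    using circ_int_poly_kernel[OF \<eta> norm2_mult_homog[OF n f]] unit_cnj[OF \<eta>] by simp
  finally have "circ_int (\<lambda>z. f z * cnj (harm_kernel n \<eta> z)) = 0"
    unfolding circ_int_mult_cnj_harm_kernel[OF fc] using n circ_int_poly_kernel[OF \<eta> f] by simp
  moreover have "circ_int (\<lambda>z. harm_kernel n \<eta> z * h z) = cnj (circ_int (\<lambda>z. f z * cnj (harm_kernel n \<eta> z)))"
  proof -
    have "continuous_on UNIV (\<lambda>z. f z * cnj (harm_kernel n \<eta> z))" by (intro continuous_intros fc harm_kernel_continuous)
    from circ_int_cnj[OF this] show ?thesis by (simp add: f_def mult.commute)
  qed
  ultimately show "circ_int (\<lambda>z. harm_kernel n \<eta> z * h z) = 0" by simp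
qed

lemma circ_ip_eq:
  assumes f: "continuous_on UNIV f" and g: "continuous_on UNIV g"
  shows "circ_ip ups f g = circ_int (\<lambda>z. f z * cnj (g z)) / mass"
proof -
  have "(LINT \<theta>:{0..2*pi}|lborel. f (cis \<theta>) * cnj (g (cis \<theta>)) * of_real (W \<theta>)) = circ_int (\<lambda>z. f z * cnj (g z))"
    unfolding circ_int_def
    by (intro set_borel_integral_eq_integral borel_integrable_atLeastAtMost' continuous_intros W_continuous continuous_on_cis_comp f g)
  moreover have "(LINT \<theta>:{0..2*pi}|lborel. W \<theta>) = integral {0..2 * pi} W"
    by (intro set_borel_integral_eq_integral borel_integrable_atLeastAtMost' W_continuous)
  moreover have "complex_of_real (integral {0..2 * pi} W) = mass"
  proof -
    have "(W has_integral integral {0..2 * pi} W) {0..2 * pi}"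
      by (intro integrable_integral integrable_continuous_real W_continuous)
    from has_integral_linear[OF this bounded_linear_of_real[where ?'a = complex]]
    show ?thesis unfolding mass_eq circ_int_def by (intro integral_unique[symmetric]) (simp add: o_def)
  qed
  ultimately show ?thesis unfolding circ_ip_def by (simp only:)
qed

text \<open>For uniqueness let q be the difference of two candidates. Both represent evaluation at
  \<eta>, so q is orthogonal to itself and vanishes. That q is h-harmonic is taken from
  orthogonality, which is plainly linear.\<close>

lemma repr_kernel_eq:
  assumes \<eta>: "cmod \<eta> = 1"
  shows "repr_kernel N kap ups n \<omega> \<eta> = harm_kernel n \<eta> \<omega>"
proof -
  have ip: "circ_ip ups f p = circ_int (\<lambda>z. f z * cnj (p z)) / mass" if "f \<in> h_harm N kap n" "p \<in> h_harm N kap n" for f p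
    by (rule circ_ip_eq; rule homog_poly_continuous[of _ n]) (use that in \<open>auto simp: h_harm_def\<close>)
  have "(THE p. p \<in> h_harm N kap n \<and> (\<forall>f \<in> h_harm N kap n. circ_ip ups f p = f \<eta>)) = harm_kernel n \<eta>"
  proof (rule the_equality)
    show "harm_kernel n \<eta> \<in> h_harm N kap n \<and> (\<forall>f \<in> h_harm N kap n. circ_ip ups f (harm_kernel n \<eta>) = f \<eta>)"
      using harm_kernel_harm[OF \<eta>] harm_kernel_reproducing[OF \<eta>] mass_nonzero by (simp add: ip)
  next
    fix p assume p: "p \<in> h_harm N kap n \<and> (\<forall>f \<in> h_harm N kap n. circ_ip ups f p = f \<eta>)"
    then have ph: "p \<in> h_harm N kap n" and pp: "p \<in> homog_poly n" by (simp_all add: h_harm_def)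
    note c = homog_poly_continuous[OF pp] homog_poly_continuous[OF harm_kernel_homog[of n \<eta>]]
    define q where "q = (\<lambda>z. p z - harm_kernel n \<eta> z)"
    have q: "q \<in> homog_poly n" unfolding q_def by (rule homog_poly_diff[OF pp harm_kernel_homog])
    note qc = homog_poly_continuous[OF q]
    have qh: "q \<in> h_harm N kap n"
    proof (rule orth_h_harm[OF q])
      fix h assume n: "n \<ge> 2" and h: "h \<in> homog_poly (n - 2)"
      have "circ_int (\<lambda>z. q z * h z) = circ_int (\<lambda>z. p z * h z - harm_kernel n \<eta> z * h z)"
        unfolding q_def by (simp only: left_diff_distrib)
      also have "\<dots> = circ_int (\<lambda>z. p z * h z) - circ_int (\<lambda>z. harm_kernel n \<eta> z * h z)"
        by (rule circ_int_diff) (intro continuous_intros c homog_poly_continuous[OF h])+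
      also have "\<dots> = 0" using h_harm_orth[OF ph h] h_harm_orth[OF harm_kernel_harm[OF \<eta>] h] n by simp
      finally show "circ_int (\<lambda>z. q z * h z) = 0" .
    qed
    have "circ_ip ups q p = q \<eta>" using p qh by blast
    then have "circ_int (\<lambda>z. q z * cnj (p z)) = q \<eta> * mass" unfolding ip[OF qh ph] using mass_nonzero by (simp add: field_simps)
    moreover have "circ_int (\<lambda>z. q z * cnj (q z)) = circ_int (\<lambda>z. q z * cnj (p z)) - circ_int (\<lambda>z. q z * cnj (harm_kernel n \<eta> z))"
    proof -
      have "circ_int (\<lambda>z. q z * cnj (q z)) = circ_int (\<lambda>z. q z * cnj (p z) - q z * cnj (harm_kernel n \<eta> z))"
        by (rule arg_cong[where f = circ_int]) (simp add: q_def right_diff_distrib)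
      also have "\<dots> = circ_int (\<lambda>z. q z * cnj (p z)) - circ_int (\<lambda>z. q z * cnj (harm_kernel n \<eta> z))"
        by (rule circ_int_diff) (intro continuous_intros c qc)+
      finally show ?thesis .
    qed
    ultimately have "circ_int (\<lambda>z. q z * cnj (q z)) = 0" using harm_kernel_reproducing[OF \<eta> qh] by simp
    from circ_int_definite[OF q this] show "p = harm_kernel n \<eta>" by (simp add: q_def fun_eq_iff)
  qed
  then show ?thesis unfolding repr_kernel_def by (simp only:)
qed

end

section \<open>Generating function and Laplace transform\<close>

text \<open>Twice a product is at most the sum of the squares. This keeps X(u, v) in
  [-1, 1].\<close>

lemma abs_Im_Re_mult_le_1:
  assumes "cmod x = 1" "cmod y = 1"
  shows "\<bar>Im x * Im y\<bar> + \<bar>Re x * Re y\<bar> \<le> 1"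
proof -
  have am: "2 * \<bar>a * b\<bar> \<le> a\<^sup>2 + b\<^sup>2" for a b :: real
    using sum_squares_bound[of "\<bar>a\<bar>" "\<bar>b\<bar>"] by (simp add: abs_mult)
  show ?thesis using am[of "Im x" "Im y"] am[of "Re x" "Re y"] cmod_power2[of x] cmod_power2[of y] assms by simp
qed

lemma sums_shift_right:
  fixes g :: "nat \<Rightarrow> 'a::real_normed_vector"
  assumes "g sums L"
  shows "(\<lambda>n. if i \<le> n then g (n - i) else 0) sums L"
  using sums_zero_iff_shift[of i "\<lambda>n. if i \<le> n then g (n - i) else 0" L] assms by simp

text \<open>Summation in blocks of indices n = m k + j with j < k: every block is the same geometric
  sum times one term of the series of \<open>G\<close>. Grouping is legitimate once the ungrouped
  series converges, and |w| \<le> 1/8 against the growth 4^m gives that.\<close>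

lemma div_mod_series:
  fixes w y :: complex
  assumes k: "k \<ge> 1" and y: "cmod y = 1" and w: "cmod w \<le> 1 / 8"
    and q: "\<And>m. cmod (q m) \<le> S * 4 ^ m" and G: "(\<lambda>m. q m * (w ^ k) ^ m) sums G"
  shows "(\<lambda>n. w ^ n * (y ^ (n mod k) * q (n div k))) sums ((\<Sum>j<k. (w * y) ^ j) * G)"
proof -
  let ?f = "\<lambda>n. w ^ n * (y ^ (n mod k) * q (n div k))"
  have S: "S \<ge> 0" using order_trans[OF norm_ge_zero q[of 0]] by simp
  have "cmod (?f n) \<le> S * (1 / 2) ^ n" for n
  proof -
    have "cmod (q (n div k)) \<le> S * 4 ^ n"
      by (rule order_trans[OF q]) (intro mult_left_mono power_increasing S div_le_dividend, simp)
    moreover have "cmod w ^ n \<le> (1 / 8) ^ n" using w by (intro power_mono) auto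
    ultimately have "cmod w ^ n * cmod (q (n div k)) \<le> (1 / 8) ^ n * (S * 4 ^ n)"
      by (intro mult_mono) auto
    also have "\<dots> = S * ((1 / 8) * 4) ^ n" by (simp only: power_mult_distrib mult_ac)
    finally show ?thesis by (simp add: norm_mult norm_power y)
  qed
  moreover have "summable (\<lambda>n. S * (1 / 2) ^ n)" by (intro summable_mult summable_geometric) simp
  ultimately have "summable ?f" by (intro summable_comparison_test'[of "\<lambda>n. S * (1 / 2) ^ n" 0 ?f]) auto
  then have f: "?f sums suminf ?f" by (rule summable_sums)
  have "(\<lambda>m. sum ?f {m * k..<m * k + k}) sums suminf ?f"
    by (rule sums_group[OF f]) (use k in simp)
  moreover have "sum ?f {m * k..<m * k + k} = (\<Sum>j<k. (w * y) ^ j) * (q m * (w ^ k) ^ m)" for m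
  proof -
    have "sum ?f {m * k..<m * k + k} = (\<Sum>j\<in>{0..<k}. ?f (j + m * k))"
      using sum.shift_bounds_nat_ivl[of ?f 0 "m * k" k] by (simp add: add.commute)
    also have "\<dots> = (\<Sum>j\<in>{0..<k}. (w * y) ^ j * (q m * (w ^ k) ^ m))"
    proof (rule sum.cong)
      fix j assume "j \<in> {0..<k}"
      then have "(j + m * k) mod k = j" "(j + m * k) div k = m" by auto
      moreover have "w ^ (j + m * k) = w ^ j * (w ^ k) ^ m" by (simp add: power_add power_mult[symmetric] mult.commute)
      ultimately show "?f (j + m * k) = (w * y) ^ j * (q m * (w ^ k) ^ m)"
        by (simp only: power_mult_distrib mult_ac)
    qed simp
    finally show ?thesis by (simp only: sum_distrib_right lessThan_atLeast0)
  qed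
  ultimately have "(\<lambda>m. (\<Sum>j<k. (w * y) ^ j) * (q m * (w ^ k) ^ m)) sums suminf ?f" by (simp only:)
  from sums_unique2[OF this sums_mult[OF G]] have "suminf ?f = (\<Sum>j<k. (w * y) ^ j) * G" .
  with f show ?thesis by (simp only:)
qed

text \<open>For |Z| = 1 the product (1 - W Z)(1 - W cnj Z) is 1 - 2 Re(Z) W + W^2. It is the
  denominator for w and \<zeta>, and the numerator for their k-th powers.\<close>

lemma geometric_product:
  assumes z: "cmod \<zeta> = 1" and w: "cmod w < 1"
  shows "(\<Sum>i<k. (w * \<zeta>) ^ i) * (\<Sum>j<k. (w * cnj \<zeta>) ^ j)
    = (1 - 2 * w ^ k * of_real (Re (\<zeta> ^ k)) + w ^ (2 * k)) / (1 - 2 * of_real (Re \<zeta>) * w + w\<^sup>2)"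
proof -
  have quad: "(1 - W * Z) * (1 - W * cnj Z) = 1 - 2 * of_real (Re Z) * W + W\<^sup>2" if "cmod Z = 1" for W Z
  proof -
    have "Z * cnj Z = 1" using that complex_norm_square[of Z] by simp
    moreover have "Z + cnj Z = 2 * of_real (Re Z)" using complex_add_cnj by simp
    moreover have "(1 - W * Z) * (1 - W * cnj Z) = 1 - (Z + cnj Z) * W + (Z * cnj Z) * W\<^sup>2"
      by (simp add: algebra_simps power2_eq_square)
    ultimately show ?thesis by simp
  qed
  have ne: "1 - w * \<zeta> \<noteq> 0" "1 - w * cnj \<zeta> \<noteq> 0"
  proof -
    have "cmod (w * \<zeta>) < 1" "cmod (w * cnj \<zeta>) < 1" using z w by (simp_all add: norm_mult)
    then have "w * \<zeta> \<noteq> 1" "w * cnj \<zeta> \<noteq> 1" by (metis norm_one order_less_irrefl)+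
    then show "1 - w * \<zeta> \<noteq> 0" "1 - w * cnj \<zeta> \<noteq> 0" by auto
  qed
  have "((1 - w * \<zeta>) * (\<Sum>i<k. (w * \<zeta>) ^ i)) * ((1 - w * cnj \<zeta>) * (\<Sum>j<k. (w * cnj \<zeta>) ^ j)) = (1 - w ^ k * \<zeta> ^ k) * (1 - w ^ k * cnj (\<zeta> ^ k))"
    unfolding one_diff_power_eq[symmetric] by (simp add: power_mult_distrib)
  also have "\<dots> = 1 - 2 * w ^ k * of_real (Re (\<zeta> ^ k)) + w ^ (2 * k)"
    using quad[of "\<zeta> ^ k" "w ^ k"] z by (simp add: norm_power power_mult[symmetric] mult_ac)
  finally have "((1 - w * \<zeta>) * (1 - w * cnj \<zeta>)) * ((\<Sum>i<k. (w * \<zeta>) ^ i) * (\<Sum>j<k. (w * cnj \<zeta>) ^ j)) = 1 - 2 * w ^ k * of_real (Re (\<zeta> ^ k)) + w ^ (2 * k)"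
    by (simp only: mult_ac)
  moreover have "(1 - w * \<zeta>) * (1 - w * cnj \<zeta>) \<noteq> 0" using ne by simp
  ultimately show ?thesis unfolding quad[OF z, symmetric] by (simp add: nonzero_eq_divide_eq mult.commute)
qed

context kernel_weight
begin

lemma poly_kernel_unit:
  assumes "cmod \<omega> = 1" "cmod \<eta> = 1"
  shows "poly_kernel n \<eta> \<omega> = (\<Sum>i<k. if i \<le> n then (\<omega> * cnj \<eta>) ^ i * (cnj (\<omega> * cnj \<eta>) ^ ((n - i) mod k)
     * of_real (Qker \<alpha> \<beta> ((n - i) div k) (Im (\<omega> ^ k) * Im (\<eta> ^ k)) (Re (\<omega> ^ k) * Re (\<eta> ^ k)))) else 0)"
proof -
  have "poly_kernel n \<eta> \<omega> = sum (\<lambda>i. poly_kernel_term n \<eta> i \<omega>) {i \<in> {..<k}. i \<le> n}" unfolding poly_kernel_def by (rule sum.cong) auto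
  also have "\<dots> = (\<Sum>i<k. if i \<le> n then poly_kernel_term n \<eta> i \<omega> else 0)" by (rule sum.inter_filter) simp
  finally have "poly_kernel n \<eta> \<omega> = (\<Sum>i<k. if i \<le> n then poly_kernel_term n \<eta> i \<omega> else 0)" .
  moreover have "cmod (\<omega> ^ k) = 1" using assms by (simp add: norm_power)
  moreover have "cnj (\<omega> * cnj \<eta>) = cnj \<omega> * \<eta>" by simp
  ultimately show ?thesis by (simp only: poly_kernel_term_def Qpoly_eq mult.assoc)
qed

abbreviation Qker_const :: real where "Qker_const \<equiv> (7 / 16) powr (- (\<alpha> + \<beta> + 1))"

lemma Qker_unit_bound:
  assumes "cmod \<omega> = 1" "cmod \<eta> = 1"
  shows "cmod (of_real (Qker \<alpha> \<beta> m (Im (\<omega> ^ k) * Im (\<eta> ^ k)) (Re (\<omega> ^ k) * Re (\<eta> ^ k)))) \<le> Qker_const * 4 ^ m"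
  unfolding norm_of_real
  by (rule Qker_bound; (rule abs_Im_Re_mult_le_1)?) (use \<alpha>_pos \<beta>_nonneg assms in \<open>simp_all add: norm_power\<close>)

lemma poly_kernel_bound:
  assumes "cmod \<omega> = 1" "cmod \<eta> = 1"
  shows "cmod (poly_kernel n \<eta> \<omega>) \<le> real k * (Qker_const * 4 ^ n)"
proof -
  have "cmod (poly_kernel n \<eta> \<omega>) \<le> (\<Sum>i<k. Qker_const * 4 ^ n)"
    unfolding poly_kernel_unit[OF assms]
  proof (rule sum_norm_le)
    fix i
    have "Qker_const * 4 ^ ((n - i) div k) \<le> Qker_const * 4 ^ n"
      by (intro mult_left_mono power_increasing) (auto intro: order_trans[OF div_le_dividend])
    note qb = order_trans[OF Qker_unit_bound[OF assms] this]
    show "cmod (if i \<le> n then (\<omega> * cnj \<eta>) ^ i * (cnj (\<omega> * cnj \<eta>) ^ ((n - i) mod k)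
     * of_real (Qker \<alpha> \<beta> ((n - i) div k) (Im (\<omega> ^ k) * Im (\<eta> ^ k)) (Re (\<omega> ^ k) * Re (\<eta> ^ k)))) else 0) \<le> Qker_const * 4 ^ n"
      using qb assms by (simp add: norm_mult norm_power del: norm_of_real)
  qed
  then show ?thesis by simp
qed

lemma harm_kernel_bound:
  assumes "cmod \<omega> = 1" "cmod \<eta> = 1"
  shows "cmod (harm_kernel n \<eta> \<omega>) \<le> 2 * real k * Qker_const * 4 ^ n"
proof -
  have "cmod (poly_kernel (n - 2) \<eta> \<omega>) \<le> real k * (Qker_const * 4 ^ n)"
    by (rule order_trans[OF poly_kernel_bound[OF assms]]) (intro mult_left_mono power_increasing; simp)
  moreover have "cmod (harm_kernel n \<eta> \<omega>) \<le> cmod (poly_kernel n \<eta> \<omega>) + cmod (poly_kernel (n - 2) \<eta> \<omega>)"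
    unfolding harm_kernel_def using unit_cnj[OF assms(1)] norm_triangle_ineq4[of "poly_kernel n \<eta> \<omega>" "poly_kernel (n - 2) \<eta> \<omega>"] by simp
  ultimately show ?thesis using poly_kernel_bound[OF assms, of n] by simp
qed

text \<open>The sum over i in \<open>poly_kernel\<close> makes w^n \<open>poly_kernel n\<close> a
  finite combination of shifts of the series of \<open>div_mod_series\<close>, with sum A * (B * G).
  Subtracting the kernel of degree n - 2 multiplies this by 1 - w^2.\<close>

lemma harm_kernel_sums:
  assumes un: "cmod \<omega> = 1" "cmod \<eta> = 1" and w: "cmod w \<le> 1 / 8"
  shows "(\<lambda>n. w ^ n * harm_kernel n \<eta> \<omega>) sums
    ((1 - w\<^sup>2) * ((1 - 2 * w ^ k * of_real (Re (\<omega> ^ k * cnj \<eta> ^ k)) + w ^ (2 * k)) / (1 - 2 * of_real (Re (\<omega> * cnj \<eta>)) * w + w\<^sup>2))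
      * dmu \<alpha> (\<lambda>u. dmu \<beta> (\<lambda>v. (1 - 2 * w ^ k * of_real (Xk k \<omega> \<eta> u v) + w ^ (2 * k)) powr (- of_real (\<alpha> + \<beta> + 1)))))"
proof -
  define \<zeta> where "\<zeta> = \<omega> * cnj \<eta>"
  have \<zeta>: "cmod \<zeta> = 1" using un by (simp add: \<zeta>_def norm_mult)
  define q where "q = (\<lambda>m. complex_of_real (Qker \<alpha> \<beta> m (Im (\<omega> ^ k) * Im (\<eta> ^ k)) (Re (\<omega> ^ k) * Re (\<eta> ^ k))))"
  define G where "G = dmu \<alpha> (\<lambda>u. dmu \<beta> (\<lambda>v. (1 - 2 * w ^ k * of_real (Xk k \<omega> \<eta> u v) + w ^ (2 * k)) powr (- of_real (\<alpha> + \<beta> + 1))))"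
  define A where "A = (\<Sum>i<k. (w * \<zeta>) ^ i)"
  define B where "B = (\<Sum>j<k. (w * cnj \<zeta>) ^ j)"
  have G: "(\<lambda>m. q m * (w ^ k) ^ m) sums G"
  proof -
    have "cmod (w ^ k) \<le> 1 / 8"
    proof -
      have "cmod w ^ k \<le> cmod w ^ 1" using w k_pos by (intro power_decreasing) auto
      then show ?thesis using w by (simp add: norm_power)
    qed
    then show ?thesis using Qker_gf[of \<alpha> \<beta> "Im (\<omega> ^ k) * Im (\<eta> ^ k)" "Re (\<omega> ^ k) * Re (\<eta> ^ k)" "w ^ k"]
        abs_Im_Re_mult_le_1[of "\<omega> ^ k" "\<eta> ^ k"] un \<alpha>_pos \<beta>_nonneg
      by (simp add: norm_power q_def G_def Xk_def power_mult[symmetric] mult.commute[of k 2])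
  qed
  have g: "(\<lambda>n. w ^ n * (cnj \<zeta> ^ (n mod k) * q (n div k))) sums (B * G)"
    unfolding B_def by (rule div_mod_series[OF k_pos _ w _ G, where S = Qker_const])
      (use \<zeta> Qker_unit_bound[OF un] in \<open>simp_all add: q_def\<close>)
  have "(\<lambda>n. \<Sum>i<k. (w * \<zeta>) ^ i * (if i \<le> n then w ^ (n - i) * (cnj \<zeta> ^ ((n - i) mod k) * q ((n - i) div k)) else 0)) sums (\<Sum>i<k. (w * \<zeta>) ^ i * (B * G))"
    by (intro sums_sum sums_mult sums_shift_right[OF g])
  moreover have "(\<Sum>i<k. (w * \<zeta>) ^ i * (if i \<le> n then w ^ (n - i) * (cnj \<zeta> ^ ((n - i) mod k) * q ((n - i) div k)) else 0)) = w ^ n * poly_kernel n \<eta> \<omega>" for n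
    unfolding poly_kernel_unit[OF un] sum_distrib_left
  proof (rule sum.cong)
    fix i
    have "w ^ n = w ^ i * w ^ (n - i)" if "i \<le> n" using that by (simp add: power_add[symmetric])
    then show "(w * \<zeta>) ^ i * (if i \<le> n then w ^ (n - i) * (cnj \<zeta> ^ ((n - i) mod k) * q ((n - i) div k)) else 0)
      = w ^ n * (if i \<le> n then (\<omega> * cnj \<eta>) ^ i * (cnj (\<omega> * cnj \<eta>) ^ ((n - i) mod k)
     * of_real (Qker \<alpha> \<beta> ((n - i) div k) (Im (\<omega> ^ k) * Im (\<eta> ^ k)) (Re (\<omega> ^ k) * Re (\<eta> ^ k)))) else 0)"
      unfolding \<zeta>_def[symmetric] q_def by (simp add: power_mult_distrib)
  qed simp
  ultimately have KKs: "(\<lambda>n. w ^ n * poly_kernel n \<eta> \<omega>) sums (A * (B * G))"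
    unfolding A_def by (simp only: sum_distrib_right)
  have "(\<lambda>n. w ^ n * poly_kernel n \<eta> \<omega> - w\<^sup>2 * (if 2 \<le> n then w ^ (n - 2) * poly_kernel (n - 2) \<eta> \<omega> else 0)) sums (A * (B * G) - w\<^sup>2 * (A * (B * G)))"
    by (intro sums_diff sums_mult KKs sums_shift_right[OF KKs])
  moreover have "w ^ n * poly_kernel n \<eta> \<omega> - w\<^sup>2 * (if 2 \<le> n then w ^ (n - 2) * poly_kernel (n - 2) \<eta> \<omega> else 0) = w ^ n * harm_kernel n \<eta> \<omega>" for n
  proof -
    have "w ^ n = w\<^sup>2 * w ^ (n - 2)" if "2 \<le> n" using that by (simp only: power_add[symmetric] le_add_diff_inverse)
    then show ?thesis unfolding harm_kernel_def using unit_cnj[OF un(1)] by (simp add: right_diff_distrib)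
  qed
  moreover have "A * (B * G) - w\<^sup>2 * (A * (B * G)) = (1 - w\<^sup>2) * (A * B) * G" by (simp add: algebra_simps)
  moreover have "A * B = (1 - 2 * w ^ k * of_real (Re (\<omega> ^ k * cnj \<eta> ^ k)) + w ^ (2 * k)) / (1 - 2 * of_real (Re (\<omega> * cnj \<eta>)) * w + w\<^sup>2)"
    unfolding A_def B_def geometric_product[OF \<zeta> order.strict_trans1[OF w], simplified] by (simp only: \<zeta>_def power_mult_distrib)
  ultimately show ?thesis unfolding G_def by (simp only:)
qed

end

section \<open>The transform of the Dunkl kernel\<close>

lemma besselJ_measurable [measurable]: "besselJ \<nu> \<in> borel_measurable borel"
  unfolding besselJ_def by measurable

context kernel_weight
begin

text \<open>Factors independent of u and v leave the integrals. The two occurrences of 1 - w^(2k)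
  cancel; |w| < 1 keeps them from being 0.\<close>

lemma dmu_f_gen:
  assumes w: "cmod (lap_w b s) < 1"
  shows "dmu \<alpha> (\<lambda>u. dmu \<beta> (\<lambda>v. f_gen k L (\<alpha> + \<beta> + 1) \<omega> \<eta> b (Xk k \<omega> \<eta> u v) s))
    = of_real (2 powr L) / (lap_r b s * lap_R b s powr of_real L) * ((1 - (lap_w b s)\<^sup>2) *
      ((1 - 2 * lap_w b s ^ k * of_real (Re (\<omega> ^ k * cnj \<eta> ^ k)) + lap_w b s ^ (2 * k)) / (1 - 2 * of_real (Re (\<omega> * cnj \<eta>)) * lap_w b s + (lap_w b s)\<^sup>2))
      * dmu \<alpha> (\<lambda>u. dmu \<beta> (\<lambda>v. (1 - 2 * lap_w b s ^ k * of_real (Xk k \<omega> \<eta> u v) + lap_w b s ^ (2 * k)) powr (- of_real (\<alpha> + \<beta> + 1)))))"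
proof -
  have cancel: "c * (a / M) * q * (M / Q) = (c * (a * q)) * inverse Q" if "M \<noteq> 0" for c a q M Q :: complex
    using that by (cases "Q = 0") (simp_all add: field_simps)
  have "cmod (lap_w b s ^ (2 * k)) < 1"
    unfolding norm_power using w k_pos by (intro power_less_one_iff[THEN iffD2]) auto
  then have M: "1 - lap_w b s ^ (2 * k) \<noteq> 0" by auto
  show ?thesis
    unfolding f_gen_def Let_def cancel[OF M] powr_minus[symmetric] dmu_cmult(1) by (simp only: mult.assoc)
qed

text \<open>In the j-th term b^(-L) meets b^(j+L) / R^(j+L), and with (- i)^j this gives w^j / R^L.
  The condition Re s > 8 b yields |w| \<le> 1/8 for the generating function and makes the L1 norms
  of the terms geometric.\<close>

lemma laplace_dunkl_E:
  assumes z: "z1 \<noteq> 0" "z2 \<noteq> 0" and L: "L > 0"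
    and \<omega>_def: "\<omega> = z1 / of_real (cmod z1)" and \<eta>_def: "\<eta> = z2 / of_real (cmod z2)"
    and b_def: "b = cmod z1 * cmod z2" and s: "Re s > 8 * b"
  shows "laplace_exists (dunkl_E N kap ups L z1 z2) s"
    and "laplace (dunkl_E N kap ups L z1 z2) s
      = of_real (Gamma (L + 1)) * dmu \<alpha> (\<lambda>u. dmu \<beta> (\<lambda>v. f_gen k L (\<alpha> + \<beta> + 1) \<omega> \<eta> b (Xk k \<omega> \<eta> u v) s))"
proof -
  have b: "b > 0" using z by (simp add: b_def)
  have un: "cmod \<omega> = 1" "cmod \<eta> = 1" using z by (simp_all add: \<omega>_def \<eta>_def norm_divide)
  define \<sigma> where "\<sigma> = Re s"
  have \<sigma>: "\<sigma> > 0" "8 * b < \<sigma>" using s b by (simp_all add: \<sigma>_def)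
  have s4: "Re s > 4 * b" and s1: "Re s > b" using s b by simp_all
  note lp = lap_props[OF s1 b]
  have w: "cmod (lap_w b s) \<le> 1 / 8"
    by (rule order_trans[OF lp(5)]) (use s b in \<open>simp add: field_simps\<close>)
  define GF where "GF = (1 - (lap_w b s)\<^sup>2) *
      ((1 - 2 * lap_w b s ^ k * of_real (Re (\<omega> ^ k * cnj \<eta> ^ k)) + lap_w b s ^ (2 * k)) / (1 - 2 * of_real (Re (\<omega> * cnj \<eta>)) * lap_w b s + (lap_w b s)\<^sup>2))
      * dmu \<alpha> (\<lambda>u. dmu \<beta> (\<lambda>v. (1 - 2 * lap_w b s ^ k * of_real (Xk k \<omega> \<eta> u v) + lap_w b s ^ (2 * k)) powr (- of_real (\<alpha> + \<beta> + 1))))"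
  have GF: "(\<lambda>n. lap_w b s ^ n * harm_kernel n \<eta> \<omega>) sums GF" unfolding GF_def by (rule harm_kernel_sums[OF un w])
  define c where "c = (\<lambda>j. (- \<i>) ^ j * of_real (b powr (- L)) * harm_kernel j \<eta> \<omega>)"
  define J where "J = (\<lambda>j t. exp (- s * of_real t) * complex_of_real (besselJ (real j + L) (b * t)))"
  define f where "f = (\<lambda>j t. indicator {0..} t *\<^sub>R (c j * J j t))"
  \<comment> \<open>The Bessel bound asks for an integer above the order j + L.\<close>
  define n0 where "n0 = nat \<lceil>L\<rceil>"
  have "real j + L > 0" "real j + L \<le> real (j + n0)" for j
    using L by (auto simp: n0_def)
  note bl = bessel_Laplace[OF b this(1) s4 this(2)]
  have int: "integrable lborel (f j)" for j
    using set_integrable_mult_right[of "c j" lborel "{0..}" "J j"] bl(1)[of j]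
    unfolding set_integrable_def f_def J_def by simp
  define D where "D = b powr (- L) * (2 * real k * Qker_const) * (2 * 2 ^ n0 * (b / (2 * \<sigma>)) powr L / \<sigma>)"
  \<comment> \<open>The ratio collects 4^j from the kernels, 2^j from the Bessel bound and (b / (2
    \<sigma>))^j; their product is (4 b / \<sigma>)^j with 4 b / \<sigma> < 1/2.\<close>
  have nb: "(\<integral>t. norm (f j t) \<partial>lborel) \<le> D * (4 * b / \<sigma>) ^ j" for j
  proof -
    have "norm (f j t) = cmod (c j) * (indicator {0..} t *\<^sub>R norm (J j t))" for t
      by (simp add: f_def norm_mult)
    then have "(\<integral>t. norm (f j t) \<partial>lborel) = cmod (c j) * (LINT t:{0..}|lborel. norm (J j t))"
      unfolding set_lebesgue_integral_def by simp
    also have "\<dots> \<le> (b powr (- L) * (2 * real k * Qker_const * 4 ^ j)) * (2 * 2 ^ (j + n0) * (b / (2 * \<sigma>)) powr (real j + L) / \<sigma>)"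
    proof (rule mult_mono)
      show "cmod (c j) \<le> b powr (- L) * (2 * real k * Qker_const * 4 ^ j)"
        using harm_kernel_bound[OF un, of j] by (simp add: c_def norm_mult norm_power mult_left_mono)
      show "(LINT t:{0..}|lborel. norm (J j t)) \<le> 2 * 2 ^ (j + n0) * (b / (2 * \<sigma>)) powr (real j + L) / \<sigma>"
        unfolding J_def \<sigma>_def by (rule bl(3))
      show "0 \<le> (LINT t:{0..}|lborel. norm (J j t))"
        unfolding set_lebesgue_integral_def by (intro integral_nonneg_AE) simp
    qed simp
    also have "(b / (2 * \<sigma>)) powr (real j + L) = (b / (2 * \<sigma>)) ^ j * (b / (2 * \<sigma>)) powr L"
      using b \<sigma> by (simp add: powr_add powr_realpow)
    also have "b powr (- L) * (2 * real k * Qker_const * 4 ^ j) * (2 * 2 ^ (j + n0) * ((b / (2 * \<sigma>)) ^ j * (b / (2 * \<sigma>)) powr L) / \<sigma>)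
       = D * (4 ^ j * 2 ^ j * (b / (2 * \<sigma>)) ^ j)"
      by (simp add: D_def power_add)
    also have "(4::real) ^ j * 2 ^ j * (b / (2 * \<sigma>)) ^ j = (4 * b / \<sigma>) ^ j"
      unfolding power_mult_distrib[symmetric] by simp
    finally show ?thesis .
  qed
  have sm: "summable (\<lambda>j. \<integral>t. norm (f j t) \<partial>lborel)"
  proof (rule summable_comparison_test'[where N = 0])
    show "summable (\<lambda>j. D * (4 * b / \<sigma>) ^ j)"
      using b \<sigma> by (intro summable_mult summable_geometric) (simp add: field_simps)
    show "norm (\<integral>t. norm (f j t) \<partial>lborel) \<le> D * (4 * b / \<sigma>) ^ j" for j
      using nb[of j] by simp
  qed
  note SB = sums_Bochner_integral[OF int sm]
  define Cst where "Cst = complex_of_real (2 powr L * Gamma (L + 1))"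
  define E where "E = dunkl_E N kap ups L z1 z2"
  have E: "E t = Cst * (\<Sum>j. c j * of_real (besselJ (real j + L) (b * t)))" for t
    unfolding E_def dunkl_E_def Let_def \<omega>_def[symmetric] \<eta>_def[symmetric] b_def[symmetric] repr_kernel_eq[OF un(2)] Cst_def c_def of_real_mult[of "b powr (- L)"]
    by (simp only: mult_ac)
  have Em [measurable]: "E \<in> borel_measurable borel"
    unfolding E[abs_def] by measurable
  \<comment> \<open>Convergence of the series at a given t comes from the L1 norms, hence only for
    almost every t; both integrals ignore the rest.\<close>
  have ae: "AE t in lborel. Cst * (\<Sum>j. f j t) = indicator {0..} t *\<^sub>R (exp (- s * of_real t) * E t)"
    using SB(1)
  proof eventually_elim
    case (elim t)
    show ?case
    proof (cases "t \<ge> 0")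
      case True
      let ?e = "exp (- s * of_real t)" and ?g = "\<lambda>j. c j * complex_of_real (besselJ (real j + L) (b * t))"
      have fe: "f j t = ?e * ?g j" for j using True by (simp add: f_def J_def)
      from summable_norm_cancel[OF elim] have "summable (\<lambda>j. ?e * ?g j)" by (simp only: fe)
      then have "summable ?g" by (simp add: summable_cmult_iff)
      then have "(\<Sum>j. f j t) = ?e * suminf ?g" unfolding fe by (rule suminf_mult)
      then show ?thesis using True by (simp add: E)
    qed (simp add: f_def)
  qed
  show "laplace_exists (dunkl_E N kap ups L z1 z2) s"
    unfolding laplace_exists_def E_def[symmetric] set_integrable_def
    by (rule integrable_cong_AE_imp[OF integrable_mult_right[OF SB(2)] _ ae]) measurable
  have "laplace E s = Cst * (\<integral>t. (\<Sum>j. f j t) \<partial>lborel)"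
  proof -
    have "laplace E s = (\<integral>t. Cst * (\<Sum>j. f j t) \<partial>lborel)"
      unfolding laplace_def set_lebesgue_integral_def
      by (rule integral_cong_AE) (use ae borel_measurable_integrable[OF SB(2)] in auto)
    then show ?thesis using SB(2) by simp
  qed
  also have "(\<integral>t. (\<Sum>j. f j t) \<partial>lborel) = 1 / (lap_r b s * lap_R b s powr of_real L) * GF"
  proof (rule sums_unique2[OF SB(3)])
    have "integral\<^sup>L lborel (f j) = 1 / (lap_r b s * lap_R b s powr of_real L) * (lap_w b s ^ j * harm_kernel j \<eta> \<omega>)" for j
    proof -
      have "integral\<^sup>L lborel (f j) = c j * (LINT t:{0..}|lborel. J j t)"
        unfolding f_def set_lebesgue_integral_def by (simp add: mult_scaleR_right[symmetric] del: mult_scaleR_right)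
      also have "\<dots> = c j * (of_real (b powr (real j + L)) / (lap_r b s * lap_R b s powr of_real (real j + L)))"
        unfolding J_def by (simp only: bl(2))
      also have "lap_R b s powr of_real (real j + L) = lap_R b s ^ j * lap_R b s powr of_real L"
        unfolding of_real_add of_real_of_nat_eq powr_add using lp(2) by (simp add: powr_nat')
      also have "b powr (real j + L) = b ^ j * b powr L"
        using b by (simp add: powr_add powr_realpow)
      also have "c j * (of_real (b ^ j * b powr L) / (lap_r b s * (lap_R b s ^ j * lap_R b s powr of_real L)))
        = of_real (b powr (- L) * b powr L) * (1 / (lap_r b s * lap_R b s powr of_real L) * ((- \<i> * of_real b) ^ j / lap_R b s ^ j * harm_kernel j \<eta> \<omega>))"
        unfolding c_def power_mult_distrib of_real_mult of_real_power by (simp add: mult_ac)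
      also have "b powr (- L) * b powr L = 1" using b by (simp add: powr_add[symmetric])
      also have "(- \<i> * of_real b) ^ j / lap_R b s ^ j = lap_w b s ^ j" by (simp only: lap_w_def power_divide)
      finally show ?thesis by (simp only: of_real_1 mult_1_left)
    qed
    then show "(\<lambda>j. integral\<^sup>L lborel (f j)) sums (1 / (lap_r b s * lap_R b s powr of_real L) * GF)"
      using sums_mult[OF GF] by (simp only:)
  qed
  also have "Cst * (1 / (lap_r b s * lap_R b s powr of_real L) * GF)
    = of_real (Gamma (L + 1)) * (of_real (2 powr L) / (lap_r b s * lap_R b s powr of_real L) * GF)"
    by (simp add: Cst_def)
  also have "of_real (2 powr L) / (lap_r b s * lap_R b s powr of_real L) * GF
    = dmu \<alpha> (\<lambda>u. dmu \<beta> (\<lambda>v. f_gen k L (\<alpha> + \<beta> + 1) \<omega> \<eta> b (Xk k \<omega> \<eta> u v) s))"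
    unfolding GF_def by (rule dmu_f_gen[symmetric]) (use w in simp)
  finally show "laplace (dunkl_E N kap ups L z1 z2) s
      = of_real (Gamma (L + 1)) * dmu \<alpha> (\<lambda>u. dmu \<beta> (\<lambda>v. f_gen k L (\<alpha> + \<beta> + 1) \<omega> \<eta> b (Xk k \<omega> \<eta> u v) s))"
    unfolding E_def .
qed

end

section \<open>The dihedral weights as products of sines\<close>

text \<open>Two monic polynomials of degree k that agree at the k roots of unity are equal.\<close>

lemma prod_roots_of_unity:
  fixes z :: complex
  assumes "k \<ge> 1"
  shows "z ^ k - 1 = (\<Prod>m<k. z - cis (2 * pi * real m / real k))"
proof -
  let ?w = "\<lambda>m. cis (2 * pi * real m / real k)"
  have bij: "bij_betw ?w {..<k} {z. z ^ k = 1}" by (rule Complex.bij_betw_roots_unity) (use assms in simp)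
  let ?P = "\<Prod>m<k. [:- ?w m, 1:]" and ?Q = "monom 1 k - 1 :: complex poly"
  have d: "degree ?P = k" "coeff ?P k = 1"
    using lead_coeff_prod[of "\<lambda>m. [:- ?w m, 1:]" "{..<k}"] by (simp_all add: degree_prod_sum_eq)
  have "?P = ?Q"
  proof (rule poly_eqI_degree_lead_coeff[where n = k and A = "{z. z ^ k = 1}"])
    show "coeff ?P k = coeff ?Q k" using d assms by simp
    show "degree ?Q \<le> k" by (rule degree_diff_le) (simp_all add: degree_monom_le)
    show "k \<le> card {z::complex. z ^ k = 1}" using bij_betw_same_card[OF bij] by simp
    show "poly ?P z = poly ?Q z" if "z \<in> {z. z ^ k = 1}" for z
    proof -
      from that obtain m where "m < k" "z = ?w m" using bij by (auto simp: bij_betw_def)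
      with that show ?thesis by (auto simp: poly_prod poly_monom intro: prod_zero)
    qed
  qed (simp add: d)
  then have "poly ?P z = poly ?Q z" by simp
  then show ?thesis by (simp add: poly_prod poly_monom)
qed

lemma cmod_cis_diff: "cmod (cis (2 * x) - cis (2 * y)) = 2 * \<bar>sin (x - y)\<bar>"
proof -
  have "cis (2 * x) - cis (2 * y) = cis (x + y) * (cis (x - y) - cis (- (x - y)))"
    by (simp add: right_diff_distrib cis_mult)
  moreover have "cis d - cis (- d) = 2 * \<i> * of_real (sin d)" for d
    by (simp add: complex_eq_iff)
  ultimately show ?thesis by (simp only: norm_mult norm_cis norm_ii norm_numeral norm_of_real mult_1_left mult_1_right)
qed

text \<open>Evaluate the factorisation of z^k - 1 at z = cis (2 \<theta>) and take norms: every
  chord is twice a sine, on the left once and on the right k times, which leaves 2^(k - 1).\<close>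

lemma abs_sin_multiple:
  assumes k: "k \<ge> 1"
  shows "\<bar>sin (real k * \<theta>)\<bar> = 2 ^ (k - 1) * (\<Prod>m<k. \<bar>sin (\<theta> - pi * real m / real k)\<bar>)"
proof -
  have "2 * \<bar>sin (real k * \<theta>)\<bar> = cmod (cis (2 * \<theta>) ^ k - 1)"
    using cmod_cis_diff[of "real k * \<theta>" 0] by (simp add: Complex.DeMoivre mult.left_commute)
  also have "\<dots> = (\<Prod>m<k. cmod (cis (2 * \<theta>) - cis (2 * (pi * real m / real k))))"
    unfolding prod_roots_of_unity[OF k] prod_norm[symmetric] by (simp add: mult.assoc)
  also have "\<dots> = 2 ^ k * (\<Prod>m<k. \<bar>sin (\<theta> - pi * real m / real k)\<bar>)"
    unfolding cmod_cis_diff prod.distrib by simp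
  also have "(2::real) ^ k = 2 * 2 ^ (k - 1)" using k by (simp add: power_Suc[symmetric])
  finally show ?thesis by simp
qed

lemma prod_abs_sin_powr:
  assumes "k \<ge> 1"
  shows "\<bar>sin (real k * \<theta>)\<bar> powr a = (2 ^ (k - 1)) powr a * (\<Prod>m<k. \<bar>sin (\<theta> - pi * real m / real k)\<bar> powr a)"
  unfolding abs_sin_multiple[OF assms] by (simp add: powr_mult prod_nonneg prod_powr_distrib)

lemma ups_cis_sin: "cmod ((cis \<theta> ^ k - cnj (cis \<theta>) ^ k) / (2 * \<i>)) = \<bar>sin (real k * \<theta>)\<bar>"
proof -
  have "cis \<theta> ^ k - cnj (cis \<theta>) ^ k = 2 * \<i> * of_real (sin (real k * \<theta>))"
    by (simp add: Complex.DeMoivre cis_cnj complex_eq_iff)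
  then show ?thesis by simp
qed

lemma ups_cis_cos: "cmod ((cis \<theta> ^ k + cnj (cis \<theta>) ^ k) / 2) = \<bar>cos (real k * \<theta>)\<bar>"
proof -
  have "cis \<theta> ^ k + cnj (cis \<theta>) ^ k = 2 * of_real (cos (real k * \<theta>))"
    by (simp add: Complex.DeMoivre cis_cnj complex_eq_iff)
  then show ?thesis by simp
qed

lemma prod_even_odd: "(\<Prod>j<2 * k. g j) = (\<Prod>m<k. g (2 * m)) * (\<Prod>m<k. g (2 * m + 1))" for k :: nat
  by (induction k) (simp_all add: mult_ac)

lemma abs_sin_cos_reflect:
  fixes j :: nat
  shows "\<bar>sin (pi * real j - x)\<bar> = \<bar>sin x\<bar>" "\<bar>cos (pi * real j - x)\<bar> = \<bar>cos x\<bar>"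
proof -
  have "\<bar>cos (pi * real j)\<bar> = 1" "sin (pi * real j) = 0" by (simp_all add: mult.commute[of pi])
  then show "\<bar>sin (pi * real j - x)\<bar> = \<bar>sin x\<bar>" "\<bar>cos (pi * real j - x)\<bar> = \<bar>cos x\<bar>"
    by (simp_all add: sin_diff cos_diff abs_mult)
qed

text \<open>Mirrors of even index supply the factors of sin (k \<theta>). Those of odd index supply
  the factors of cos (k \<theta>), which up to sign is sin (k \<theta>) with \<theta> moved by
  pi/(2k).\<close>

lemma kernel_weight_even:
  assumes k: "k \<ge> 1" and ab: "\<alpha> > 0" "\<beta> > 0"
  shows "kernel_weight (2 * k) (kap_even \<alpha> \<beta>) (ups_even k \<alpha> \<beta>) ((2 ^ (k - 1)) powr (2 * \<alpha>) * (2 ^ (k - 1)) powr (2 * \<beta>)) k \<alpha> \<beta>"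
proof
  have W: "ups_even k \<alpha> \<beta> (cis \<theta>) = \<bar>sin (real k * \<theta>)\<bar> powr (2 * \<alpha>) * \<bar>cos (real k * \<theta>)\<bar> powr (2 * \<beta>)" for \<theta>
    by (simp only: ups_even_def ups_cis_sin ups_cis_cos)
  show "ups_even k \<alpha> \<beta> (cis \<theta>) = \<bar>sin (real k * \<theta>)\<bar> powr (2 * \<alpha>) * (if \<beta> = 0 then 1 else \<bar>cos (real k * \<theta>)\<bar> powr (2 * \<beta>))" for \<theta>
    using ab by (simp add: W)
  show "ups_even k \<alpha> \<beta> (cis \<theta>) = (2 ^ (k - 1)) powr (2 * \<alpha>) * (2 ^ (k - 1)) powr (2 * \<beta>) * (\<Prod>j<2 * k. \<bar>sin (\<theta> - dih_theta (2 * k) j)\<bar> powr (2 * kap_even \<alpha> \<beta> j))" for \<theta>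
  proof -
    have c: "\<bar>cos (real k * \<theta>)\<bar> = \<bar>sin (real k * (\<theta> - pi / (2 * real k)))\<bar>"
      using k by (simp add: right_diff_distrib sin_diff)
    have th: "dih_theta (2 * k) (2 * m) = pi * real m / real k"
      "\<theta> - dih_theta (2 * k) (2 * m + 1) = (\<theta> - pi / (2 * real k)) - pi * real m / real k" for m
      using k by (simp_all add: dih_theta_def field_simps)
    have kp: "kap_even \<alpha> \<beta> (2 * m) = \<alpha>" "kap_even \<alpha> \<beta> (2 * m + 1) = \<beta>" for m by (simp_all add: kap_even_def)
    show ?thesis unfolding W c prod_abs_sin_powr[OF k] prod_even_odd th kp by (simp only: mult_ac)
  qed
  show "ups_even k \<alpha> \<beta> (cis (2 * dih_theta (2 * k) j - \<theta>)) = ups_even k \<alpha> \<beta> (cis \<theta>)" for j \<theta>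
  proof -
    have "real k * (2 * dih_theta (2 * k) j - \<theta>) = pi * real j - real k * \<theta>"
      using k by (simp add: dih_theta_def field_simps)
    then show ?thesis unfolding W by (simp only: abs_sin_cos_reflect)
  qed
qed (use assms in \<open>auto simp: kap_even_def\<close>)

text \<open>A single class of mirrors is the case \<beta> = 0, where the cosine factor of the weight
  is 1.\<close>

lemma kernel_weight_odd:
  assumes k: "k \<ge> 1" and a: "\<alpha> > 0"
  shows "kernel_weight k (\<lambda>_. \<alpha>) (ups_odd k \<alpha>) ((2 ^ (k - 1)) powr (2 * \<alpha>)) k \<alpha> 0"
proof
  have W: "ups_odd k \<alpha> (cis \<theta>) = \<bar>sin (real k * \<theta>)\<bar> powr (2 * \<alpha>)" for \<theta>
    by (simp only: ups_odd_def ups_cis_sin)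
  show "ups_odd k \<alpha> (cis \<theta>) = \<bar>sin (real k * \<theta>)\<bar> powr (2 * \<alpha>) * (if (0::real) = 0 then 1 else \<bar>cos (real k * \<theta>)\<bar> powr (2 * 0))" for \<theta>
    by (simp add: W)
  show "ups_odd k \<alpha> (cis \<theta>) = (2 ^ (k - 1)) powr (2 * \<alpha>) * (\<Prod>j<k. \<bar>sin (\<theta> - dih_theta k j)\<bar> powr (2 * \<alpha>))" for \<theta>
    unfolding W dih_theta_def by (rule prod_abs_sin_powr[OF k])
  show "ups_odd k \<alpha> (cis (2 * dih_theta k j - \<theta>)) = ups_odd k \<alpha> (cis \<theta>)" for j \<theta>
  proof -
    have "real k * (2 * dih_theta k j - \<theta>) = pi * real (2 * j) - real k * \<theta>"
      using k by (simp add: dih_theta_def field_simps)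
    then show ?thesis unfolding W by (simp only: abs_sin_cos_reflect)
  qed
qed (use assms in auto)

theorem theorem16:
  "(\<forall>(k::nat) (\<alpha>::real) (\<beta>::real) (z1::complex) (z2::complex).
      1 \<le> k \<and> 0 < \<alpha> \<and> 0 < \<beta> \<and> z1 \<noteq> 0 \<and> z2 \<noteq> 0 \<longrightarrow>
      (let K = real k * (\<alpha> + \<beta>);
           E = dunkl_E (2*k) (kap_even \<alpha> \<beta>) (ups_even k \<alpha> \<beta>) K z1 z2;
           \<omega> = z1 / of_real (cmod z1); \<eta> = z2 / of_real (cmod z2); b = cmod z1 * cmod z2
       in \<exists>c::real. \<forall>s::complex. c < Re s \<longrightarrow>
            laplace_exists E s \<and>
            laplace E s = of_real (Gamma (K + 1)) *
              (LINT u:{-1..1}|lborel. LINT v:{-1..1}|lborel.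
                 of_real (mu_dens \<alpha> u * mu_dens \<beta> v) * f_I2k k \<alpha> \<beta> \<omega> \<eta> b u v s)))
   \<and>
   (\<forall>(k::nat) (\<alpha>::real) (z1::complex) (z2::complex).
      odd k \<and> 0 < \<alpha> \<and> z1 \<noteq> 0 \<and> z2 \<noteq> 0 \<longrightarrow>
      (let K = real k * \<alpha>;
           E = dunkl_E k (\<lambda>_. \<alpha>) (ups_odd k \<alpha>) K z1 z2;
           \<omega> = z1 / of_real (cmod z1); \<eta> = z2 / of_real (cmod z2); b = cmod z1 * cmod z2
       in \<exists>c::real. \<forall>s::complex. c < Re s \<longrightarrow>
            laplace_exists E s \<and>
            laplace E s = of_real (Gamma (K + 1)) *
              (LINT u:{-1..1}|lborel. of_real (mu_dens \<alpha> u) * g_Ik k \<alpha> \<omega> \<eta> b u s)))"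
proof (intro conjI allI impI)
  fix k :: nat and \<alpha> \<beta> :: real and z1 z2 :: complex
  assume a: "1 \<le> k \<and> 0 < \<alpha> \<and> 0 < \<beta> \<and> z1 \<noteq> 0 \<and> z2 \<noteq> 0"
  then interpret kernel_weight "2 * k" "kap_even \<alpha> \<beta>" "ups_even k \<alpha> \<beta>" "(2 ^ (k - 1)) powr (2 * \<alpha>) * (2 ^ (k - 1)) powr (2 * \<beta>)" k \<alpha> \<beta>
    by (intro kernel_weight_even) auto
  have L: "real k * (\<alpha> + \<beta>) > 0" using a by simp
  have z: "z1 \<noteq> 0" "z2 \<noteq> 0" using a by auto
  have d: "dmu \<alpha> (\<lambda>u. dmu \<beta> (F u)) = (LINT u:{-1..1}|lborel. LINT v:{-1..1}|lborel. of_real (mu_dens \<alpha> u * mu_dens \<beta> v) * F u v)" for F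
    using a unfolding dmu_def by (simp add: mult.assoc)
  \<comment> \<open>The half-plane wanted in the conclusion is Re s > 8 b.\<close>
  note E = laplace_dunkl_E[OF z L refl refl refl]
  show "let K = real k * (\<alpha> + \<beta>);
           E = dunkl_E (2*k) (kap_even \<alpha> \<beta>) (ups_even k \<alpha> \<beta>) K z1 z2;
           \<omega> = z1 / of_real (cmod z1); \<eta> = z2 / of_real (cmod z2); b = cmod z1 * cmod z2
       in \<exists>c::real. \<forall>s::complex. c < Re s \<longrightarrow>
            laplace_exists E s \<and>
            laplace E s = of_real (Gamma (K + 1)) *
              (LINT u:{-1..1}|lborel. LINT v:{-1..1}|lborel.
                 of_real (mu_dens \<alpha> u * mu_dens \<beta> v) * f_I2k k \<alpha> \<beta> \<omega> \<eta> b u v s)"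
    unfolding Let_def f_I2k_def d[symmetric] using E by blast
next
  fix k :: nat and \<alpha> :: real and z1 z2 :: complex
  assume a: "odd k \<and> 0 < \<alpha> \<and> z1 \<noteq> 0 \<and> z2 \<noteq> 0"
  then have k: "k \<ge> 1" by (cases k) auto
  interpret kernel_weight k "\<lambda>_. \<alpha>" "ups_odd k \<alpha>" "(2 ^ (k - 1)) powr (2 * \<alpha>)" k \<alpha> 0
    using a k by (intro kernel_weight_odd) auto
  have L: "real k * \<alpha> > 0" using a k by simp
  have z: "z1 \<noteq> 0" "z2 \<noteq> 0" using a by auto
  \<comment> \<open>With parameter 0 the inner integral is evaluation at v = 1, which turns X(u, v)
    into X(u, 1).\<close>
  have d: "dmu \<alpha> (\<lambda>u. dmu 0 (F u)) = (LINT u:{-1..1}|lborel. of_real (mu_dens \<alpha> u) * F u 1)" for F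
    using a unfolding dmu_def by simp
  note E = laplace_dunkl_E[OF z L refl refl refl, unfolded d add_0_right]
  show "let K = real k * \<alpha>;
           E = dunkl_E k (\<lambda>_. \<alpha>) (ups_odd k \<alpha>) K z1 z2;
           \<omega> = z1 / of_real (cmod z1); \<eta> = z2 / of_real (cmod z2); b = cmod z1 * cmod z2
       in \<exists>c::real. \<forall>s::complex. c < Re s \<longrightarrow>
            laplace_exists E s \<and>
            laplace E s = of_real (Gamma (K + 1)) *
              (LINT u:{-1..1}|lborel. of_real (mu_dens \<alpha> u) * g_Ik k \<alpha> \<omega> \<eta> b u s)"
    unfolding Let_def g_Ik_def using E by blast
qed

end
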